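(* The chromatic number of the plane satisfies $$\chi(\mathbb{R}^2)\ge 5.$$ That is, there is no function $c:\mathbb{R}^2\to\{1,2,3,4\}$ such that $c(x)\neq c(y)$ for all $x,y\in\mathbb{R}^2$ with $\|x-y\|=1$.
   Context: $\chi(\mathbb{R}^2)$ denotes the chromatic number of the plane: the least number of colors in a coloring of all points of the Euclidean plane $\mathbb{R}^2$ such that any two points at Euclidean distance exactly $1$ receive different colors. Here $\|\cdot\|$ is the Euclidean norm. *)

theory Defs
  imports "HOL-Analysis.Analysis" "HOL-Library.Extended_Nat"
begin

definition plane_coloring :: "nat \<Rightarrow> (real ^ 2 \<Rightarrow> nat) \<Rightarrow> bool" where
  "plane_coloring n c \<longleftrightarrow>
     (\<forall>x. c x \<in> {1..n}) \<and> (\<forall>x y. norm (x - y) = 1 \<longrightarrow> c x \<noteq> c y)"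

text \<open>
  The infimum in \<^typ>\<open>enat\<close> of a nonempty set is its least element; the value would be
  \<open>\<infinity>\<close> only if no finite coloring of the plane existed.
\<close>

definition chromatic_number_plane :: enat where
  "chromatic_number_plane = Inf {enat n | n. \<exists>c. plane_coloring n c}"

end

theory Submission
  imports Defs
begin

text \<open>
  Suppose the plane has a proper colouring with four colours. Two finite unit distance graphs show
  that no point has an inscribed equilateral triangle of one colour on the unit circle around it: one
  treats the case that the opposite triangle of the regular hexagon is monochromatic too, the other
  the case that it is not. So no equilateral triangle of side \<open>\<surd>3\<close> is monochromatic. Take a piece
  of the unit triangular lattice together with its rotation by the angle that moves points at
  distance 2 from the centre by exactly 1. Without monochromatic triangles of side \<open>\<surd>3\<close> this
  graph has no colouring in which two points at distance 4, on opposite sides of the centre, differ.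
  So any two points at distance 4 have the same colour, which contradicts the isosceles triangle
  with sides 4, 4, 1.

  The three finite refutations were found by a clause learning search.
\<close>

section \<open>Replaying certificates of non-colourability\<close>

text \<open>Merging the three arguments into a single graph would require copies of the two hexagon
  graphs around every triangle in use. The split avoids this: a refutation applies to every
  congruent copy of its graph and to every renaming of the colours, so the third search may take the
  absence of monochromatic triangles as given. Two hexagon graphs suffice because the three points
  opposite to a monochromatic triple are adjacent to the centre and to the triple. They share two
  colours, so two of them agree, and a rotation decides which two. Triangles of side sqrt 3 enter
  because their circumradius is 1: each of them is such a triple around its circumcentre. The
  certificates are long and are checked by rewriting alone. This dictates the form of the checker,
  and also the integer coordinates in which unit distance is a matter of arithmetic on
  numerals.\<close>

datatype 'a trie = Tip | Fork "'a trie" "'a option" "'a trie"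

text \<open>Keys are binary numerals read from the lowest bit. A search follows the constructors of
  \<open>num\<close> and needs neither comparison nor arithmetic.\<close>

primrec lookup :: "num \<Rightarrow> 'a trie \<Rightarrow> 'a option" where
  "lookup k Tip = None"
| "lookup k (Fork l x r) =
     (case k of num.One \<Rightarrow> x | num.Bit0 k' \<Rightarrow> lookup k' l | num.Bit1 k' \<Rightarrow> lookup k' r)"

primrec update :: "num \<Rightarrow> 'a \<Rightarrow> 'a trie \<Rightarrow> 'a trie" where
  "update num.One x t = (case t of Tip \<Rightarrow> Fork Tip (Some x) Tip | Fork l y r \<Rightarrow> Fork l (Some x) r)"
| "update (num.Bit0 k) x t =
     (case t of Tip \<Rightarrow> Fork (update k x Tip) None Tip | Fork l y r \<Rightarrow> Fork (update k x l) y r)"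
| "update (num.Bit1 k) x t =
     (case t of Tip \<Rightarrow> Fork Tip None (update k x Tip) | Fork l y r \<Rightarrow> Fork l y (update k x r))"

text \<open>\<open>lookup\<close> recurses on the trie and \<open>update\<close> on the key, and
  each leaves a case distinction on the other argument. Resolving it beforehand gives equations that
  match on constructors only; \<open>update_simps\<close> does the same.\<close>

lemma lookup_simps:
  "lookup num.One (Fork l x r) = x"
  "lookup (num.Bit0 k) (Fork l x r) = lookup k l"
  "lookup (num.Bit1 k) (Fork l x r) = lookup k r"
  "lookup k Tip = None"
  by simp_all

lemma update_simps:
  "update num.One x Tip = Fork Tip (Some x) Tip"
  "update (num.Bit0 k) x Tip = Fork (update k x Tip) None Tip"
  "update (num.Bit1 k) x Tip = Fork Tip None (update k x Tip)"
  "update num.One x (Fork l y r) = Fork l (Some x) r"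
  "update (num.Bit0 k) x (Fork l y r) = Fork (update k x l) y r"
  "update (num.Bit1 k) x (Fork l y r) = Fork l y (update k x r)"
  by simp_all

lemma lookup_update: "lookup k (update j x t) = (if k = j then Some x else lookup k t)"
proof (induction j arbitrary: k t)
  case One then show ?case by (cases k; cases t) auto
next
  case (Bit0 j) then show ?case by (cases k; cases t) auto
next
  case (Bit1 j) then show ?case by (cases k; cases t) auto
qed

section \<open>Palettes: the colours that a vertex may still have\<close>

datatype colour = C0 | C1 | C2 | C3

datatype palette = Pal bool bool bool bool

primrec allows :: "palette \<Rightarrow> colour \<Rightarrow> bool" where
  "allows (Pal a b c d) x = (case x of C0 \<Rightarrow> a | C1 \<Rightarrow> b | C2 \<Rightarrow> c | C3 \<Rightarrow> d)"

primrec only :: "colour \<Rightarrow> palette" where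
  "only C0 = Pal True False False False"
| "only C1 = Pal False True False False"
| "only C2 = Pal False False True False"
| "only C3 = Pal False False False True"

fun forbid :: "colour \<Rightarrow> palette \<Rightarrow> palette" where
  "forbid C0 (Pal a b c d) = Pal False b c d"
| "forbid C1 (Pal a b c d) = Pal a False c d"
| "forbid C2 (Pal a b c d) = Pal a b False d"
| "forbid C3 (Pal a b c d) = Pal a b c False"

definition next_to :: "palette \<Rightarrow> palette \<Rightarrow> palette" where
  "next_to q p =
     (if q = only C0 then forbid C0 p else if q = only C1 then forbid C1 p
      else if q = only C2 then forbid C2 p else if q = only C3 then forbid C3 p else p)"

text \<open>The first six equations cover the palettes with at least two colours by naming two of
  them: a neighbour that is still open excludes nothing. The empty palette is left out because
  \<open>put\<close> never stores it.\<close>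

lemma next_to_simps:
  "next_to (Pal True True c d) p = p"
  "next_to (Pal True b True d) p = p"
  "next_to (Pal True b c True) p = p"
  "next_to (Pal a True True d) p = p"
  "next_to (Pal a True c True) p = p"
  "next_to (Pal a b True True) p = p"
  "next_to (Pal True False False False) p = forbid C0 p"
  "next_to (Pal False True False False) p = forbid C1 p"
  "next_to (Pal False False True False) p = forbid C2 p"
  "next_to (Pal False False False True) p = forbid C3 p"
  by (simp_all add: next_to_def)

text \<open>Only a palette with a single colour acts, and this colour is then the actual colour
  \<open>x\<close> of the neighbour.\<close>

lemma allows_next_to:
  assumes "allows q x" "allows p y" "x \<noteq> y" shows "allows (next_to q p) y"
  using assms by (cases p; cases q; cases x; cases y) (auto simp: next_to_def)

lemma allows_forbid: "allows p y \<Longrightarrow> x \<noteq> y \<Longrightarrow> allows (forbid x p) y"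
  by (cases p; cases x; cases y) auto

lemma allows_only: "allows (only x) y \<longleftrightarrow> x = y"
  by (cases x; cases y) auto

text \<open>A vertex that is absent from the trie is unrestricted, so the empty trie stands for no
  information at all.\<close>

fun palette_of :: "palette option \<Rightarrow> palette" where
  "palette_of None = Pal True True True True"
| "palette_of (Some p) = p"

text \<open>
  Vertices and patterns are numbered from 1, because \<^const>\<open>num_of_nat\<close> identifies 0 with 1.
\<close>

definition pal :: "nat \<Rightarrow> palette trie \<Rightarrow> palette" where
  "pal v t = palette_of (lookup (num_of_nat v) t)"

definition store :: "nat \<Rightarrow> 'a \<Rightarrow> 'a trie \<Rightarrow> 'a trie" where
  "store v = update (num_of_nat v)"

definition fetch :: "nat \<Rightarrow> 'a trie \<Rightarrow> 'a option" where
  "fetch v = lookup (num_of_nat v)"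

primrec avoid :: "nat list \<Rightarrow> palette trie \<Rightarrow> palette \<Rightarrow> palette" where
  "avoid [] t p = p"
| "avoid (w # ws) t p = avoid ws t (next_to (pal w t) p)"

fun avoid_opt :: "nat list option \<Rightarrow> palette trie \<Rightarrow> palette \<Rightarrow> palette" where
  "avoid_opt None t p = p"
| "avoid_opt (Some ws) t p = avoid ws t p"

text \<open>A vertex without a remaining colour turns the whole state into \<open>None\<close>. The
  only other source of a contradiction is a forbidden pattern all of whose entries hold.\<close>

definition put :: "nat \<Rightarrow> palette \<Rightarrow> palette trie \<Rightarrow> palette trie option" where
  "put v p t = (if p = Pal False False False False then None else Some (store v p t))"

lemma put_simps:
  "put v (Pal False False False False) t = None"
  "put v (Pal True b c d) t = Some (store v (Pal True b c d) t)"
  "put v (Pal a True c d) t = Some (store v (Pal a True c d) t)"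
  "put v (Pal a b True d) t = Some (store v (Pal a b True d) t)"
  "put v (Pal a b c True) t = Some (store v (Pal a b c True) t)"
  by (simp_all add: put_def)

section \<open>Forbidden patterns and unit propagation\<close>

type_synonym pattern = "(nat \<times> colour) list"

text \<open>This asks whether the entry is certain to hold. \<open>False\<close> does not mean that
  the colour is excluded; the vertex may simply be open.\<close>

definition meets :: "colour \<Rightarrow> palette \<Rightarrow> bool" where
  "meets x p \<longleftrightarrow> p = only x"

lemma meets_simps:
  "meets C0 (Pal True False False False) = True"
  "meets C0 (Pal False b c d) = False"
  "meets C0 (Pal a True c d) = False"
  "meets C0 (Pal a b True d) = False"
  "meets C0 (Pal a b c True) = False"
  "meets C1 (Pal False True False False) = True"
  "meets C1 (Pal True b c d) = False"
  "meets C1 (Pal a False c d) = False"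
  "meets C1 (Pal a b True d) = False"
  "meets C1 (Pal a b c True) = False"
  "meets C2 (Pal False False True False) = True"
  "meets C2 (Pal True b c d) = False"
  "meets C2 (Pal a True c d) = False"
  "meets C2 (Pal a b False d) = False"
  "meets C2 (Pal a b c True) = False"
  "meets C3 (Pal False False False True) = True"
  "meets C3 (Pal True b c d) = False"
  "meets C3 (Pal a True c d) = False"
  "meets C3 (Pal a b True d) = False"
  "meets C3 (Pal a b c False) = False"
  by (simp_all add: meets_def)

text \<open>\<open>all_meet1\<close> receives the truth value as an argument, in place of an
  \<open>if\<close>. On \<open>False\<close> it discards the other entries unevaluated.\<close>

fun all_meet :: "pattern \<Rightarrow> palette trie \<Rightarrow> bool" and all_meet1 where
  "all_meet [] t = True"
| "all_meet ((v, x) # ls) t = all_meet1 (meets x (pal v t)) ls t"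
| "all_meet1 True ls t = all_meet ls t"
| "all_meet1 False ls t = False"

fun rule_out :: "bool \<Rightarrow> nat \<Rightarrow> colour \<Rightarrow> palette trie \<Rightarrow> palette trie option" where
  "rule_out True v x t = put v (forbid x (pal v t)) t"
| "rule_out False v x t = Some t"

text \<open>Unit propagation, with the clause read as a forbidden conjunction. The scan stops at the
  first entry that is not certain. If all later entries are certain, its colour would complete the
  pattern and is removed; with a second uncertain entry nothing changes. Reaching the end of the
  list means that the pattern occurs.\<close>

fun cut :: "pattern \<Rightarrow> palette trie \<Rightarrow> palette trie option" and cut1 where
  "cut [] t = None"
| "cut ((v, x) # ls) t = cut1 (meets x (pal v t)) v x ls t"
| "cut1 True v x ls t = cut ls t"
| "cut1 False v x ls t = rule_out (all_meet ls t) v x t"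

fun visit :: "nat list trie \<Rightarrow> nat \<Rightarrow> palette trie option \<Rightarrow> palette trie option" where
  "visit G v None = None"
| "visit G v (Some t) = put v (avoid_opt (fetch v G) t (pal v t)) t"

primrec look :: "nat list trie \<Rightarrow> nat list \<Rightarrow> palette trie option \<Rightarrow> palette trie option" where
  "look G [] s = s"
| "look G (v # vs) s = look G vs (visit G v s)"

fun cut_by :: "pattern option \<Rightarrow> palette trie option \<Rightarrow> palette trie option" where
  "cut_by None s = s"
| "cut_by (Some ls) None = None"
| "cut_by (Some ls) (Some t) = cut ls t"

text \<open>
  A certificate works on a trie that stores, for every vertex, the colours it may still have.
  \<open>Look vs\<close> removes from each vertex in \<open>vs\<close>, in this order, the colours of those listed
  neighbours that have only one colour left. \<open>Use k\<close> applies forbidden pattern number \<open>k\<close>: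
  if all of its entries but one hold, the remaining one is ruled out. \<open>Learn k ls ss\<close> claims that
  the steps \<open>ss\<close> refute the partial colouring \<open>ls\<close>, which then becomes forbidden pattern
  number \<open>k\<close>, while the deductions of \<open>Fix ss\<close> persist. The trie \<open>None\<close> stands for
  a contradiction.
\<close>

datatype step = Look "nat list" | Use nat

fun run :: "nat list trie \<Rightarrow> pattern trie \<Rightarrow> step list \<Rightarrow> palette trie option \<Rightarrow> palette trie option" where
  "run G N [] s = s"
| "run G N (Look vs # ss) s = run G N ss (look G vs s)"
| "run G N (Use k # ss) s = run G N ss (cut_by (fetch k N) s)"

text \<open>The palette is overwritten rather than intersected. A clash with earlier deductions can
  thereby be missed, but never invented.\<close>

fun suppose :: "pattern \<Rightarrow> palette trie \<Rightarrow> palette trie" where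
  "suppose [] t = t"
| "suppose ((v, x) # ls) t = suppose ls (store v (only x) t)"

fun suppose_opt :: "pattern \<Rightarrow> palette trie option \<Rightarrow> palette trie option" where
  "suppose_opt ls None = None"
| "suppose_opt ls (Some t) = Some (suppose ls t)"

text \<open>A pattern is recorded only after its steps have produced a contradiction. A claim that
  fails is dropped, so soundness does not depend on what the certificate asserts.\<close>

fun admit :: "palette trie option \<Rightarrow> nat \<Rightarrow> pattern \<Rightarrow> pattern trie \<Rightarrow> pattern trie" where
  "admit None k ls N = store k ls N"
| "admit (Some t) k ls N = N"

datatype item = Learn nat pattern "step list" | Fix "step list"

fun replay :: "nat list trie \<Rightarrow> item list \<Rightarrow> pattern trie \<Rightarrow> palette trie option \<Rightarrow> palette trie option" where
  "replay G [] N s = s"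
| "replay G (Learn k ls ss # is) N s = replay G is (admit (run G N ss (suppose_opt ls s)) k ls N) s"
| "replay G (Fix ss # is) N s = replay G is N (run G N ss s)"

fun index :: "(nat \<times> 'a) list \<Rightarrow> 'a trie \<Rightarrow> 'a trie" where
  "index [] t = t"
| "index ((v, x) # xs) t = index xs (store v x t)"

section \<open>Soundness of the replay, relative to a hypothetical colouring of the vertices\<close>

context
  fixes f :: "num \<Rightarrow> colour"
begin

definition agrees :: "palette trie \<Rightarrow> bool" where
  "agrees t \<longleftrightarrow> (\<forall>k. allows (palette_of (lookup k t)) (f k))"

text \<open>\<open>None\<close> agrees with no colouring. As every operation preserves agreement
  with \<open>f\<close>, a replay that ends in \<open>None\<close> shows that \<open>f\<close>
  cannot match the initial pattern.\<close>

definition agrees_opt :: "palette trie option \<Rightarrow> bool" where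
  "agrees_opt s \<longleftrightarrow> (\<exists>t. s = Some t \<and> agrees t)"

definition matches :: "pattern \<Rightarrow> bool" where
  "matches ls \<longleftrightarrow> (\<forall>(v, x) \<in> set ls. f (num_of_nat v) = x)"

definition proper :: "nat list trie \<Rightarrow> bool" where
  "proper G \<longleftrightarrow> (\<forall>k ws. lookup k G = Some ws \<longrightarrow> (\<forall>w \<in> set ws. f (num_of_nat w) \<noteq> f k))"

definition excluded :: "pattern trie \<Rightarrow> bool" where
  "excluded N \<longleftrightarrow> (\<forall>k ls. lookup k N = Some ls \<longrightarrow> \<not> matches ls)"

lemma agrees_pal: "agrees t \<Longrightarrow> allows (pal v t) (f (num_of_nat v))"
  by (simp add: agrees_def pal_def)

lemma agrees_store: "agrees t \<Longrightarrow> allows p (f (num_of_nat v)) \<Longrightarrow> agrees (store v p t)"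
  by (auto simp: agrees_def store_def lookup_update)

text \<open>A palette that allows the actual colour is not empty, so \<open>put\<close> does not
  fail here.\<close>

lemma agrees_put: "agrees t \<Longrightarrow> allows p (f (num_of_nat v)) \<Longrightarrow> agrees_opt (put v p t)"
  by (cases "f (num_of_nat v)") (auto simp: put_def agrees_opt_def intro!: agrees_store)

lemma agrees_suppose: "agrees t \<Longrightarrow> matches ls \<Longrightarrow> agrees (suppose ls t)"
  by (induction ls t rule: suppose.induct)
     (simp_all add: matches_def allows_only agrees_store)

lemma allows_avoid:
  assumes "agrees t" "\<forall>w \<in> set ws. f (num_of_nat w) \<noteq> y" "allows p y"
  shows "allows (avoid ws t p) y"
  using assms(2,3) by (induction ws arbitrary: p) (auto intro: allows_next_to agrees_pal assms(1))

lemma meets_eq: "agrees t \<Longrightarrow> meets x (pal v t) \<Longrightarrow> f (num_of_nat v) = x"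
  using agrees_pal[of t v] by (simp add: meets_def allows_only)

lemma all_meet_matches: "agrees t \<Longrightarrow> all_meet ls t \<Longrightarrow> matches ls"
proof (induction ls)
  case (Cons l ls)
  then show ?case
    by (cases l; cases "meets (snd l) (pal (fst l) t)") (auto simp: matches_def meets_eq)
qed (simp add: matches_def)

text \<open>Entries passed over as certain do hold for \<open>f\<close>, so \<open>f\<close>
  violates the rest of the pattern. If everything after the current entry is certain as well,
  \<open>f\<close> must differ from the pattern at this very vertex, and removing the colour keeps
  the agreement.\<close>

lemma agrees_cut: "agrees t \<Longrightarrow> \<not> matches ls \<Longrightarrow> agrees_opt (cut ls t)"
proof (induction ls)
  case Nil
  then show ?case by (simp add: matches_def)
next
  case (Cons l ls)
  obtain v x where l: "l = (v, x)" by force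
  show ?case
  proof (cases "meets x (pal v t)")
    case True
    with Cons.prems l have "\<not> matches ls" by (auto simp: matches_def dest: meets_eq)
    with Cons l True show ?thesis by simp
  next
    case False
    have "x \<noteq> f (num_of_nat v)" if "all_meet ls t"
      using all_meet_matches[OF Cons.prems(1) that] Cons.prems(2) l by (auto simp: matches_def)
    with False l Cons.prems(1) show ?thesis
      by (cases "all_meet ls t")
         (auto simp: agrees_opt_def[of "Some t"] intro!: agrees_put allows_forbid agrees_pal)
  qed
qed

lemma agrees_look:
  assumes "proper G" "agrees_opt s" shows "agrees_opt (look G vs s)"
  using assms(2)
proof (induction vs arbitrary: s)
  case (Cons v vs)
  then obtain t where t: "s = Some t" "agrees t" by (auto simp: agrees_opt_def)
  have "allows (avoid_opt (fetch v G) t (pal v t)) (f (num_of_nat v))"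
    using assms(1) t(2) by (cases "fetch v G")
      (auto simp: proper_def fetch_def intro!: allows_avoid agrees_pal)
  with Cons.IH t show ?case by (simp add: agrees_put)
qed simp

lemma agrees_run:
  assumes "proper G" "excluded N" "agrees_opt s" shows "agrees_opt (run G N ss s)"
  using assms
proof (induction G N ss s rule: run.induct)
  case (3 G N k ss s)
  then obtain t where t: "s = Some t" "agrees t" by (auto simp: agrees_opt_def)
  with 3 have "agrees_opt (cut_by (fetch k N) s)"
    by (cases "fetch k N") (auto simp: excluded_def fetch_def intro: agrees_cut)
  with 3 show ?case by simp
qed (simp_all add: agrees_look)

text \<open>A learned pattern is justified by contraposition: if \<open>f\<close> matched it, the
  state with the pattern supposed would still agree with \<open>f\<close>, and no steps could turn
  it into \<open>None\<close>. The pattern also rests on the deductions already in \<open>s\<close>,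
  with which \<open>f\<close> agrees.\<close>

lemma agrees_replay:
  "proper G \<Longrightarrow> excluded N \<Longrightarrow> agrees_opt s \<Longrightarrow> agrees_opt (replay G is N s)"
proof (induction G "is" N s rule: replay.induct)
  case (2 G k ls ss "is" N s)
  obtain t where t: "s = Some t" "agrees t" using 2 by (auto simp: agrees_opt_def)
  have "excluded (admit (run G N ss (suppose_opt ls s)) k ls N)"
  proof (cases "run G N ss (suppose_opt ls s)")
    case None
    then have "\<not> matches ls"
      using agrees_run[OF 2(2,3), of "suppose_opt ls s" ss] t
      by (auto simp: agrees_opt_def dest: agrees_suppose)
    with None 2(3) show ?thesis by (auto simp: excluded_def store_def lookup_update)
  qed (simp add: 2)
  with 2 show ?case by simp
qed (simp_all add: agrees_run)

text \<open>A later entry overwrites an earlier one with the same key, so an entry of the list need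
  not be found again. What is found, however, comes from the list or from the initial trie.\<close>

lemma lookup_index:
  "lookup k (index xs t) = Some x \<Longrightarrow> lookup k t = Some x \<or> (\<exists>v. k = num_of_nat v \<and> (v, x) \<in> set xs)"
proof (induction xs t rule: index.induct)
  case (2 v x xs t)
  then show ?case by (fastforce simp: store_def lookup_update split: if_splits)
qed simp

theorem replay_sound:
  assumes "replay (index G Tip) is (index N Tip) (Some (suppose I Tip)) = None"
    and "\<And>v ws w. (v, ws) \<in> set G \<Longrightarrow> w \<in> set ws \<Longrightarrow> f (num_of_nat w) \<noteq> f (num_of_nat v)"
    and "\<And>k ls. (k, ls) \<in> set N \<Longrightarrow> \<not> matches ls"
  shows "\<not> matches I"
proof
  assume "matches I"
  \<comment> \<open>In the empty trie every vertex has the default palette.\<close>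
  have "allows (Pal True True True True) x" for x by (cases x) auto
  then have "agrees_opt (Some (suppose I Tip))"
    using agrees_suppose[OF _ \<open>matches I\<close>, of Tip] by (simp add: agrees_opt_def agrees_def)
  moreover have "proper (index G Tip)"
    unfolding proper_def using assms(2) lookup_index[of _ G Tip] by fastforce
  moreover have "excluded (index N Tip)"
    unfolding excluded_def using assms(3) lookup_index[of _ N Tip] by fastforce
  ultimately have "agrees_opt (replay (index G Tip) is (index N Tip) (Some (suppose I Tip)))"
    by (intro agrees_replay)
  with assms(1) show False by (simp add: agrees_opt_def)
qed

end

text \<open>\<open>numeral k\<close> carries the trie key \<open>k\<close> in itself, so
  \<open>num_of_nat\<close> disappears without computation. The literal 1 is not of this form and
  has its own equations.\<close>

lemma key_simps:
  "pal (numeral k) t = palette_of (lookup k t)"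
  "pal 1 t = palette_of (lookup num.One t)"
  "store (numeral k) x t' = update k x t'"
  "store 1 x t' = update num.One x t'"
  "fetch (numeral k) t' = lookup k t'"
  "fetch 1 t' = lookup num.One t'"
  by (simp_all add: pal_def store_def fetch_def num_of_nat_One)

text \<open>
  These equations use neither conditionals nor case distinctions nor local abstractions. Therefore
  the simplifier evaluates innermost first and does not visit normalised arguments again, so that
  the size of the tries does not matter much.
\<close>

lemmas check_simps = key_simps lookup_simps update_simps palette_of.simps avoid.simps avoid_opt.simps
  only.simps forbid.simps next_to_simps put_simps meets_simps all_meet.simps all_meet1.simps rule_out.simps
  cut.simps cut1.simps cut_by.simps visit.simps look.simps run.simps suppose.simps suppose_opt.simps
  admit.simps replay.simps index.simps

section \<open>Colourings of the plane\<close>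

definition proper_colouring :: "(complex \<Rightarrow> colour) \<Rightarrow> bool" where
  "proper_colouring g \<longleftrightarrow> (\<forall>z w. cmod (z - w) = 1 \<longrightarrow> g z \<noteq> g w)"

lemma proper_colouringD: "proper_colouring g \<Longrightarrow> cmod (z - w) = 1 \<Longrightarrow> g z \<noteq> g w"
  by (simp add: proper_colouring_def)

text \<open>This is why one finite refutation excludes its pattern at every position, in every
  orientation and under every renaming of the colours.\<close>

lemma proper_colouring_transform:
  assumes "proper_colouring g" "cmod u = 1" "inj \<pi>"
  shows "proper_colouring (\<lambda>x. \<pi> (g (z + u * x)))"
  unfolding proper_colouring_def
proof (intro allI impI)
  fix x y :: complex assume "cmod (x - y) = 1"
  then have "cmod ((z + u * x) - (z + u * y)) = 1"
    using assms(2) by (simp flip: right_diff_distrib add: norm_mult)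
  then show "\<pi> (g (z + u * x)) \<noteq> \<pi> (g (z + u * y))"
    using proper_colouringD[OF assms(1)] injD[OF assms(3)] by blast
qed

text \<open>The certificates start from fixed colour names; this injection brings any three distinct
  colours to these names.\<close>

lemma recolour:
  assumes "distinct [a, b, c]"
  obtains \<pi> :: "colour \<Rightarrow> colour" where
    "inj \<pi>" "\<pi> a = C0" "\<pi> b = C1" "\<pi> c = C2" "\<And>d. d \<notin> {a, b, c} \<Longrightarrow> \<pi> d = C3"
proof
  let ?\<pi> = "\<lambda>d. if d = a then C0 else if d = b then C1 else if d = c then C2 else C3"
  \<comment> \<open>Only one of the four colours lies outside three distinct ones, so the last
    branch of \<open>?\<pi>\<close> is taken at most once.\<close>
  have *: "d = e" if "d \<notin> {a, b, c}" "e \<notin> {a, b, c}" for d e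
    using assms that by (cases a; cases b; cases c; cases d; cases e) simp_all
  show "inj ?\<pi>"
  proof (rule injI)
    fix d e assume "?\<pi> d = ?\<pi> e"
    then show "d = e"
      using assms *[of d e] by (cases "d \<in> {a, b, c} \<or> e \<in> {a, b, c}") (auto split: if_splits)
  qed
qed (use assms in auto)

section \<open>Exact integer coordinates and unit distances\<close>

type_synonym coords = "int \<times> int \<times> int \<times> int"

text \<open>A vertex missing from the table is placed at the origin. The edge check and the
  colouring read positions through this same function, so the default cannot make them
  disagree.\<close>

fun coords_of :: "coords option \<Rightarrow> coords" where
  "coords_of None = (0, 0, 0, 0)"
| "coords_of (Some p) = p"

text \<open>The relation is a parameter because the graphs use two coordinate systems:
  \<open>unit_apart\<close> belongs to the hexagon graphs and \<open>double_apart\<close> to the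
  graph for distance 4.\<close>

fun adjacent_all :: "(coords \<Rightarrow> coords \<Rightarrow> bool) \<Rightarrow> coords trie \<Rightarrow> coords \<Rightarrow> nat list \<Rightarrow> bool" where
  "adjacent_all R Q p [] = True"
| "adjacent_all R Q p (w # ws) = (R p (coords_of (fetch w Q)) \<and> adjacent_all R Q p ws)"

fun edges_ok :: "(coords \<Rightarrow> coords \<Rightarrow> bool) \<Rightarrow> coords trie \<Rightarrow> (nat \<times> nat list) list \<Rightarrow> bool" where
  "edges_ok R Q [] = True"
| "edges_ok R Q ((v, ws) # G) = (adjacent_all R Q (coords_of (fetch v Q)) ws \<and> edges_ok R Q G)"

lemma adjacent_allD: "adjacent_all R Q p ws \<Longrightarrow> w \<in> set ws \<Longrightarrow> R p (coords_of (fetch w Q))"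
  by (induction ws) auto

lemma edges_okD:
  "edges_ok R Q G \<Longrightarrow> (v, ws) \<in> set G \<Longrightarrow> w \<in> set ws \<Longrightarrow>
    R (coords_of (fetch v Q)) (coords_of (fetch w Q))"
  by (induction R Q G rule: edges_ok.induct) (auto dest: adjacent_allD)

text \<open>
  The lattice of these points contains \<open>e\<^bsup>i\<pi>/3\<^esup>\<close>, the rotation \<open>(5 + i\<surd>11) / 6\<close> of the Moser
  spindle, which moves points at distance \<open>\<surd>3\<close> from the centre by 1, and its square root
  \<open>(\<surd>33 + i\<surd>3) / 6\<close>.
\<close>

definition place :: "coords \<Rightarrow> complex" where
  "place = (\<lambda>(a, b, c, d).
     Complex ((of_int a + of_int b * sqrt 33) / 12) ((of_int c * sqrt 3 + of_int d * sqrt 11) / 12))"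

text \<open>With the common denominator 12, the squared distance times 144 has the form m + n sqrt
  33 with integers m and n. The first equation says m = 144, the second n = 0.\<close>

fun unit_apart :: "coords \<Rightarrow> coords \<Rightarrow> bool" where
  "unit_apart (a, b, c, d) (a', b', c', d') \<longleftrightarrow>
     (a - a') * (a - a') + 33 * ((b - b') * (b - b')) + 3 * ((c - c') * (c - c'))
       + 11 * ((d - d') * (d - d')) = 144 \<and>
     (a - a') * (b - b') + (c - c') * (d - d') = 0"

lemma sqrt33: "sqrt 33 = sqrt 3 * sqrt 11"
  by (simp flip: real_sqrt_mult)

lemma unit_apart_place:
  assumes "unit_apart p q" shows "cmod (place p - place q) = 1"
proof -
  obtain a b c d where p: "p = (a, b, c, d)" by (cases p)
  obtain a' b' c' d' where q: "q = (a', b', c', d')" by (cases q)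
  define x y z w :: real where "x = of_int (a - a')" "y = of_int (b - b')"
    "z = of_int (c - c')" "w = of_int (d - d')"
  have "real_of_int ((a - a') * (a - a') + 33 * ((b - b') * (b - b')) + 3 * ((c - c') * (c - c'))
       + 11 * ((d - d') * (d - d'))) = real_of_int 144"
    "real_of_int ((a - a') * (b - b') + (c - c') * (d - d')) = real_of_int 0"
    using assms unfolding p q unit_apart.simps of_int_eq_iff by simp_all
  then have eqs: "x * x + 33 * (y * y) + 3 * (z * z) + 11 * (w * w) = 144" "x * y + z * w = 0"
    unfolding x_y_z_w_def of_int_add of_int_mult of_int_numeral by simp_all
  have sq: "sqrt 33 * sqrt 33 = 33" "sqrt 3 * sqrt 3 = 3" "sqrt 11 * sqrt 11 = 11" by simp_all
  \<comment> \<open>The mixed terms of both squares are multiples of sqrt 33, because sqrt 3 times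
    sqrt 11 is sqrt 33, and so they cancel against each other.\<close>
  have "(x + y * sqrt 33)\<^sup>2 + (z * sqrt 3 + w * sqrt 11)\<^sup>2 =
      x * x + (sqrt 33 * sqrt 33) * (y * y) + (sqrt 3 * sqrt 3) * (z * z)
       + (sqrt 11 * sqrt 11) * (w * w) + 2 * sqrt 33 * (x * y + z * w)"
    unfolding sqrt33 by (simp add: power2_eq_square algebra_simps)
  also have "\<dots> = 144" using eqs unfolding sq by simp
  finally have "((x + y * sqrt 33) / 12)\<^sup>2 + ((z * sqrt 3 + w * sqrt 11) / 12)\<^sup>2 = 1"
    by (simp add: power_divide flip: add_divide_distrib)
  moreover have "place p - place q = Complex ((x + y * sqrt 33) / 12) ((z * sqrt 3 + w * sqrt 11) / 12)"
    by (simp add: p q place_def x_y_z_w_def complex_eq_iff algebra_simps add_divide_distrib diff_divide_distrib)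
  ultimately show ?thesis by (simp add: complex_norm)
qed

definition \<omega> :: complex where "\<omega> = Complex (1/2) (sqrt 3 / 2)"

lemma \<omega>_sq: "\<omega> * \<omega> = \<omega> - 1"
  by (simp add: \<omega>_def complex_eq_iff)

text \<open>The quadratic relation of the sixth root of unity, in a form that also rewrites inside
  longer products.\<close>

lemma \<omega>_mult: "\<omega> * (\<omega> * x) = \<omega> * x - x"
  using \<omega>_sq by (simp flip: mult.assoc add: left_diff_distrib)

lemma norm_\<omega>: "cmod \<omega> = 1"
  by (simp add: \<omega>_def complex_norm power_divide)

lemma norm_\<omega>_minus_1: "cmod (\<omega> - 1) = 1" "cmod (1 - \<omega>) = 1"
  by (simp_all add: \<omega>_def cmod_def power_divide)

text \<open>The bridge from the plane to the checker: the colouring \<open>f\<close> of the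
  soundness proof becomes the colouring of the points at which the vertices lie, indexed by trie
  keys.\<close>

definition seen :: "(complex \<Rightarrow> colour) \<Rightarrow> (coords \<Rightarrow> complex) \<Rightarrow> coords trie \<Rightarrow> num \<Rightarrow> colour" where
  "seen h pl Q k = h (pl (coords_of (lookup k Q)))"

lemma matches_simps:
  "matches f [] = True"
  "matches f ((v, x) # ls) = (f (num_of_nat v) = x \<and> matches f ls)"
  by (simp_all add: matches_def)

lemma seen_num_of_nat: "seen h pl Q (num_of_nat v) = h (pl (coords_of (fetch v Q)))"
  by (simp add: seen_def fetch_def)

text \<open>\<open>N\<close> contains patterns that are known to be impossible beforehand: none for
  the hexagon graphs, monochromatic triangles of side sqrt 3 for the graph at distance 4.\<close>

lemma certificate_refutes:
  assumes "proper_colouring h"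
    and "\<And>p q. R p q \<Longrightarrow> cmod (pl p - pl q) = 1"
    and "edges_ok R Q G"
    and "\<And>k ls. (k, ls) \<in> set N \<Longrightarrow> \<not> matches (seen h pl Q) ls"
    and "replay (index G Tip) is (index N Tip) (Some (suppose I Tip)) = None"
  shows "\<not> matches (seen h pl Q) I"
proof (rule replay_sound[OF assms(5)])
  fix v ws w assume "(v, ws) \<in> set G" "w \<in> set ws"
  then have "cmod (pl (coords_of (fetch v Q)) - pl (coords_of (fetch w Q))) = 1"
    using assms(2,3) edges_okD by blast
  then show "seen h pl Q (num_of_nat w) \<noteq> seen h pl Q (num_of_nat v)"
    using proper_colouringD[OF assms(1)] by (metis seen_num_of_nat)
qed (use assms(4) in blast)

lemmas coords_arith = arith_simps arith_special rel_simps mult_1_left mult_1_right mult_minus1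
  mult_minus1_right minus_minus inc.simps simp_thms

lemmas edges_simps = check_simps edges_ok.simps adjacent_all.simps coords_of.simps coords_arith

section \<open>No monochromatic triangle of side \<open>\<surd>3\<close>\<close>

lemma place_ring:
  "place (0, 0, 0, 0) = 0" "place (12, 0, 0, 0) = 1" "place (6, 0, 6, 0) = \<omega>"
  "place (-6, 0, 6, 0) = \<omega> - 1" "place (-12, 0, 0, 0) = -1" "place (-6, 0, -6, 0) = -\<omega>"
  "place (6, 0, -6, 0) = 1 - \<omega>"
  by (simp_all add: place_def \<omega>_def complex_eq_iff)

text \<open>
  The vertices are sums of at most three unit vectors \<open>\<omega>\<^sup>j\<zeta>\<^sup>k\<close> with
  \<open>\<bar>k\<bar> \<le> 2\<close>, where \<open>\<zeta> = (\<surd>33 + i\<surd>3) / 6\<close>. The neighbour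
  lists contain only the edges that the certificate needs, so they are not symmetric.
\<close>

definition alternating_points :: "(nat \<times> int \<times> int \<times> int \<times> int) list" where
  "alternating_points = [
   (1, (-1, -1, -1, 1)), (2, (1, -1, -1, -1)), (3, (-2, 0, 0, 2)), (4, (2, 0, 0, -2)), (5, (-1, 1, 1, 1)), (6,
   (0, -2, -2, 0)), (7, (1, 1, 1, -1)), (8, (3, -1, 5, 3)), (9, (6, -2, 4, 0)), (10, (0, 0, 0, 0)), (11, (-3,
   -1, -1, 3)), (12, (5, -1, 5, 1)), (13, (-6, -2, 4, 0)), (14, (9, -1, -1, 3)), (15, (-5, -1, 5, -1)), (16,
   (-10, 0, 0, -2)), (17, (-7, -1, 5, 1)), (18, (11, -1, -1, 1)), (19, (-11, -1, -1, -1)), (20, (7, -1, 5,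
   -1)), (21, (9, 1, 1, 3)), (22, (3, 1, -5, 3)), (23, (4, 0, 6, 2)), (24, (-3, -1, 5, -3)), (25, (-9, -1, -1,
   -3)), (26, (-11, 1, 1, -1)), (27, (-6, 0, 2, 0)), (28, (-3, 1, 1, 3)), (29, (3, -1, -1, -3)), (30, (-7, 1,
   -5, 1)), (31, (-5, 1, -5, -1)), (32, (0, 0, -4, 0)), (33, (0, 0, 4, 0)), (34, (-6, 2, -4, 0)), (35, (5, 1,
   -5, 1)), (36, (6, 0, 2, 0)), (37, (-6, 0, -2, 0)), (38, (-6, 0, 6, 0)), (39, (-4, 0, -6, -2)), (40, (10, 0,
   0, 2)), (41, (12, 0, 0, 0)), (42, (6, 0, -2, 0)), (43, (6, 0, -6, 0)), (44, (4, 0, -6, 2)), (45, (-4, -2,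
   4, -2)), (46, (-2, -2, -2, 2)), (47, (6, 0, 6, 0)), (48, (-12, 0, 0, 0)), (49, (-4, 0, 6, -2)), (50, (-8,
   0, -6, 2)), (51, (-13, -1, -1, 1)), (52, (4, -2, 4, 2)), (53, (11, 1, 1, 1)), (54, (-3, 1, -5, -3)), (55,
   (-9, 1, 1, -3)), (56, (6, 2, -4, 0)), (57, (8, 0, 0, 4)), (58, (3, -1, 1, 3)), (59, (5, -1, -7, 1)), (60,
   (3, 1, 1, -3)), (61, (-6, 0, -6, 0)), (62, (-3, -1, 3, 3)), (63, (-8, 0, 6, 2)), (64, (0, -2, 2, 0)), (65,
   (7, 1, -5, -1)), (66, (12, -2, -2, 0)), (67, (-8, -2, 4, 2)), (68, (5, -1, 1, 1)), (69, (-5, -1, -7, -1)),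
   (70, (-6, -2, 0, 0)), (71, (0, 2, 2, 0)), (72, (-7, -1, -7, 1)), (73, (-4, 0, 0, 4)), (74, (-14, 0, 0, 2)),
   (75, (-9, -1, 5, 3)), (76, (6, -2, 0, 0)), (77, (-4, 2, -4, -2)), (78, (3, -1, -7, 3)), (79, (13, -1, -1,
   -1)), (80, (5, -3, 3, 1)), (81, (0, -2, 10, 0)), (82, (3, -3, 3, 3)), (83, (-1, -1, 3, 1)), (84, (2, -2,
   -2, -2)), (85, (-13, 1, 1, 1)), (86, (-4, 0, 2, -2)), (87, (-7, -3, 3, 1)), (88, (-9, 1, -5, 3)), (89, (-1,
   1, -3, 1)), (90, (-3, -1, 1, -3)), (91, (0, -2, 6, 0)), (92, (-7, -1, 1, 1)), (93, (-4, 0, -2, -2)), (94,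
   (-3, -1, -3, -3)), (95, (-5, -3, 3, -1)), (96, (-5, 1, 7, -1)), (97, (-8, 0, 0, -4)), (98, (-10, -2, -2,
   -2)), (99, (10, -2, -2, 2)), (100, (-3, 1, -3, 3)), (101, (-12, -2, -2, 0)), (102, (3, 1, -1, 3)), (103,
   (2, -2, 4, 4)), (104, (4, 2, -4, 2)), (105, (-1, -1, 11, 1)), (106, (-16, 0, -6, -2)), (107, (17, -1, 5,
   1)), (108, (5, 1, -1, 1)), (109, (-3, 1, -1, -3)), (110, (1, -1, 3, -1)), (111, (-1, -3, -3, 1)), (112,
   (15, -1, 5, 3)), (113, (8, -2, 4, -2)), (114, (8, 0, -6, -2)), (115, (-9, 1, -3, -3)), (116, (-5, -1, 1,
   -1)), (117, (4, 0, -2, 2)), (118, (0, 2, -2, 0)), (119, (3, -1, -3, 3)), (120, (-7, 1, 7, 1)), (121, (0, 2,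
   -6, 0)), (122, (-9, -1, 3, -3)), (123, (1, -1, 5, 5)), (124, (-5, 1, -1, -1)), (125, (-3, -1, -5, 3)),
   (126, (-6, -2, -4, 0)), (127, (-9, -1, 1, 3)), (128, (-3, -1, -7, -3)), (129, (5, 1, 7, 1)), (130, (-12, 0,
   -4, 0)), (131, (-7, 1, -1, 1)), (132, (-3, -3, 3, -3)), (133, (-17, -1, 5, -1)), (134, (1, 1, -3, -1)),
   (135, (-11, -1, 3, -1)), (136, (8, 0, 6, -2)), (137, (-3, 1, 3, -3)), (138, (7, 1, 7, -1)), (139, (3, 1, 3,
   3)), (140, (-1, -1, -5, 1)), (141, (6, -2, -4, 0)), (142, (-1, -3, 9, 1)), (143, (-3, -1, 7, 3)), (144, (1,
   -1, 1, 1)), (145, (-8, 2, -4, 2)), (146, (4, 0, 2, 2)), (147, (2, 2, 2, -2)), (148, (-17, 1, -5, -1)),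
   (149, (11, 1, -3, 1)), (150, (-4, -2, -2, 4)), (151, (5, 1, 3, 1)), (152, (6, 0, 0, 6)), (153, (3, -1, -5,
   -3)), (154, (2, 0, -6, 4)), (155, (13, 1, 1, -1)), (156, (9, -1, 5, -3)), (157, (2, 0, 4, -2)), (158, (7,
   -3, 3, -1)), (159, (-2, 0, 4, 2)), (160, (3, 1, -3, -3)), (161, (-7, -1, -3, 1)), (162, (7, -1, -1, 5)),
   (163, (6, -2, -8, 0)), (164, (-12, 0, 4, 0)), (165, (-9, -1, -3, 3)), (166, (-2, -2, 10, 2)), (167, (2, 0,
   -4, -2)), (168, (-10, 0, 4, -2)), (169, (8, 0, -2, -2)), (170, (2, 0, 6, 4)), (171, (-8, 0, -2, 2)), (172,
   (-5, -1, -1, 5)), (173, (-9, 1, -1, 3)), (174, (7, -1, -7, -1)), (175, (3, 1, 7, 3)), (176, (8, 2, -4,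
   -2)), (177, (7, -1, -3, -1)), (178, (6, 2, 0, 0)), (179, (9, 1, -5, -3)), (180, (-2, 0, -6, -4)), (181, (5,
   -1, -3, 1)), (182, (9, -1, -3, -3)), (183, (-2, 2, 2, 2)), (184, (8, -2, -2, 4)), (185, (-2, -2, 4, -4)),
   (186, (10, -2, 10, 2)), (187, (-15, -1, -1, 3)), (188, (4, -2, 0, 2)), (189, (3, -1, 3, -3)), (190, (9, -1,
   3, 3)), (191, (-6, -2, 8, 0)), (192, (1, -3, -3, -1)), (193, (1, -1, -5, -1)), (194, (-3, 1, 5, 3)), (195,
   (10, 0, 4, 2)), (196, (2, 0, 0, 2)), (197, (-14, -2, 4, -4)), (198, (-6, 2, 0, 0)), (199, (-5, -1, -3,
   -1)), (200, (12, 2, 2, 0)), (201, (8, 0, 2, -2)), (202, (0, -2, -6, 0)), (203, (-2, 0, 0, -2)), (204, (-9,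
   1, 3, 3)), (205, (0, 0, 8, 0)), (206, (-10, 0, -4, -2)), (207, (11, -1, 3, 1)), (208, (0, 0, 12, 0)), (209,
   (-4, 0, 2, 2)), (210, (0, 0, -8, 0)), (211, (-7, 1, 3, 1)), (212, (2, 0, 2, 4)), (213, (16, 0, 6, 2)),
   (214, (15, 1, -5, 3)), (215, (3, 1, 5, -3)), (216, (15, -1, -1, -3)), (217, (4, 0, 0, -4)), (218, (-16, 0,
   6, -2)), (219, (-6, 0, 0, -6)), (220, (-5, -1, -1, 1)), (221, (-1, 1, -11, 1)), (222, (-1, -1, 1, -1)),
   (223, (-16, -2, 4, -2)), (224, (-2, 2, -10, 2)), (225, (2, 2, -4, 4)), (226, (-2, 0, -2, -4)), (227, (14,
   -2, 4, 4)), (228, (-8, 0, 2, 2)), (229, (0, 0, -12, 0)), (230, (-9, -1, -7, 3)), (231, (-6, 0, 10, 0)),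
   (232, (0, 2, 6, 0)), (233, (-2, 0, -4, 2)), (234, (3, 3, -3, 3)), (235, (3, 1, -7, -3)), (236, (-1, -1, 7,
   1)), (237, (9, -1, -5, 3)), (238, (1, 1, -1, 1)), (239, (-4, -2, -8, -2)), (240, (9, -1, 1, -3)), (241,
   (-7, 1, 1, -5)), (242, (18, 0, -6, 0)), (243, (-3, 1, -7, 3)), (244, (2, -2, 6, -2)), (245, (-1, 1, 5, 1)),
   (246, (-12, -2, 2, 0)), (247, (-18, 0, 6, 0)), (248, (-2, 0, -12, 2)), (249, (2, -2, 2, -2)), (250, (6, -2,
   8, 0)), (251, (-2, -2, 2, 2)), (252, (9, 1, -7, 3)), (253, (12, 0, -4, 0)), (254, (-12, 2, -2, 0)), (255,
   (-16, 0, -2, -2)), (256, (-7, -1, -1, -5)), (257, (-15, -1, -7, -3)), (258, (-1, 1, -5, -5)), (259, (-2, 2,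
   -4, -4)), (260, (-4, -2, 0, -2)), (261, (9, -1, 7, 3)), (262, (3, -1, 7, -3)), (263, (-3, -3, -3, 3)),
   (264, (-15, -1, 7, 3)), (265, (-5, -1, 7, 1)), (266, (-16, 0, 2, -2)), (267, (-9, 1, 7, 3)), (268, (1, -1,
   -3, 1)), (269, (-6, -2, -8, 0)), (270, (-15, -1, 5, -3)), (271, (-11, -1, 1, 1)), (272, (-10, 2, 2, -2)),
   (273, (7, -1, 1, -1)), (274, (1, 1, -7, -1)), (275, (-12, -2, 6, 0)), (276, (3, -3, -1, 3)), (277, (2, -2,
   8, 4)), (278, (2, 0, -2, 4)), (279, (-3, 1, 7, -3)), (280, (0, -4, 8, 0)), (281, (-4, -2, -4, 2)), (282,
   (-15, -1, -3, -3)), (283, (-11, -1, -5, -1)), (284, (6, 2, 4, 0)), (285, (15, -1, 1, 3)), (286, (-1, -3, 5,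
   1)), (287, (-2, 2, -2, 2)), (288, (1, 1, 5, -1)), (289, (-13, 1, -5, -5)), (290, (12, 0, 4, 0)), (291, (9,
   1, 5, 3)), (292, (-3, -3, 9, 3)), (293, (-2, 0, -8, 2)), (294, (14, 2, -4, 4)), (295, (10, -2, 2, 2)),
   (296, (-1, -1, -3, -1)), (297, (-8, -2, -4, 2)), (298, (11, 1, -7, 1)), (299, (-4, 2, 0, -2)), (300, (-2,
   0, -4, -2)), (301, (-5, 1, -3, 1)), (302, (-14, -2, -2, 2)), (303, (10, 0, -4, 2)), (304, (5, -1, -1, -1)),
   (305, (4, -2, -8, 2)), (306, (-2, 0, 8, 2)), (307, (-9, 1, -7, -3)), (308, (7, -1, -5, 1)), (309, (4, 0, 2,
   -2)), (310, (-4, -2, 0, 2)), (311, (-9, -1, 7, -3)), (312, (1, -1, 7, -1)), (313, (-6, 2, -8, 0)), (314,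
   (-4, 0, -4, 4)), (315, (9, 1, 3, -3)), (316, (-9, 1, 5, -3)), (317, (1, 1, 3, 1)), (318, (-5, -1, -5, 1)),
   (319, (-16, 2, -4, -2)), (320, (1, -3, 5, -1)), (321, (17, 1, -5, 1)), (322, (13, -1, 5, 5)), (323, (-10,
   0, -6, 4)), (324, (14, 0, -6, 4)), (325, (-6, 0, -10, 0)), (326, (8, 2, 2, 4)), (327, (15, 1, 1, -3)),
   (328, (-4, 0, -6, 2)), (329, (7, 1, 1, 5)), (330, (5, 1, 1, -5)), (331, (-14, 2, 2, 2)), (332, (-15, 1, -1,
   -3)), (333, (8, 0, 2, 2)), (334, (8, 0, -4, 4)), (335, (-2, 0, -2, 4)), (336, (-4, 0, -2, 2)), (337, (10,
   0, -6, -4)), (338, (18, 0, 6, 0)), (339, (5, -1, -1, -5)), (340, (15, -3, 3, 3)), (341, (-7, -1, 3, -5)),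
   (342, (-8, -2, -8, 2)), (343, (2, 2, -10, -2)), (344, (6, 2, 8, 0)), (345, (4, -2, -2, -4)), (346, (11, -1,
   -3, -1)), (347, (2, 0, -4, 2)), (348, (-7, -1, -5, -1)), (349, (12, 0, 6, 6)), (350, (-2, 2, -2, -2)),
   (351, (-19, 1, -5, 1)), (352, (-10, 0, 4, 2)), (353, (-1, 1, -5, -1)), (354, (8, 0, -6, 2)), (355, (-13,
   -1, 1, -1)), (356, (1, -3, 9, -1)), (357, (9, -3, -3, 3)), (358, (-1, 1, -7, 1)), (359, (14, 0, -2, 4)),
   (360, (-8, 0, 0, 4)), (361, (12, 2, 6, 0)), (362, (4, 0, 0, 4)), (363, (12, -2, 2, 0)), (364, (18, -2, -4,
   0)), (365, (13, -1, 1, 1)), (366, (-4, -2, 8, -2)), (367, (-9, -3, -5, 3)), (368, (11, -1, -5, 1)), (369,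
   (-3, -1, -9, 3)), (370, (-14, 2, -4, -4)), (371, (-18, 0, -6, 0)), (372, (-18, -2, -4, 0)), (373, (18, 0,
   2, 0)), (374, (-3, 1, 11, -3)), (375, (6, -2, -2, 6)), (376, (-13, -3, 9, 1)), (377, (3, -1, -11, 3)),
   (378, (7, 1, 1, 1)), (379, (0, 2, -10, 0)), (380, (11, -3, -3, 1)), (381, (3, -1, -9, -3)), (382, (-11, -1,
   -3, 1)), (383, (-11, 1, -3, -1)), (384, (-8, 0, 6, -2))]"

definition alternating_edges :: "(nat \<times> nat list) list" where
  "alternating_edges = [
   (1, [61]), (2, [3, 7, 18, 43]), (3, [2, 7, 48]), (4, [1, 5, 16, 20, 41, 49]), (5, [1, 4, 23, 26, 30, 35,
   38, 53]), (6, [9, 10, 11, 13, 29, 59, 66, 95]), (7, [2, 3, 47]), (8, [3, 9, 14, 17, 47]), (9, [2, 6, 8, 18,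
   47]), (11, [6, 8, 10, 14, 28, 50, 51, 75]), (12, [1, 10, 15, 17, 18, 40, 81, 105, 107, 112]), (13, [1, 6,
   9, 19, 24, 38]), (14, [1, 8, 11, 21, 41, 44, 66]), (15, [2, 10, 12, 16, 19, 20, 81, 96, 133]), (16, [4, 10,
   15, 31, 39, 49, 51, 85, 106]), (17, [1, 3, 8, 12, 48, 120]), (18, [1, 2, 9, 12, 43]), (19, [1, 2, 13, 15,
   26, 61, 106]), (20, [2, 4, 15, 23, 24, 41, 79, 107]), (21, [5, 14, 22, 23, 28, 41]), (22, [3, 21, 30, 43,
   78]), (23, [3, 5, 20, 21, 38, 40, 63, 105, 138]), (24, [4, 13, 20, 38]), (25, [2, 24, 29, 39, 48, 101]),
   (26, [5, 7, 19, 31, 34, 38, 74, 218]), (27, [13, 28, 32, 36, 55, 62, 70, 89, 122, 130, 146, 205]), (28,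
   [10, 11, 21, 22, 27, 62, 63, 85, 88, 175]), (29, [6, 10, 24, 25, 60, 79, 114, 156]), (30, [3, 5, 22, 48,
   148]), (31, [7, 10, 16, 26, 35, 50, 65, 69, 148]), (32, [6, 22, 27, 36, 54, 68, 94, 100, 118, 121]), (33,
   [8, 24, 37, 42, 62, 64, 71, 91, 108, 124, 137, 164, 168, 195, 231]), (34, [5, 26, 61, 88]), (35, [5, 10,
   30, 31, 40, 53, 59]), (36, [9, 21, 27, 32, 58, 60, 76, 86, 134, 149]), (37, [11, 25, 33, 34, 42, 83, 100,
   109, 115, 117]), (39, [2, 4, 16, 25, 30, 43, 72]), (40, [3, 10, 12, 23, 35, 44, 112, 214]), (42, [14, 29,
   33, 37, 56, 93, 110]), (44, [1, 3, 14, 40, 61, 221]), (45, [2, 9, 17, 25, 49, 87]), (46, [2, 3, 52, 67, 72,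
   78, 82, 99, 172, 192]), (49, [4, 7, 16, 17, 47, 55, 120]), (50, [3, 11, 31, 44, 51, 69, 74, 145]), (51, [1,
   11, 16, 17, 50, 67, 72, 85]), (52, [1, 13, 14, 20, 23, 46, 123]), (53, [5, 7, 18, 35, 47, 56, 213]), (54,
   [4, 34, 61, 65, 128]), (55, [7, 25, 48, 49, 60]), (56, [7, 22, 34, 43, 53, 71]), (57, [3, 8, 18, 22, 53]),
   (58, [10, 36, 64, 76, 82, 92, 102, 125, 139, 152]), (59, [1, 6, 18, 35, 69, 72, 99, 229]), (60, [10, 29,
   36, 54, 55, 71, 136, 155, 179]), (62, [13, 27, 28, 33, 64, 119, 171, 277, 278]), (63, [3, 15, 23, 28, 67,
   74, 96]), (64, [10, 33, 58, 62, 82, 90, 132, 191, 250]), (65, [4, 7, 31, 41, 44]), (66, [6, 9, 14, 41, 158,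
   163, 216]), (67, [11, 15, 46, 51, 52, 63, 135, 166, 228]), (68, [4, 32, 57, 80, 91, 92, 108, 151]), (69,
   [2, 6, 19, 31, 50, 59, 98, 257]), (70, [11, 25, 27, 37, 76, 90, 140]), (71, [10, 28, 33, 34, 56, 60, 96,
   129]), (72, [1, 30, 39, 46, 51, 59, 78]), (73, [1, 5, 57, 74, 75, 150]), (74, [3, 19, 26, 50, 63, 73, 88]),
   (75, [8, 11, 13, 38, 123, 275]), (76, [14, 29, 36, 42, 58, 70, 91, 276]), (77, [7, 30, 39, 55, 56, 176]),
   (78, [11, 14, 22, 43, 163, 248]), (79, [2, 20, 29, 40, 113, 114, 155]), (80, [6, 12, 87, 95, 99, 103, 111,
   113, 142]), (81, [9, 12, 13, 15, 186]), (82, [8, 9, 46, 87]), (83, [5, 37, 45, 86, 103, 157, 161, 190]),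
   (84, [1, 4, 45, 66, 98, 111, 128, 132, 174, 239]), (85, [5, 16, 28, 30, 51]), (86, [5, 36, 45, 83, 115,
   206, 241, 266]), (87, [17, 45, 46, 82, 101, 142]), (88, [22, 28, 34, 61, 73, 230]), (89, [1, 27, 77, 93,
   149, 167, 225]), (90, [10, 27, 64, 70, 109, 132, 137, 219, 244]), (91, [8, 24, 33, 68, 70, 76, 116, 280]),
   (92, [16, 68, 73, 87, 131, 260]), (93, [1, 42, 77, 89, 169, 255, 256, 274]), (94, [6, 32, 37, 54, 122, 126,
   177]), (95, [6, 15, 67, 98, 116, 158]), (96, [7, 15, 26, 63, 129, 138, 306]), (97, [4, 19, 24, 26, 54]),
   (98, [6, 16, 45, 51, 69, 223]), (99, [6, 40, 46, 52, 59, 79, 177]), (100, [11, 32, 34, 37, 118, 139]),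
   (101, [6, 13, 25, 46, 48, 72, 187, 282]), (102, [10, 42, 58, 118, 119, 131, 152, 159, 173, 178, 234, 252]),
   (103, [11, 12, 67, 80, 162, 170, 227]), (104, [5, 21, 34, 44, 65, 224]), (105, [12, 17, 23, 38]), (106,
   [16, 19, 39, 61]), (107, [12, 18, 20, 41]), (108, [4, 33, 57, 68, 121, 131, 298]), (109, [10, 37, 90, 94,
   118, 219, 235, 307]), (110, [7, 42, 52, 135, 177, 185, 207]), (111, [1, 80, 84, 87, 140, 150]), (112, [8,
   12, 14, 40, 186]), (113, [12, 45, 79, 80, 84, 136, 185, 201, 207]), (114, [4, 29, 35, 39, 59, 79, 242]),
   (115, [25, 34, 37, 86, 160, 254]), (116, [3, 32, 95, 97, 193]), (117, [2, 37, 104, 159, 162, 171, 188, 190,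
   293]), (118, [10, 32, 102, 109, 160, 234]), (119, [6, 22, 32, 42, 62, 102, 161]), (120, [5, 49, 85, 129,
   183]), (121, [22, 32, 54, 124, 178, 198]), (122, [13, 27, 55, 93, 94, 110, 189]), (123, [23, 52, 73, 75,
   159, 322]), (124, [3, 33, 97, 108, 116, 121, 168, 287, 288]), (125, [32, 58, 61, 100, 127, 237, 243]),
   (126, [37, 61, 64, 94, 246, 263]), (127, [27, 48, 58, 70, 125, 143, 204]), (128, [25, 29, 54, 61]), (129,
   [5, 12, 53, 71, 136, 208]), (130, [32, 88, 92, 101, 115, 233]), (131, [16, 73, 92, 93, 245, 299]), (132,
   [13, 24, 64, 84, 90, 158]), (133, [15, 17, 19, 48]), (134, [2, 36, 86, 104, 115, 117, 259]), (135, [26, 37,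
   67, 83, 110, 197]), (136, [4, 12, 49, 113, 129]), (137, [24, 27, 33, 71]), (138, [7, 20, 23, 147, 155]),
   (139, [8, 33, 58, 71, 100, 211]), (140, [39, 68, 70, 89, 92, 111, 154, 167, 188]), (141, [42, 43, 64, 119,
   126, 153, 182]), (142, [13, 52, 80, 105]), (143, [38, 58, 91, 191, 212, 261, 292]), (144, [47, 127, 141,
   281]), (145, [31, 50, 85, 104, 183, 224]), (146, [7, 27, 52, 329]), (147, [4, 5, 77, 200, 279]), (148, [26,
   30, 31, 48]), (149, [18, 36, 89, 134, 169, 176, 294]), (150, [1, 73, 103, 111, 184, 230]), (151, [12, 68,
   89, 147, 149, 157, 211, 212, 326]), (152, [14, 21, 58, 73, 123]), (153, [32, 43, 90, 160, 202]), (154, [11,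
   35, 50, 57, 59, 73]), (155, [7, 40, 65, 138, 338]), (156, [9, 24, 29, 47]), (157, [12, 93, 147, 151, 169,
   249, 290]), (158, [20, 52, 66, 84, 273, 295]), (159, [15, 110, 117, 131, 183, 251]), (160, [29, 32, 42, 56,
   115, 137]), (161, [30, 93, 98, 131, 150, 181, 206, 314]), (162, [11, 40, 99, 123, 154]), (163, [6, 43, 66,
   78, 239]), (164, [33, 37, 75, 122, 131, 270]), (165, [37, 62, 88, 101, 119, 126, 130]), (166, [8, 17, 52,
   67, 186]), (167, [35, 84, 86, 89, 201, 206, 273]), (168, [17, 33, 93, 157, 211, 272]), (169, [18, 108, 157,
   176, 181, 339]), (170, [12, 57, 63, 73, 103, 129]), (171, [19, 62, 124, 145, 159, 172, 199]), (172, [3, 46,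
   162, 187]), (173, [37, 48, 102, 165, 198]), (174, [2, 44, 65, 69, 84]), (175, [8, 21, 28, 47, 344]), (176,
   [35, 60, 77, 114, 155, 343]), (177, [65, 94, 99, 117, 249, 303, 345]), (178, [21, 36, 42, 60, 102]), (179,
   [43, 54, 56, 258]), (180, [31, 69, 97, 114, 217]), (181, [35, 83, 84, 167, 184]), (182, [42, 66, 94, 141,
   189, 253]), (183, [3, 7, 104, 120]), (184, [18, 46, 57, 78, 82, 103]), (185, [15, 29, 95, 110, 113, 197,
   320]), (186, [12, 52, 81, 112]), (187, [11, 48, 75, 101, 220, 323]), (188, [2, 117, 146, 162, 286]), (189,
   [9, 33, 64, 94, 169, 226]), (190, [9, 21, 36, 62]), (191, [38, 83, 135, 246]), (192, [2, 46, 95, 163]),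
   (193, [44, 76, 116, 134, 180, 192, 233]), (194, [33, 38, 62, 102, 143, 173, 232]), (195, [20, 33, 108, 117,
   159]), (196, [41, 125, 194, 308]), (197, [25, 45, 133]), (198, [27, 28, 37, 55, 109, 178, 245]), (199, [31,
   46, 110, 124, 135, 171, 226]), (200, [21, 41, 56, 71, 138]), (201, [53, 68, 113, 151, 160, 330]), (202,
   [32, 70, 76, 78, 210]), (203, [48, 144, 153, 215, 220, 238]), (204, [27, 75, 100, 139, 164]), (205, [81,
   175, 279]), (206, [30, 32, 86, 98, 116, 289]), (207, [53, 83, 113, 181, 201, 227]), (208, [38, 47, 81,
   96]), (209, [36, 165, 267, 333]), (210, [42, 78, 121, 128, 181, 199]), (211, [17, 86, 92, 151]), (212, [5,
   83, 103, 334]), (213, [23, 40, 47]), (214, [21, 22, 35]), (215, [33, 47, 109, 189, 232, 262]), (216, [29,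
   41, 66, 156, 304, 337]), (217, [2, 7, 97]), (218, [16, 38, 49]), (219, [25, 55, 217]), (220, [33, 187, 202,
   203, 301, 335]), (221, [30, 35, 61]), (222, [38, 126, 196, 209, 240, 310]), (223, [13, 19, 45, 98]), (224,
   [22, 30, 104, 248]), (225, [28, 35, 89, 145, 154]), (226, [2, 124, 134, 259, 341]), (227, [14, 52, 103,
   107]), (228, [26, 100, 116, 135]), (229, [43, 59, 61, 69]), (230, [11, 61, 88, 269, 302]), (231, [164, 191,
   245]), (232, [33, 175, 178, 194, 198, 215]), (233, [31, 46, 92, 193, 199, 303]), (234, [22, 56, 183]),
   (235, [43, 109, 121, 169, 210, 226]), (236, [27, 49, 68, 142, 146, 170]), (237, [43, 58, 188, 252, 253]),
   (238, [43, 173, 203, 284]), (239, [39, 72, 98]), (240, [36, 41, 76, 90, 153, 262, 315]), (241, [16, 60, 86,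
   258, 272]), (242, [41, 43, 79]), (243, [61, 102, 121, 210, 313]), (244, [12, 157, 236, 260, 286]), (245,
   [49, 83, 131, 157, 170, 236]), (246, [48, 64, 122, 161, 164]), (247, [38, 48, 63, 270]), (248, [44, 50,
   72]), (249, [4, 68, 80, 83]), (250, [47, 110, 366]), (251, [3, 95, 116, 297]), (252, [43, 117, 243, 358,
   359]), (253, [32, 66, 167, 179, 214]), (254, [48, 115, 118, 130, 332]), (255, [37, 51, 319]), (256, [16,
   29, 98, 180]), (257, [25, 98, 128]), (258, [39, 77, 167, 289]), (259, [31, 60, 180]), (260, [1, 76, 86, 92,
   93]), (261, [47, 58, 146, 236, 349]), (262, [47, 90, 91, 250]), (263, [6, 11, 82, 342]), (264, [127, 143,
   247, 265]), (265, [64, 144, 208, 264, 271]), (266, [27, 85, 223]), (267, [28, 38, 75, 209, 331]), (268,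
   [36, 163, 165, 209, 238]), (269, [6, 61, 101, 111, 128, 305]), (270, [15, 16, 24, 25]), (271, [38, 126,
   222]), (272, [16, 77, 85, 96, 147]), (273, [40, 116, 188, 193, 217, 244]), (274, [44, 180, 193]), (275,
   [70, 91, 311]), (276, [6, 119, 375]), (277, [142, 170, 236]), (278, [1, 89, 108]), (279, [24, 38, 55, 60]),
   (280, [80, 81, 95]), (281, [127, 141, 296]), (282, [94, 122, 332]), (283, [50, 70, 140, 193]), (284, [36,
   118, 139, 291]), (285, [41, 58, 68, 237, 340]), (286, [45, 70, 103]), (287, [3, 134, 254]), (288, [23, 178,
   316]), (289, [54, 97, 106]), (290, [33, 42, 112, 156, 157, 200]), (291, [47, 102, 190, 261]), (292, [81,
   82, 376]), (293, [119, 161, 171]), (294, [21, 104, 321]), (295, [64, 195, 251]), (296, [27, 182, 269, 346,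
   347]), (297, [50, 199, 283]), (298, [42, 114, 324]), (299, [5, 86, 241]), (300, [60, 130, 268, 309]), (301,
   [210, 300, 317, 318, 350]), (302, [19, 46, 67, 74]), (303, [32, 99, 285]), (304, [33, 196, 202]), (305,
   [44, 46, 99, 174]), (306, [166, 228, 312]), (307, [61, 93, 235]), (308, [41, 125, 365]), (309, [27, 144,
   182]), (310, [75, 336, 367]), (311, [38, 86, 312]), (312, [23, 36, 86, 116, 356]), (313, [61, 89, 254]),
   (314, [127, 150, 212]), (315, [137, 156, 200]), (316, [38, 109, 122, 299, 311]), (317, [42, 144, 204]),
   (318, [10, 144, 271]), (319, [26, 34, 106, 351]), (320, [52, 76, 110]), (321, [35, 41, 53, 65]), (322, [8,
   57, 213]), (323, [30, 72, 154]), (324, [14, 44, 154]), (325, [130, 140, 283, 313]), (326, [53, 57, 225]),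
   (327, [41, 60, 200]), (328, [43, 173, 196, 353, 354]), (329, [28, 40, 170]), (330, [4, 147, 327]), (331,
   [26, 74, 145]), (332, [48, 124, 168]), (333, [119, 175, 373]), (334, [35, 181, 184]), (335, [78, 139,
   238]), (336, [42, 204, 230, 352]), (337, [65, 174, 180]), (338, [41, 47, 112]), (339, [4, 84, 216]), (340,
   [80, 99, 357]), (341, [45, 86, 241]), (342, [46, 69, 302]), (343, [54, 65, 77]), (344, [47, 71, 200]),
   (345, [2, 192, 217]), (346, [36, 163, 268]), (347, [28, 209, 369]), (348, [48, 153, 203, 222, 328, 355]),
   (349, [112, 152, 170]), (350, [235, 254, 300]), (351, [30, 74, 85]), (352, [33, 187, 220]), (353, [179,
   198, 325]), (354, [102, 196, 377]), (355, [90, 222, 372]), (356, [9, 45, 95]), (357, [14, 66, 305]), (358,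
   [39, 117, 131]), (359, [18, 117, 294]), (360, [125, 194, 196]), (361, [232, 290, 291]), (362, [238, 291,
   360]), (363, [41, 64, 285]), (364, [141, 242, 363]), (365, [58, 144, 364]), (366, [49, 142, 236]), (367,
   [126, 165, 230]), (368, [68, 114, 324]), (369, [165, 243, 325]), (370, [55, 77, 148]), (371, [48, 51, 61]),
   (372, [126, 246, 371]), (373, [36, 285, 327]), (374, [208, 215, 316]), (375, [14, 150, 357]), (376, [67,
   87, 142]), (377, [125, 229, 237]), (378, [28, 309, 361, 362]), (379, [31, 34, 35, 56]), (380, [18, 111,
   184, 368]), (381, [94, 182, 235, 300]), (382, [27, 268, 269, 296]), (383, [19, 134, 145, 370]), (384, [90,
   203, 247, 374])]"

text \<open>The case analysis behind the list: patterns 40 and 21 and the neighbour 61 force vertex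
  1 to \<open>C2\<close>; patterns 47 and 59 and the neighbour 43 force vertex 2 to
  \<open>C0\<close>. Patterns 44, 60 and 65 exclude \<open>C3\<close> from the vertices 7, 4 and 12,
  after which propagation ends in a contradiction. The other patterns are intermediate
  results.\<close>

definition alternating_items :: "item list" where
  "alternating_items = [
   Learn 1 [(2, C0), (1, C3), (8, C3)] [Look [9, 18]],
   Learn 2 [(3, C0), (9, C3), (1, C3)] [Look [17, 8]],
   Learn 3 [(148, C1), (1, C3), (2, C1)] [Look [18, 9], Use 2, Look [3, 7, 30, 39, 5, 22, 26, 4, 23, 56, 34,
   31, 21, 53, 16, 65, 28, 104, 35, 85, 49, 54, 63, 145, 55, 97, 96, 50, 225, 77, 15, 11, 89, 78, 27, 46, 32,
   67, 72, 116, 59, 95, 6]],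
   Learn 4 [(26, C2), (3, C3), (1, C3)] [Look [19, 5, 74, 30, 34, 73, 22, 88]],
   Learn 5 [(5, C0), (1, C3), (2, C1)] [Look [18, 9], Use 2, Look [3, 7], Use 4, Look [26, 34, 4, 23, 65, 40,
   54, 104, 12, 155, 97, 183, 15, 16, 20, 49, 52, 24, 79, 120, 25, 242, 17, 114, 51, 8, 29, 67, 11, 6, 37, 95,
   70, 116, 91]],
   Learn 6 [(19, C2), (56, C3), (4, C0), (21, C3), (30, C1), (6, C1), (52, C1), (1, C3), (84, C1), (35, C3),
   (34, C0), (57, C2), (183, C2), (46, C2), (2, C1)] [Look [18, 9], Use 2, Look [3, 7, 26, 22, 39, 25, 77,
   234, 97, 13, 15, 67, 20, 95, 24, 116, 29, 124, 251, 128, 159, 54, 32, 206, 94, 121, 118, 68, 167, 108, 100,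
   102, 140, 89, 181, 195, 111, 93, 27, 210, 169, 33, 146, 80, 42, 28, 243, 235, 189, 194, 236, 249, 160, 71,
   125, 109, 182, 90, 261, 157, 153, 139, 196, 215, 141, 70, 291, 290, 360, 203, 232, 127, 284, 361, 144, 238,
   309, 362, 378]],
   Learn 7 [(6, C1), (1, C3), (3, C3), (57, C2), (56, C3), (30, C1), (84, C1), (183, C2), (2, C1)] [Look [18,
   7], Use 4, Look [26, 22], Use 5, Look [5, 34, 4, 23, 35, 21, 39, 77, 59, 72, 46, 52], Use 6, Look [19, 106,
   13, 16, 51, 31, 49, 11, 65, 55, 75, 54, 73, 32, 74, 154, 27, 63, 89, 28, 225]],
   Learn 8 [(2, C1), (1, C3)] [Look [18, 9], Use 2, Look [3, 7], Use 4, Look [26], Use 3, Look [148, 30, 22],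
   Use 5, Look [5, 34, 4, 35, 21, 39, 53, 104, 25, 77, 57, 56, 183, 45, 234, 84], Use 7, Look [6, 13, 66, 19,
   14, 15, 20, 24, 132, 29, 42, 76, 93, 160, 89, 118, 167, 32, 100, 102, 140, 253, 119, 68, 58, 178, 70, 237,
   141, 108, 201, 64, 27, 125, 285, 33, 113, 90, 127, 363, 79, 109, 144, 242, 198, 364, 232, 365, 194, 308,
   196]],
   Learn 9 [(3, C0), (1, C3)] [Look [17], Use 8, Look [2, 44, 8, 12, 7, 14, 15, 112, 40, 23, 52, 63, 5, 20,
   21, 46, 4, 53, 107, 22, 67, 99, 16, 129, 227, 28, 49, 11, 45, 136, 103, 83, 80, 207, 113]],
   Learn 10 [(39, C0), (5, C0), (21, C3), (30, C3), (73, C1), (1, C3), (3, C1), (26, C3), (97, C1)] [Look [17,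
   8], Use 1, Look [2, 7, 4, 20, 24, 217, 34, 25, 55, 45, 29, 49, 60, 79, 16, 71, 114, 106, 56, 180, 19, 77,
   256, 13, 93, 75, 122, 131, 42, 27, 161, 164, 37, 102, 36, 83, 246, 173, 58, 245, 191, 231, 143, 33, 194]],
   Learn 11 [(98, C0), (3, C1), (52, C1), (166, C2), (26, C3), (5, C0), (45, C2), (6, C3), (9, C1), (21, C3),
   (56, C1), (29, C2), (25, C0), (7, C0), (75, C0), (54, C0), (13, C2), (55, C3), (73, C1), (16, C3), (77,
   C2), (1, C3)] [Look [34, 23, 256, 93, 122, 131, 42, 27, 94, 164, 110, 37, 160, 102, 36, 32, 83, 246, 135,
   58, 153, 126, 191, 67, 127, 64, 240, 143, 63, 141, 222, 247, 144, 271, 264, 265]],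
   Learn 12 [(29, C2), (19, C0), (2, C3), (25, C0), (3, C1), (52, C1), (166, C2), (26, C3), (5, C0), (45, C2),
   (6, C3), (9, C1), (21, C3), (75, C0), (54, C0), (55, C3), (73, C1), (16, C3), (77, C2), (1, C3)] [Look [7,
   34, 13, 128, 60, 71, 56], Use 11, Look [98, 257, 69]],
   Learn 13 [(9, C1), (75, C0), (3, C1), (6, C3), (16, C3), (25, C0), (55, C3), (5, C0), (45, C2), (21, C3),
   (104, C1), (258, C0), (20, C0), (19, C0), (26, C3), (54, C0), (77, C2), (1, C3)] [Look [17, 8], Use 1, Look
   [2, 22, 57, 73, 34, 88, 23, 52, 166, 13], Use 12, Look [29, 60, 79, 241, 36, 99, 86, 27, 134, 178, 46, 341,
   115, 299, 122, 28, 32, 119, 82, 226, 37, 131, 316, 11, 267, 130, 121, 70, 92, 288, 263, 100, 254, 165, 235,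
   108, 90, 211, 124, 126, 125, 209, 240, 139, 33, 141, 127, 268, 222, 204, 42, 144, 300, 271, 317, 350, 318,
   301]],
   Learn 14 [(6, C3), (3, C1), (26, C3), (5, C0), (45, C2), (55, C3), (25, C0), (21, C3), (54, C0), (1, C3),
   (24, C3), (75, C0), (16, C3), (104, C1), (258, C0), (20, C0), (19, C0), (77, C2)] [Look [17, 8], Use 1,
   Look [2, 7, 23, 52, 166], Use 13, Look [9, 156, 18, 66, 29, 12, 53, 14, 60, 15, 56, 36, 179, 133, 81, 42,
   32, 190, 197, 208, 76, 110, 27, 253, 83, 58, 135, 182, 127, 67, 191, 141, 63, 143, 64, 144, 247, 265, 264]],
   Learn 15 [(19, C0), (5, C0), (3, C1), (45, C2), (57, C2), (55, C3), (30, C3), (1, C3), (88, C3), (26, C3),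
   (21, C3)] [Look [17, 8], Use 1, Look [2, 7, 73, 4, 20, 65, 24, 54, 97, 34, 104, 23], Use 10, Look [39, 25,
   16, 77, 106, 13, 289, 75, 258], Use 14, Look [6, 98, 101, 69, 11, 29, 9, 84, 87, 31, 230, 28, 14, 18, 82,
   35, 150, 27, 71, 12, 46, 161, 62, 56, 15, 67, 184, 181, 83, 64, 42, 81, 63, 334, 58, 141, 208, 247, 212,
   127, 143, 144, 264, 265]],
   Learn 16 [(21, C3), (30, C3), (5, C0), (1, C3), (3, C1), (26, C3), (97, C1)] [Look [17, 8], Use 1, Look [2,
   7, 22, 57, 73, 4, 20, 217, 34, 88, 104, 224, 23, 52, 105, 40, 166], Use 10, Look [39, 25, 16, 77, 49, 45,
   55, 219], Use 15, Look [19, 106, 74, 13, 15, 319, 75, 63, 142, 133, 11, 67, 170, 197, 51, 37, 28, 78, 46,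
   236, 135, 50, 255, 115, 100, 109, 27, 99, 366, 245, 110, 145, 90, 93, 86, 204, 198, 62, 162, 131, 250, 127,
   173, 171, 117, 161, 92, 164, 159, 64, 262, 199, 134, 119, 211, 102, 126, 33, 240, 36, 141, 139, 118, 42,
   222, 144, 284, 210, 271, 317, 238, 318, 203, 335, 301, 220]],
   Learn 17 [(21, C2), (3, C1), (1, C3), (5, C0)] [Look [14, 23, 44, 40]],
   Learn 18 [(5, C0), (1, C3), (3, C1), (30, C3)] [Look [17, 8], Use 1, Look [2, 7, 22, 57, 73, 4, 20, 65, 24,
   54, 97], Use 17, Look [21, 23], Use 16, Look [26, 19, 34, 74, 13, 88, 56, 63, 28, 71, 179, 53, 247, 11, 60,
   129, 55, 14, 29, 96, 27, 152, 42, 208, 137, 76, 33, 70, 58, 91, 127, 90, 143, 64, 141, 264, 144, 265]],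
   Learn 19 [(30, C3), (1, C3), (3, C1)] [Look [17, 8], Use 1, Look [2, 7, 22], Use 18, Look [5, 26, 4, 35,
   21, 39, 20, 31, 23, 25, 24, 15, 16, 65, 52, 133, 96, 12, 49, 54, 166, 63, 45, 136, 67, 60, 197, 84, 29,
   135, 113, 110, 185]],
   Learn 20 [(3, C1), (1, C3)] [Look [17, 8], Use 1, Look [2], Use 19, Look [30, 39, 5, 22, 72, 21, 51, 14,
   11]],
   Learn 21 [(1, C3)] [Use 9, Use 20, Look [3], Use 8, Look [2, 19, 7, 18, 13, 9, 12, 81, 40, 15, 20, 52, 24,
   4, 23, 79, 46, 25, 49, 105, 213, 67, 99, 29, 136, 142, 53, 6, 57, 129, 80, 103, 68, 170, 236]],
   Learn 22 [(3, C3), (1, C0)] [Look [17, 44, 8, 14, 40, 112, 12, 18, 9, 2, 57, 13, 7, 19, 75, 6, 52, 73, 69,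
   11, 46, 186, 31, 59, 51, 81, 35, 65, 154, 98, 15, 5, 162, 95, 20, 4, 104, 192, 24, 117, 97, 134, 180, 193]],
   Learn 23 [(5, C3), (1, C0), (3, C0), (2, C1)] [Look [7, 18, 30, 4, 23, 22, 35, 65, 21, 59, 31, 54, 321,
   214, 16, 40, 39, 44, 77, 114, 50, 104, 14, 343, 154, 294, 8, 176, 11, 149, 28, 89, 225]],
   Learn 24 [(30, C3), (7, C3), (5, C2), (3, C0)] [Look [26, 34, 22, 35, 31, 56, 379]],
   Learn 25 [(20, C0), (3, C0), (1, C0), (77, C2), (8, C1), (2, C1)] [Look [7, 18, 9], Use 23, Look [5, 26, 4,
   39, 25, 45, 57, 24, 107, 13, 29, 12, 19, 6, 114, 15, 11, 79, 14, 113, 52, 185, 136, 110, 60, 42, 279, 93,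
   33, 147, 89, 108, 138, 278, 96, 62, 63, 28]],
   Learn 26 [(11, C2), (34, C3), (8, C1), (3, C0), (2, C1), (1, C0), (25, C3), (24, C0), (52, C1), (15, C3)]
   [Look [7, 18, 9], Use 23, Look [5, 23, 21, 45], Use 24, Look [30, 22, 17, 19, 13, 67, 51, 75, 28, 6, 14,
   16, 50, 123, 71, 101, 29, 59, 270, 31, 74, 152, 33, 87, 128, 72, 302, 73, 164, 139, 54, 46, 230, 92, 100,
   32, 82, 88, 233, 37, 204, 94, 27, 58, 130, 42, 126, 62, 125, 165, 336, 194, 367, 196, 310, 222]],
   Learn 27 [(29, C2), (34, C3), (1, C0), (84, C1), (2, C1), (24, C0), (52, C1), (23, C3), (30, C1), (35, C3),
   (3, C0), (183, C2), (15, C3), (8, C1), (4, C3), (97, C1), (158, C0), (66, C3)] [Look [7, 18, 39, 25, 77,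
   22, 19, 13], Use 26, Look [11, 6, 128, 114, 216, 95, 101, 163, 54, 176, 339, 116, 192, 187, 78, 32, 169,
   124, 251, 46, 184, 94, 119, 93, 33, 159, 172, 181, 161, 89, 123, 171, 210, 27, 146, 75, 293, 202, 235, 137,
   117, 220, 307, 160, 188, 352, 109, 140, 37, 118, 111, 42, 100, 269, 204, 230, 336]],
   Learn 28 [(42, C0), (29, C1), (15, C3), (52, C1), (7, C3), (14, C2)] [Look [76, 110, 320, 185]],
   Learn 29 [(8, C1), (34, C3), (183, C2), (4, C3), (3, C0), (1, C0), (35, C3), (84, C1), (2, C1), (23, C3),
   (30, C1)] [Look [7, 18, 9, 39, 25, 77, 22, 17, 57], Use 25, Look [20, 52, 24, 15, 19, 97, 13, 132], Use 26,
   Look [11, 14, 44, 66, 158], Use 27, Look [29, 6, 114, 59, 154, 324], Use 28, Look [42, 76, 93, 33, 298, 91,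
   168, 124, 71, 108, 332, 137, 56, 68, 90, 160, 32, 70, 27, 64, 262, 118, 202, 122, 189, 254, 153, 215, 115,
   203, 37, 220, 94, 187, 282, 101]],
   Learn 30 [(2, C1), (1, C0), (3, C0)] [Look [7, 18, 9], Use 23, Look [5, 26, 4, 23, 34, 39, 21, 25, 104, 45,
   183, 84], Use 24, Look [30, 22, 35], Use 29, Look [8, 17, 175, 14, 49, 12, 28, 11, 44, 66, 55, 107, 71, 78,
   50, 6, 20, 51, 154, 13, 24, 72, 27, 33, 323, 70, 198, 62, 32, 187, 232, 64, 202, 189, 220, 153, 215, 203]],
   Learn 31 [(3, C0), (1, C0)] [Use 30, Look [2, 19, 18, 13, 15, 9, 81, 12, 17, 45, 8, 57, 14, 52, 11, 44, 66,
   46, 186, 6, 50, 84, 112, 59, 51, 113, 40, 72, 154, 16, 80, 35, 101, 39, 248, 324, 4, 87, 114, 78, 68, 111,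
   184, 368, 380]],
   Learn 32 [(2, C3), (1, C0), (8, C0)] [Look [9, 18]],
   Learn 33 [(14, C2), (1, C0), (18, C3)] [Use 31, Use 22, Look [3, 17, 8, 2, 7, 9, 57, 45, 44, 40, 12, 112,
   338, 155, 79, 113, 20, 242, 15, 4, 138, 19, 84, 39, 136, 23, 13, 16, 114, 60, 21, 6, 51, 59, 176, 36, 80,
   11, 77, 149, 111, 154, 89, 140]],
   Learn 34 [(5, C2), (14, C3), (40, C3)] [Look [23, 21]],
   Learn 35 [(23, C0), (45, C2), (65, C0), (7, C3), (40, C3), (57, C2), (1, C0), (14, C3), (20, C3)] [Use 31,
   Look [3, 17, 8], Use 34, Look [5, 73, 30, 4, 22, 105, 21, 213, 12, 28, 322, 53, 15, 85, 123, 129, 19, 63,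
   51, 52, 71, 13, 170, 16, 98, 200, 329, 223, 147, 146, 272, 138, 27, 155, 266, 60, 86, 241]],
   Learn 36 [(11, C1), (13, C2), (21, C0), (14, C3), (1, C0), (65, C0), (52, C1), (217, C2), (73, C1), (9,
   C1), (40, C3), (104, C1), (123, C0)] [Use 31, Use 22, Look [3, 17, 8], Use 32, Look [2, 7, 45], Use 34,
   Look [5, 30, 4, 22, 20, 152, 19, 75, 6, 51, 187, 28, 78, 162, 85, 101, 88, 267, 163, 172, 117, 16, 25, 87,
   74, 34, 46, 188, 134, 39, 92, 351, 26, 37, 192, 273, 36, 77, 130, 319, 115, 345, 58, 158, 272, 165, 255,
   254, 177, 102, 66, 209, 268, 93, 287, 94, 168, 89, 346, 42, 124, 140, 313, 178, 182, 325, 243, 121, 369,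
   32, 347, 27, 296]],
   Learn 37 [(27, C0), (2, C0), (162, C1), (21, C0), (9, C1), (52, C1), (7, C3), (28, C1), (13, C2)] [Look
   [62, 146, 190, 188, 117]],
   Learn 38 [(13, C2), (22, C3), (57, C2), (8, C0), (17, C3), (217, C2), (156, C3), (7, C3), (1, C0), (18,
   C3), (2, C0), (104, C1), (30, C0), (40, C3), (65, C0), (23, C2)] [Look [9, 45], Use 33, Look [14, 5, 73, 4,
   54, 52, 21, 152, 19, 75, 6, 123], Use 36, Look [11, 51, 28, 162, 85, 98, 16, 223, 39, 25, 77], Use 37, Look
   [27, 266, 62, 89, 36, 86, 93, 60, 190, 149, 83, 260, 29, 55, 178, 37, 92, 216, 219, 198, 102, 70, 42, 211,
   66, 90, 109, 119, 58, 291, 127, 151, 165, 64, 139, 68, 173, 141, 284, 32, 144, 182, 238, 94, 121, 309, 268,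
   235, 300, 381]],
   Learn 39 [(18, C3), (1, C0)] [Use 31, Use 22, Look [3, 17, 8, 2, 7, 9, 57, 45], Use 33, Look [14, 44, 65,
   40], Use 34, Look [5, 73, 30, 4, 104, 22, 54, 20, 24, 97, 156, 217], Use 35, Look [23, 52, 21, 152], Use
   38, Look [13, 19, 6, 26, 15, 11, 29, 59, 99, 66, 74, 34, 12, 25, 60, 69, 158, 63, 112, 37, 36, 174, 132,
   170, 70, 94, 83, 42, 58, 305, 103, 349, 90, 32, 182, 269, 212, 261, 27, 153, 143, 296, 141, 127, 281, 144]],
   Learn 40 [(1, C0)] [Use 31, Use 22, Look [3, 17, 8], Use 32, Look [2, 7], Use 39, Look [18, 9, 12, 53, 13,
   105, 40, 56, 19, 75, 6, 44, 23, 69, 11, 65, 14, 5, 31, 59, 51, 52, 21, 30, 4, 129, 35, 72, 142, 123, 22,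
   85, 16, 54, 214, 46, 80, 162, 28, 57, 120, 98, 39, 179, 101, 103, 73, 49, 239, 25, 150, 55, 84, 163, 29,
   27, 111, 66, 60, 42, 269, 253, 36, 119, 37, 182, 165, 296, 268, 382]],
   Fix [Use 40, Use 21, Look [1]],
   Learn 41 [(9, C3), (3, C1), (2, C0)] [Look [8, 18, 17, 12]],
   Learn 42 [(2, C0), (7, C3)] [Look [19, 3, 13], Use 41, Look [9, 18, 12, 15, 81, 20, 208, 24, 4, 49, 5, 65,
   16, 55, 30, 129, 54, 31, 39, 120, 69, 148, 35, 77, 183, 221, 114, 29, 370, 44, 180, 60, 50, 104, 259, 145,
   134, 383]],
   Learn 43 [(9, C0), (7, C3)] [Use 42, Look [2, 3, 44, 14, 13, 18, 19, 52, 12, 26, 81, 17, 40, 31, 15, 133,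
   45, 8, 112, 50, 35, 223, 57, 5, 186, 69, 11, 4, 53, 166, 98, 229, 78, 39, 67, 84, 59, 184, 25, 103, 6, 181,
   197, 227, 95, 207, 185, 110]],
   Learn 44 [(7, C3)] [Use 42, Look [2, 3], Use 43, Look [9, 13, 8, 19, 17, 15, 12, 81]],
   Learn 45 [(8, C1), (2, C1), (26, C2), (227, C0), (12, C3), (9, C3)] [Use 44, Look [7, 3, 44, 14, 18, 17,
   11, 57, 45, 105, 50, 6, 103, 23, 51, 31, 184, 5, 98, 65, 83, 53, 174, 35, 84, 181]],
   Learn 46 [(9, C3), (2, C1)] [Use 44, Look [7, 3, 44, 14, 13, 18, 19, 52, 26, 15, 81, 12, 107, 227], Use 45,
   Look [8, 17, 49, 16, 55, 4, 31, 39, 5, 20, 65, 25, 77, 53, 24, 174, 54, 45, 147, 57, 56, 84, 60, 138, 113,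
   71, 200, 33, 327, 91, 330, 68, 201]],
   Learn 47 [(2, C1)] [Use 44, Look [7, 3, 44, 14], Use 46, Look [9, 13, 8, 18, 11, 12, 53, 6, 50, 40, 59, 35,
   154]],
   Learn 48 [(5, C3), (2, C3), (3, C0)] [Look [30, 4, 39]],
   Learn 49 [(11, C2), (9, C0), (2, C3), (82, C1), (3, C0), (57, C2)] [Look [19, 13, 18, 12, 17, 7, 44, 45,
   46], Use 48, Look [5, 4, 53, 49, 56, 55, 77, 147, 50, 6, 69, 101, 31, 25, 26, 39, 74, 97, 34, 73, 180, 37,
   170, 70, 115, 103, 286, 83, 135, 86, 212, 199, 134, 151, 233, 68, 157, 201, 130, 193, 140, 108, 244, 245,
   283, 116, 274, 169, 90, 198, 325, 228, 124, 273, 93, 149, 64, 67, 226, 167, 36, 126, 51, 189, 258, 240,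
   165, 371, 122, 179, 222, 173, 246, 353, 372, 328, 355, 348]],
   Learn 50 [(35, C2), (147, C1), (12, C3), (156, C1), (200, C3), (14, C0), (57, C2), (53, C3), (145, C0),
   (28, C3)] [Look [225, 40, 326, 112, 151, 290, 157]],
   Learn 51 [(65, C2), (28, C3), (11, C1), (8, C3), (200, C3), (16, C2), (87, C3), (46, C2), (31, C3), (172,
   C1), (57, C2), (45, C2), (23, C3), (29, C3), (180, C0), (3, C0), (97, C1), (9, C0), (22, C1), (69, C1), (2,
   C3)] [Look [19, 44, 14, 5, 4, 6, 21, 174, 54, 84, 32, 111, 116, 119, 36, 80, 124, 193, 76, 312, 86, 60, 68,
   171, 233, 58, 311, 71, 327, 91, 92, 62, 285, 344, 130, 373, 27, 175, 165, 70, 333, 275, 209, 75, 267]],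
   Learn 52 [(23, C3), (57, C2), (4, C3), (6, C2), (12, C3), (22, C1), (87, C3), (9, C0), (29, C3), (69, C1),
   (2, C3), (11, C1), (8, C3), (46, C2), (31, C3), (172, C1), (45, C2), (3, C0), (97, C1), (39, C0), (147,
   C1), (53, C3), (145, C0), (56, C0), (15, C1)] [Look [14, 156, 16, 21, 28, 200], Use 50, Look [35, 114,
   180], Use 51, Look [65, 54, 128, 60, 84, 36, 111, 32, 80, 68]],
   Learn 53 [(15, C1), (14, C0), (29, C3), (9, C0), (11, C1), (34, C3), (8, C3), (46, C2), (145, C0), (56,
   C0), (2, C3), (3, C0), (57, C2), (4, C3), (12, C3), (22, C1), (87, C3), (31, C3), (172, C1), (45, C2), (39,
   C0), (147, C1), (53, C3)] [Look [19, 13, 6, 69, 26, 97, 156], Use 52, Look [23, 63, 20, 21, 74, 28, 24,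
   200, 302, 331, 71, 342, 267, 33, 60, 263, 62, 37, 137, 36, 76, 126, 165, 315, 209, 240, 222]],
   Learn 54 [(39, C0), (57, C2), (3, C0), (12, C3), (11, C1), (9, C0), (34, C3), (46, C2), (56, C0), (2, C3),
   (31, C3), (147, C1), (53, C3)] [Look [19, 13, 17, 44, 133, 45, 8, 14, 82, 5, 4, 50, 6, 78, 22, 30, 25, 72,
   197, 101, 29, 248, 187, 87, 224, 172, 104, 145], Use 53, Look [15, 16, 185, 85, 113, 28, 80, 63, 21, 68,
   74, 92, 73, 58, 152]],
   Learn 55 [(3, C0), (9, C0), (2, C3)] [Look [19, 13, 18, 12, 17, 7, 44, 133, 45, 8, 14, 57, 52, 46, 82], Use
   48, Look [5, 4, 53, 49, 56, 55, 77, 147], Use 49, Look [11, 50, 6, 78, 31, 22, 26, 97, 34], Use 54, Look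
   [39, 25, 72, 16, 197, 37, 51, 59, 15, 115, 100, 67, 99, 270, 81, 86, 32, 95, 135, 166, 80, 247, 116, 125,
   160, 356, 228, 280, 58, 118, 312, 91, 64, 109, 311, 306, 33, 90, 316, 96, 215, 153, 208, 203, 374, 384]],
   Learn 56 [(9, C0), (2, C3)] [Look [19, 13, 18, 12], Use 55, Look [3, 17, 7, 40, 53, 35, 5, 56, 30, 4, 65,
   49, 54, 31, 45, 16, 55, 26, 223, 106, 85, 15, 97, 51, 96, 289, 71, 98, 272, 60, 206, 241, 86]],
   Learn 57 [(12, C3), (13, C3), (2, C3), (3, C1), (59, C3)] [Use 56, Look [9, 6, 18, 7, 17, 40, 107, 105, 8,
   35, 20, 57, 14, 53, 52, 24, 4, 79, 56, 142, 29, 80, 42, 68, 76, 91]],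
   Learn 58 [(3, C1), (2, C3), (13, C3), (59, C3)] [Look [7], Use 57, Look [12, 15, 20, 4, 16, 49]],
   Learn 59 [(2, C3)] [Look [19, 13], Use 56, Look [9, 6, 18, 69, 59], Use 58, Look [3, 7, 8, 44], Use 48,
   Look [5, 53, 17, 11, 14, 50, 4, 56, 12, 52, 78, 66, 31, 49, 107, 46, 99, 22, 26, 45, 55, 20, 82, 184, 80,
   305, 57, 34, 77, 24, 87, 263, 113, 357, 68, 147, 111, 340, 249, 91, 32, 151, 150, 285, 33, 119, 201, 73,
   375, 303, 37, 207, 92, 276, 177, 233, 126, 76, 110, 130, 94, 36, 122, 27]],
   Fix [Use 47, Use 59, Look [2, 19], Use 44, Look [7, 13, 3, 44, 14, 52, 46]],
   Learn 60 [(4, C3)] [Look [24, 20]],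
   Fix [Use 60, Look [4, 49, 5, 55, 53, 56, 77, 147]],
   Learn 61 [(8, C1), (12, C3)] [Look [18, 9, 82, 17, 11, 184, 133, 105, 50, 6, 15, 142, 23, 51, 69, 81, 20,
   87, 63, 21, 67, 98, 31, 24, 45, 28, 376, 103, 65, 279, 175, 292, 150, 83, 54, 205, 111, 86, 212, 143, 27,
   84, 36, 127, 181, 32, 314, 206, 161]],
   Learn 62 [(34, C0), (50, C1), (54, C3), (31, C3), (9, C3), (180, C0), (8, C0), (57, C2), (15, C2), (104,
   C1), (25, C1)] [Look [82, 11, 39, 20, 24, 97, 29, 37, 26, 70, 33, 117, 74, 134, 91, 71, 195, 63, 68, 60,
   139, 28, 140, 259, 58, 62, 76, 283, 226, 64, 143, 36, 27, 199, 194, 32, 127, 116, 297, 202, 125, 251, 196,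
   295, 304, 158, 216, 66]],
   Learn 63 [(15, C2), (80, C2), (45, C2), (57, C2), (25, C1), (6, C1), (54, C3), (9, C3), (104, C1), (12,
   C3)] [Use 61, Look [8, 69, 50, 31, 20, 24, 97, 180], Use 62, Look [34, 71, 33, 91, 37, 68, 83, 249]],
   Learn 64 [(6, C1), (12, C3), (45, C2)] [Look [18, 9, 57], Use 61, Look [8, 82, 101, 69, 11, 25, 87, 50, 31,
   39, 80, 65, 142, 54, 104, 321], Use 63, Look [15, 16, 218, 26, 74, 97, 34, 63, 73, 180, 37, 23, 92, 170,
   70, 117, 21, 131, 58, 68, 103, 134, 294, 159, 358, 64, 76, 236, 286, 83, 359, 102, 260, 193, 36, 283, 277,
   188, 135, 252, 173, 244, 116, 32, 62, 199, 237, 90, 202, 194, 33, 297, 125, 132, 195, 251, 196, 84, 295,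
   304, 174, 158, 337, 66, 216]],
   Learn 65 [(12, C3)] [Look [18, 9, 57], Use 61, Look [8, 82, 17, 45], Use 64, Look [6, 69, 11, 50, 78, 31,
   22, 65, 174, 54, 104, 84, 32, 113, 94, 121, 119, 80, 68, 249, 108, 157, 124, 83, 151, 199, 86, 171, 210,
   211, 117, 243, 168, 177, 252, 33, 99, 102, 64, 59, 58, 194, 132, 189, 229, 125, 237, 90, 215, 196, 377,
   153, 354, 203, 328, 348]],
   Fix [Use 65, Look [12, 15, 17, 129, 136]]]"

text \<open>Vertex 10 is the centre; 41, 38, 61 form the monochromatic triple and 47, 48, 43 the
  opposite one.\<close>

definition alternating_start :: pattern where
  "alternating_start = [(10,C0),(41,C1),(38,C1),(61,C1),(47,C2),(48,C2),(43,C2)]"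

lemma alternating_edges_ok: "edges_ok unit_apart (index alternating_points Tip) alternating_edges"
  unfolding alternating_points_def alternating_edges_def
  by (simp only: edges_simps unit_apart.simps)

lemma alternating_replay:
  "replay (index alternating_edges Tip) alternating_items (index [] Tip) (Some (suppose alternating_start Tip)) = None"
  unfolding alternating_edges_def alternating_items_def alternating_start_def
  by (simp only: check_simps)

lemma alternating_start:
  "matches (seen h place (index alternating_points Tip)) alternating_start \<longleftrightarrow>
     h (place (0, 0, 0, 0)) = C0 \<and> h (place (12, 0, 0, 0)) = C1 \<and> h (place (-6, 0, 6, 0)) = C1 \<and>
     h (place (-6, 0, -6, 0)) = C1 \<and> h (place (6, 0, 6, 0)) = C2 \<and> h (place (-12, 0, 0, 0)) = C2 \<and>
     h (place (6, 0, -6, 0)) = C2"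
  unfolding alternating_points_def alternating_start_def
  by (simp only: matches_simps seen_num_of_nat check_simps coords_of.simps simp_thms)

lemma no_alternating_ring:
  assumes "proper_colouring h"
  shows "\<not> (h 0 = C0 \<and> h 1 = C1 \<and> h \<omega> = C2 \<and> h (\<omega> - 1) = C1 \<and> h (-1) = C2 \<and>
    h (-\<omega>) = C1 \<and> h (1 - \<omega>) = C2)"
proof -
  have "\<not> matches (seen h place (index alternating_points Tip)) alternating_start"
    by (rule certificate_refutes[OF assms unit_apart_place alternating_edges_ok _ alternating_replay]) simp_all
  then show ?thesis by (simp add: alternating_start place_ring)
qed

section \<open>The hexagon whose opposite triangle has two colours\<close>

definition single_triple_points :: "(nat \<times> int \<times> int \<times> int \<times> int) list" where
  "single_triple_points = [
   (1, (2, 0, 0, -2)), (2, (1, -1, -1, -1)), (3, (-1, -1, -1, 1)), (4, (-5, -1, 5, -1)), (5, (-3, -1, 5, -3)),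
   (6, (-6, -2, 4, 0)), (7, (1, 1, 1, -1)), (8, (-2, 0, 0, 2)), (9, (-10, 0, 0, -2)), (10, (-11, -1, -1, -1)),
   (11, (7, -1, 5, -1)), (12, (-4, 0, 6, -2)), (13, (-1, 1, 1, 1)), (14, (-7, -1, 5, 1)), (15, (5, -1, 5, 1)),
   (16, (-9, -1, -1, -3)), (17, (0, 0, 0, 0)), (18, (6, -2, 4, 0)), (19, (-5, 1, -5, -1)), (20, (-9, 1, 1,
   -3)), (21, (3, -1, 5, 3)), (22, (0, 0, 4, 0)), (23, (-4, -2, 4, -2)), (24, (-6, 0, 6, 0)), (25, (-12, 0, 0,
   0)), (26, (-4, 0, -6, -2)), (27, (6, 0, 6, 0)), (28, (0, -2, -2, 0)), (29, (-6, 0, 2, 0)), (30, (3, 1, 1,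
   -3)), (31, (7, 1, -5, -1)), (32, (11, -1, -1, 1)), (33, (-11, 1, 1, -1)), (34, (12, 0, 0, 0)), (35, (-8, 0,
   0, -4)), (36, (-6, 0, -6, 0)), (37, (-15, -1, 5, -3)), (38, (3, -1, -1, -3)), (39, (-3, -1, -1, 3)), (40,
   (-6, 2, -4, 0)), (41, (9, -1, -1, 3)), (42, (4, 0, 6, 2)), (43, (0, -2, 10, 0)), (44, (-6, 0, -2, 0)), (45,
   (-12, 0, 4, 0)), (46, (11, 1, 1, 1)), (47, (4, 0, -6, 2)), (48, (4, -2, 4, 2)), (49, (-3, 1, 3, -3)), (50,
   (2, -2, -2, -2)), (51, (0, 2, 2, 0)), (52, (-17, -1, 5, -1)), (53, (10, 0, 0, 2)), (54, (-7, 1, -5, 1)),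
   (55, (-3, 1, -5, -3)), (56, (5, 1, -5, 1)), (57, (1, -1, 11, -1)), (58, (-2, 0, 6, -4)), (59, (-12, 2, 2,
   0)), (60, (6, 0, 2, 0)), (61, (6, 0, -2, 0)), (62, (-16, 0, 6, -2)), (63, (0, 0, 8, 0)), (64, (-5, -1, 1,
   -1)), (65, (6, 2, -4, 0)), (66, (-9, -1, 3, -3)), (67, (0, -2, 6, 0)), (68, (6, 0, -6, 0)), (69, (3, -1, 3,
   -3)), (70, (-1, -1, 11, 1)), (71, (-3, 1, 1, 3)), (72, (4, 0, 0, -4)), (73, (7, -1, -7, -1)), (74, (9, 1,
   1, 3)), (75, (17, -1, 5, 1)), (76, (1, -1, 3, -1)), (77, (-12, -2, 10, 0)), (78, (-5, -3, 3, -1)), (79,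
   (-8, -2, 4, 2)), (80, (-13, -1, -1, 1)), (81, (-5, 1, 7, -1)), (82, (-9, -1, 11, -3)), (83, (-16, 0, -6,
   -2)), (84, (-10, -2, -2, -2)), (85, (-3, 1, 7, -3)), (86, (-2, -2, 4, -4)), (87, (-5, -1, -7, -1)), (88,
   (9, -1, 5, -3)), (89, (13, -1, -1, -1)), (90, (-15, 1, -5, -3)), (91, (-5, 1, -1, -1)), (92, (3, 1, -5,
   3)), (93, (-4, 0, 2, -2)), (94, (-9, -1, 5, 3)), (95, (17, 1, -5, 1)), (96, (-15, 1, 3, -3)), (97, (-4, 2,
   -4, -2)), (98, (-3, -1, 1, -3)), (99, (-14, 0, -6, -4)), (100, (-8, 0, -6, 2)), (101, (-2, -2, -2, 2)),
   (102, (-6, -2, 0, 0)), (103, (-12, -2, 2, 0)), (104, (-8, 0, 6, 2)), (105, (-14, 0, 6, -4)), (106, (8, 0,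
   0, 4)), (107, (-1, -1, 3, 1)), (108, (-13, 1, 1, 1)), (109, (5, -1, 1, 1)), (110, (-12, -2, -2, 0)), (111,
   (-8, -2, -2, -4)), (112, (-7, -1, -1, -5)), (113, (-7, 1, 1, -5)), (114, (-22, 0, 0, -2)), (115, (-3, -3,
   3, -3)), (116, (-4, 0, -2, -2)), (117, (-2, 2, 2, 2)), (118, (3, -1, 7, -3)), (119, (-3, 1, -1, -3)), (120,
   (-3, -1, -3, -3)), (121, (5, 1, 7, 1)), (122, (5, -1, -7, 1)), (123, (12, 0, 4, 0)), (124, (-1, 1, -1,
   -1)), (125, (-5, 1, 3, -1)), (126, (0, -2, 2, 0)), (127, (-14, 0, 0, 2)), (128, (-21, -1, -1, -3)), (129,
   (7, -3, 3, -1)), (130, (6, 2, 0, 0)), (131, (4, 2, -4, 2)), (132, (12, -2, -2, 0)), (133, (-2, -2, 10, 2)),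
   (134, (0, 2, -10, 0)), (135, (-8, 2, -4, 2)), (136, (6, -2, 0, 0)), (137, (-1, -1, 1, -1)), (138, (3, 1, 5,
   -3)), (139, (1, -1, 7, -1)), (140, (12, -2, 10, 0)), (141, (1, -3, -3, -1)), (142, (3, 1, 7, 3)), (143,
   (13, 1, 1, -1)), (144, (-16, -2, 4, -2)), (145, (-18, 0, -6, 0)), (146, (7, -1, 1, -1)), (147, (0, 0, -4,
   0)), (148, (8, 0, 6, -2)), (149, (-11, -1, -5, -1)), (150, (7, 1, 7, -1)), (151, (-11, -1, 11, -1)), (152,
   (8, -2, 4, -2)), (153, (4, -2, -2, -4)), (154, (-20, 0, 0, -4)), (155, (1, 1, 5, -1)), (156, (-9, 1, 5,
   -3)), (157, (-9, -1, 1, 3)), (158, (-6, -2, -4, 0)), (159, (-9, -1, -3, 3)), (160, (9, 1, 7, -3)), (161,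
   (-9, -3, 9, -3)), (162, (-6, -2, 8, 0)), (163, (-11, 1, -3, -1)), (164, (2, 0, 0, 2)), (165, (-11, -1, 3,
   -1)), (166, (-10, -2, 10, -2)), (167, (-8, 2, 2, -4)), (168, (2, 0, -4, -2)), (169, (-5, -1, -3, -1)),
   (170, (3, -1, 1, 3)), (171, (-7, -1, 1, 1)), (172, (-3, -1, 7, 3)), (173, (-9, -1, 7, -3)), (174, (-18, 0,
   6, 0)), (175, (10, -2, -2, 2)), (176, (15, -1, 5, 3)), (177, (5, -1, -3, 1)), (178, (5, -3, 3, 1)), (179,
   (-3, 1, -3, 3)), (180, (-5, -1, 3, 1)), (181, (-12, 0, 8, 0)), (182, (-6, 2, 4, 0)), (183, (2, 0, 4, -2)),
   (184, (-1, 1, -3, 1)), (185, (2, -2, 4, 4)), (186, (4, 0, -2, 2)), (187, (-1, 1, 3, -1)), (188, (6, -2, -4,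
   0)), (189, (-2, 0, -6, -4)), (190, (9, 1, 3, -3)), (191, (9, -1, 1, -3)), (192, (3, -1, 11, -3)), (193,
   (-5, -1, 9, -1)), (194, (-5, 3, -3, -1)), (195, (12, 0, 8, 0)), (196, (9, 1, -5, -3)), (197, (-8, 0, -2,
   2)), (198, (12, -2, 6, 0)), (199, (-3, -1, 3, 3)), (200, (-4, 0, 2, 2)), (201, (9, 1, -1, -3)), (202, (12,
   2, 2, 0)), (203, (-11, -1, 1, 1)), (204, (-11, 1, 5, -1)), (205, (0, 0, 12, 0)), (206, (10, 2, 2, 2)),
   (207, (-13, 1, -5, -5)), (208, (-4, 0, 0, 4)), (209, (-18, 0, 2, 0)), (210, (-8, 0, 2, 2)), (211, (0, -2,
   4, -6)), (212, (1, -3, 9, -1)), (213, (2, -2, 10, -2)), (214, (-2, 0, 4, -2)), (215, (-1, -3, 9, 1)), (216,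
   (5, 1, -1, 1)), (217, (-13, -1, 5, -5)), (218, (-17, 1, 7, -1)), (219, (15, 1, 1, -3)), (220, (-2, -2, 2,
   -2)), (221, (-5, 1, 5, 1)), (222, (3, -1, -3, 3)), (223, (-9, 1, -3, -3)), (224, (4, 0, 2, 2)), (225, (1,
   -3, 5, -1)), (226, (-3, 1, 5, 3)), (227, (4, 0, 2, -2)), (228, (-11, -3, 9, -1)), (229, (-12, 0, 12, 0)),
   (230, (-7, -1, 7, -1)), (231, (1, 1, -11, -1)), (232, (3, -1, -7, 3)), (233, (-9, 1, -5, 3)), (234, (-6, 0,
   0, -6)), (235, (16, 0, -6, 2)), (236, (-10, 2, -10, -2)), (237, (17, -1, -7, 1)), (238, (10, -2, 10, 2)),
   (239, (-4, -2, 8, -2)), (240, (-1, -1, 5, -5)), (241, (-16, 0, -2, -2)), (242, (-7, 1, 3, 1)), (243, (-21,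
   1, 1, -3)), (244, (-18, -2, 4, 0)), (245, (-8, 0, 2, -2)), (246, (16, -2, 4, 2)), (247, (-8, -2, 10, -4)),
   (248, (-16, 2, -4, -2)), (249, (3, -1, 9, 3)), (250, (-9, 1, -1, 3)), (251, (-14, -2, 4, -4)), (252, (-3,
   -1, -5, 3)), (253, (-6, 2, 0, 0)), (254, (-19, -1, -1, -5)), (255, (2, 2, 2, -2)), (256, (7, 1, -1, -1)),
   (257, (2, -2, 2, 2)), (258, (5, -1, 3, -1)), (259, (2, 2, -4, 4)), (260, (-11, -1, 7, -1)), (261, (-8, -2,
   2, -4)), (262, (1, -1, 1, 1)), (263, (4, 2, 4, -2)), (264, (-4, -2, -8, -2)), (265, (-11, -3, -3, -1)),
   (266, (-7, -1, -7, 1)), (267, (6, 0, 10, 0)), (268, (12, 0, -12, 0)), (269, (0, 0, -12, 0)), (270, (5, 3,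
   -3, 1)), (271, (-2, -2, 2, 2)), (272, (-3, -3, -3, 3)), (273, (-4, 2, 0, -2)), (274, (2, 0, -2, 4)), (275,
   (6, 0, 0, -6)), (276, (-5, 1, 1, 1)), (277, (-15, 1, 1, 3)), (278, (-3, -1, -7, -3)), (279, (-8, 2, 4, 2)),
   (280, (-6, -2, -8, 0)), (281, (0, 2, 10, 0)), (282, (2, 0, -12, -2)), (283, (20, 0, 0, 4)), (284, (2, 0, 8,
   -2)), (285, (14, 0, 0, -2)), (286, (9, -1, -3, -3)), (287, (13, -1, 3, -1)), (288, (-2, 0, 2, -4)), (289,
   (-15, 1, 5, 3)), (290, (2, 2, -10, -2)), (291, (6, -2, -8, 0)), (292, (2, -2, 2, -2)), (293, (9, -1, 3,
   3)), (294, (-12, -2, 4, -6)), (295, (3, 1, -3, -3)), (296, (-13, 1, 3, -5)), (297, (2, 0, 2, -4)), (298,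
   (-10, 0, -4, 2)), (299, (15, -1, -1, -3)), (300, (0, 0, 6, -6)), (301, (-9, 1, 3, 3)), (302, (-15, -1, 3,
   3)), (303, (-11, 1, -11, -1)), (304, (14, 0, -6, 4)), (305, (14, -2, 4, 4)), (306, (18, 0, -6, 0)), (307,
   (3, -3, 3, 3)), (308, (-13, 1, -11, 1)), (309, (-2, 0, 4, 2)), (310, (7, 1, 3, -1)), (311, (12, -2, 2, 0)),
   (312, (7, -1, 3, 1)), (313, (-17, 1, -5, -1)), (314, (-10, 0, -12, -2)), (315, (-16, 0, 2, -2)), (316, (-8,
   0, 4, -4)), (317, (-3, 3, -3, -3)), (318, (-12, 0, -4, 0)), (319, (-12, -2, 6, 0)), (320, (-8, 0, 0, 4)),
   (321, (-14, 2, -4, -4)), (322, (-5, 1, 1, 5)), (323, (1, 3, 3, -1)), (324, (-7, 1, 7, 1)), (325, (11, -1,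
   11, 1)), (326, (0, 2, -6, 0)), (327, (5, 1, 1, -1)), (328, (-4, 0, -2, 2)), (329, (-7, -1, -1, -1)), (330,
   (-3, -1, 9, -3)), (331, (15, 1, -5, 3)), (332, (-7, -1, -3, 1)), (333, (2, 2, -2, -2)), (334, (-4, -2, 0,
   -2)), (335, (-7, -1, 3, -1)), (336, (2, -2, 0, 4)), (337, (4, -2, -4, 2)), (338, (3, -1, -5, -3)), (339,
   (-2, 0, 0, -2)), (340, (-4, -2, 0, 2)), (341, (-1, -1, -3, -1)), (342, (14, -2, -2, -2)), (343, (1, -1, -5,
   -1)), (344, (-14, -2, -2, 2)), (345, (1, -1, 5, 5)), (346, (-19, 1, 1, -5)), (347, (2, 0, 6, 4)), (348, (7,
   1, 1, 5)), (349, (-10, 2, 2, -2)), (350, (5, -1, 9, 1)), (351, (-19, 1, -5, 1)), (352, (11, -1, 7, 1)),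
   (353, (22, 0, 0, 2)), (354, (12, 2, -10, 0)), (355, (-1, 1, -5, -5)), (356, (-1, 1, -7, 1)), (357, (1, 1,
   -7, -1)), (358, (7, 1, 5, 1)), (359, (2, 2, -6, -2)), (360, (-9, -3, 3, 3)), (361, (10, -2, 4, -4)), (362,
   (-19, -1, 5, 1)), (363, (-2, 2, 6, 2)), (364, (-1, -1, 7, 1)), (365, (0, 0, -8, 0)), (366, (-14, 0, 2,
   -4)), (367, (3, 1, 11, 3)), (368, (-6, 0, 10, 0)), (369, (-18, 2, 4, 0)), (370, (8, -2, -2, 4)), (371, (2,
   0, 2, 4)), (372, (-13, 1, -7, 1)), (373, (-3, -3, 5, 3)), (374, (0, -2, 4, 6)), (375, (10, 0, 4, 2)), (376,
   (15, 1, 7, 3)), (377, (-4, -2, -4, -2)), (378, (8, 0, 4, -4)), (379, (-7, -3, 3, 1)), (380, (-1, 1, -1,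
   -5)), (381, (4, 0, 4, -4)), (382, (-10, 0, -4, -2)), (383, (18, 0, 6, 0)), (384, (-11, 1, -7, -1)), (385,
   (-11, 3, 3, -1)), (386, (-2, 0, 12, 2)), (387, (-16, 2, 0, -2)), (388, (-23, -1, -1, -1)), (389, (2, 2, 2,
   2)), (390, (17, 1, 7, 1)), (391, (19, 1, 7, -1)), (392, (-8, 2, 4, -2)), (393, (1, 1, 3, 1)), (394, (9, 1,
   5, 3)), (395, (5, 1, 5, -1)), (396, (-8, -2, 2, 4)), (397, (-4, -2, 16, -2)), (398, (3, 1, 9, -3)), (399,
   (16, 2, -4, 2)), (400, (23, -1, -1, 1)), (401, (8, 0, -4, 4)), (402, (8, -2, 2, 4)), (403, (2, -2, 6, -2)),
   (404, (3, -3, -9, 3)), (405, (-10, 2, -6, -2)), (406, (6, 2, 4, 0)), (407, (12, 0, -4, 0)), (408, (-11, 1,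
   3, 1)), (409, (1, 1, 7, 1)), (410, (0, 2, 6, 0)), (411, (12, -2, 4, 6)), (412, (7, -1, -1, 5)), (413, (8,
   0, -6, -2)), (414, (8, -2, 10, 4)), (415, (-4, 2, 0, 2)), (416, (-3, 1, -7, 3)), (417, (14, 0, 6, 4)),
   (418, (-1, -1, 5, -1)), (419, (-10, -2, -2, 2)), (420, (-26, 0, 6, -4)), (421, (-23, 1, 1, -1)), (422, (9,
   1, -11, 3)), (423, (7, -1, -3, -1)), (424, (15, -1, 1, 3)), (425, (-15, -1, -7, -3)), (426, (-1, -1, -3,
   -5)), (427, (3, 1, 3, 3)), (428, (4, -2, 2, -4)), (429, (4, 0, -6, -2)), (430, (-5, -1, -1, 1)), (431, (12,
   0, 2, -6)), (432, (9, -1, -7, -3)), (433, (10, 0, 6, -4)), (434, (-9, -1, -7, 3)), (435, (-2, 2, -4, -4)),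
   (436, (0, -2, -6, 0)), (437, (5, -1, -1, -1)), (438, (8, 2, 2, -4)), (439, (9, 1, -3, 3)), (440, (-3, -1,
   -9, 3)), (441, (-1, 1, -3, 5)), (442, (-7, -1, -3, 5)), (443, (9, -1, 11, 3)), (444, (-4, 0, 10, -2)),
   (445, (-4, 0, 6, 2)), (446, (-19, 1, -1, 1)), (447, (-7, 1, 5, -1)), (448, (-1, 1, -11, 1)), (449, (4, -2,
   -8, 2)), (450, (9, -3, -3, 3)), (451, (18, -2, -4, 0)), (452, (1, -1, -3, 1)), (453, (8, -2, -4, 2)), (454,
   (-6, -2, 2, -6)), (455, (6, 0, -4, -6)), (456, (6, 0, 0, 6)), (457, (-6, 0, 0, 6)), (458, (-14, 2, 2, 2)),
   (459, (4, 2, 8, 2)), (460, (1, 1, 7, 5)), (461, (13, -1, 5, 5)), (462, (18, -2, 4, 0)), (463, (-11, 3, -5,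
   -1)), (464, (-1, -1, -5, 1)), (465, (-5, 3, 1, -1)), (466, (-8, 2, 0, 2)), (467, (2, -2, -4, 4)), (468,
   (-3, 3, -5, 3)), (469, (-6, 2, -6, 6)), (470, (2, 0, -4, 2)), (471, (-6, 0, -8, 6)), (472, (-1, 1, 5, 1)),
   (473, (4, 2, 0, 2)), (474, (-2, -2, 6, 2)), (475, (10, 0, -4, 2)), (476, (10, -2, 6, 2)), (477, (6, -2, 16,
   0)), (478, (16, 0, 6, 2)), (479, (10, 0, 12, 2)), (480, (-9, -1, 9, 3)), (481, (8, 0, 8, 4)), (482, (11, 1,
   9, 1)), (483, (-9, 1, 11, 3)), (484, (6, 2, 8, 0)), (485, (1, -1, 5, 1)), (486, (4, 0, 6, -2)), (487, (-2,
   0, 6, 4)), (488, (11, 1, 3, -1)), (489, (-8, 0, 8, -4)), (490, (-4, 0, 0, -4)), (491, (-18, 2, -4, 0)),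
   (492, (-20, 0, -6, 2)), (493, (-12, 2, -10, 0)), (494, (2, 0, -6, 4)), (495, (-15, 1, -11, 3)), (496, (-10,
   0, -6, 4)), (497, (-9, 1, 9, -3)), (498, (-12, 2, 10, 0)), (499, (11, -1, -3, -1)), (500, (-13, -1, -3,
   -1)), (501, (-11, -1, 5, 5)), (502, (1, 1, 5, -5))]"

definition single_triple_edges :: "(nat \<times> nat list) list" where
  "single_triple_edges = [
   (1, [3, 5, 11, 26, 34]), (2, [68]), (3, [1, 6, 10, 36]), (4, [2, 9, 10, 11, 15, 17]), (5, [1, 6, 11, 16,
   24]), (6, [3, 5, 10, 24]), (7, [2, 8, 12, 19, 27, 31, 46]), (8, [2, 7, 14, 25, 42, 47, 54]), (9, [1, 4, 12,
   17, 19, 26, 37]), (10, [2, 3, 4, 6, 36, 128]), (11, [1, 2, 4, 5, 34, 75, 140]), (12, [1, 7, 9, 14, 20, 27,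
   57, 62]), (13, [1, 3, 24]), (14, [3, 8, 12, 15, 21, 25, 52, 70]), (15, [3, 4, 14, 17, 32, 43]), (16, [2, 5,
   23, 25, 26, 37, 38]), (18, [2, 6, 23, 27, 28, 32, 43]), (19, [7, 9, 17, 31, 33, 56, 90, 231]), (20, [7, 12,
   16, 25, 29, 30, 55, 59]), (21, [8, 14, 18, 22, 27, 39, 41]), (22, [5, 21, 44, 45, 49, 51, 61, 67, 69, 91,
   123, 138, 193]), (23, [2, 12, 14, 16, 18, 50]), (26, [1, 2, 9, 16, 68, 83, 99]), (28, [6, 17, 18, 38, 39,
   87, 110, 122]), (29, [6, 20, 49, 60, 63, 66, 71, 163, 181, 224, 260]), (30, [17, 20, 38, 55, 58, 85, 113,
   143, 148, 160]), (31, [1, 7, 19, 34, 73, 95]), (32, [2, 3, 15, 18, 46, 68, 75, 122]), (33, [7, 10, 13, 24,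
   62]), (35, [1, 5, 10, 33, 111]), (37, [4, 5, 9, 16, 82, 166]), (38, [5, 16, 17, 28, 86, 88, 89, 112]), (39,
   [17, 21, 28, 41, 71, 80, 94, 100, 185]), (40, [13, 33, 36, 65]), (41, [3, 21, 34, 47]), (42, [8, 11, 13,
   24, 53, 70]), (43, [4, 6, 15, 18, 77, 166]), (44, [16, 22, 39, 40, 45, 61, 107, 119, 179, 186, 187]), (45,
   [22, 37, 44, 59, 66, 94, 96, 103, 156]), (46, [7, 13, 27, 32, 95]), (47, [3, 8, 31, 36, 53, 73]), (48, [3,
   6, 11, 41]), (49, [5, 22, 29, 51, 96, 98, 223, 296]), (50, [1, 3, 23, 73, 84]), (51, [17, 22, 30, 40, 49,
   59, 65, 71, 81, 121]), (52, [4, 10, 25, 114]), (53, [8, 15, 17, 42, 56, 89, 235]), (54, [8, 13, 25, 26, 56,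
   108]), (55, [1, 30, 31, 36, 40, 90]), (56, [13, 17, 19, 46, 54, 95, 134]), (57, [4, 11, 27]), (58, [4, 30,
   35, 72, 86, 105, 148, 192]), (59, [20, 25, 40, 45, 218]), (60, [18, 29, 30, 69, 74, 93, 130, 170, 200]),
   (61, [22, 38, 41, 65, 76, 116, 130]), (62, [9, 12, 24, 114, 151]), (63, [29, 43, 60, 67, 85, 118, 142,
   172]), (64, [8, 35, 78, 125, 139, 146, 149]), (65, [7, 46, 51, 68, 97, 134, 196]), (66, [6, 20, 29, 76,
   116, 294]), (67, [5, 21, 22, 64, 109, 198]), (69, [18, 22, 30, 60, 66, 120, 126, 211, 287]), (70, [14, 15,
   24, 151]), (71, [17, 29, 51, 92, 104, 108, 142]), (72, [2, 7, 35, 58, 88, 153]), (73, [2, 31, 47, 50, 87,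
   89, 237, 268, 282]), (74, [13, 34, 42, 92]), (75, [11, 15, 32, 34, 353]), (76, [7, 48, 86, 165, 169, 239]),
   (77, [6, 14, 43, 52, 82, 161]), (78, [4, 28, 64, 79, 84, 129, 212, 228]), (79, [4, 39, 48, 78, 80, 101,
   133]), (80, [3, 9, 14, 84, 145, 266]), (81, [4, 7, 33, 51, 58, 104, 150]), (82, [5, 12, 37, 57, 77, 192]),
   (83, [9, 10, 26, 36, 128, 303]), (84, [9, 23, 28, 50, 78, 87, 144]), (85, [5, 20, 24, 30, 63, 167]), (86,
   [4, 38, 58, 76, 78, 111, 152, 247]), (87, [2, 10, 19, 28, 189]), (88, [5, 18, 27, 72, 190]), (89, [2, 11,
   38, 53, 175]), (90, [9, 19, 20, 55, 145, 154, 236]), (91, [8, 22, 35, 64, 194, 204]), (92, [8, 54, 65, 68,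
   71, 74, 232]), (93, [13, 23, 60, 113, 168, 171, 223, 242, 315]), (94, [6, 21, 24, 39, 45]), (95, [34, 46]),
   (96, [37, 45, 49, 59, 125]), (97, [7, 20, 26, 54, 65]), (98, [17, 29, 49, 102, 115, 146, 234]), (99, [16,
   26, 35, 154]), (100, [8, 19, 39, 47, 80, 127, 145, 308]), (101, [2, 8, 48, 79, 110, 141]), (102, [16, 29,
   39, 44, 67, 136, 149]), (103, [25, 45, 66, 157, 162, 271]), (104, [4, 8, 42, 79, 81, 127, 279]), (105, [12,
   20, 35, 52, 82, 154]), (106, [8, 21, 32, 46, 92]), (107, [13, 23, 44, 93, 177, 183, 332]), (108, [9, 13,
   54, 80, 135, 174, 324]), (109, [1, 64, 106, 171, 178, 216]), (110, [6, 16, 25, 159, 280]), (111, [10, 35,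
   50, 153, 251, 278]), (112, [9, 38, 84, 113, 189, 217, 240]), (113, [9, 30, 58, 93, 112, 207]), (114, [9,
   25, 52, 62, 83, 254]), (115, [5, 6, 50]), (116, [3, 76, 97, 112, 183, 184, 241, 357]), (117, [7, 8, 131,
   135]), (118, [27, 63, 67, 138, 173, 288]), (119, [17, 44, 98, 120, 183, 234, 316, 317, 359]), (120, [28,
   55, 66, 69, 147, 261]), (121, [13, 15, 46, 206]), (122, [3, 28, 32, 56, 87, 269]), (123, [61, 88, 176, 202,
   256, 267, 293, 394]), (124, [36, 137, 164, 182, 201]), (125, [4, 64, 96, 117, 163, 167]), (126, [17, 22,
   69, 98, 115, 169]), (127, [8, 10, 33, 100, 208, 362]), (128, [10, 16, 37, 83, 144]), (129, [11, 50, 132,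
   141]), (130, [30, 60, 74, 155, 253]), (131, [13, 31, 40, 47, 74]), (132, [18, 28, 34, 41, 73, 237]), (133,
   [14, 21, 48, 57, 77, 238]), (134, [19, 40, 56, 65, 236]), (135, [19, 100, 117, 131, 194]), (136, [38, 41,
   61, 102, 225]), (137, [24, 124, 158, 191, 203]), (138, [22, 27, 69, 119, 300]), (139, [42, 58, 64, 93, 212,
   352]), (140, [18, 43, 75]), (141, [2, 78, 101, 129, 153, 264, 343]), (142, [21, 27, 63, 74, 386]), (143,
   [7, 31, 53, 89, 150, 383]), (144, [6, 10, 23, 62, 128]), (145, [25, 36, 80, 90, 388]), (146, [53, 72, 98,
   129, 168]), (147, [28, 55, 92, 109, 382]), (148, [1, 12, 15, 121, 152, 285]), (149, [64, 99, 100, 102, 265,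
   384]), (150, [7, 11, 42, 143, 255]), (151, [4, 52, 57, 62, 70]), (152, [15, 23, 38, 50, 89]), (153, [2, 72,
   111, 141, 342]), (154, [9, 35, 37, 90, 99]), (155, [42, 58, 91, 130, 139, 204, 323, 363]), (156, [24, 66,
   119, 173, 273]), (157, [25, 29, 102, 170, 250, 360]), (158, [36, 44, 103, 120, 159, 188, 337]), (159, [44,
   110, 199, 222, 233, 250]), (160, [27, 30, 85, 195, 219, 227, 391]), (161, [23, 77, 82, 115]), (162, [24,
   107, 161, 165, 173, 330]), (163, [10, 135, 149, 197, 321]), (164, [34, 124, 137, 226, 252]), (165, [33, 79,
   107, 241, 251, 261]), (166, [4, 23, 37, 43]), (167, [33, 35, 85, 125]), (168, [50, 56, 177, 184, 355]),
   (169, [19, 91, 101, 111, 126, 177, 197]), (170, [17, 60, 126, 136, 171, 307, 401]), (171, [9, 93, 208, 334,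
   379]), (172, [24, 63, 67, 162, 170, 371]), (173, [24, 93, 139, 161, 319, 366]), (174, [24, 25, 37, 244]),
   (175, [28, 48, 53, 89, 101, 122, 178, 246]), (176, [15, 21, 41, 53, 238, 283]), (177, [50, 56, 168, 370]),
   (178, [15, 28, 152, 175, 185, 215]), (179, [39, 40, 44, 301]), (180, [28, 63, 220, 221, 302, 396]), (181,
   [29, 63, 77, 242, 319, 335]), (182, [24, 29, 49, 156]), (183, [15, 107, 116, 240, 255, 256, 292, 403]),
   (184, [3, 97, 116, 259]), (185, [15, 39, 79, 107, 305]), (186, [2, 44, 107, 131, 197, 309, 356]), (187,
   [44, 137, 190, 200, 297, 408]), (188, [61, 68, 126, 222, 377]), (189, [19, 35, 38, 72, 99, 112, 413]),
   (190, [49, 60, 88, 202, 295, 406]), (191, [34, 60, 98, 118, 136, 190, 275]), (192, [5, 88, 205]), (193,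
   [22, 76, 81, 133, 247]), (194, [19, 51, 349, 435]), (195, [60, 63, 160, 198, 284, 310, 376]), (196, [30,
   55, 72, 285]), (197, [10, 135, 163, 169, 186, 372]), (198, [67, 88, 123, 146, 176, 195]), (199, [6, 29, 71,
   197, 249, 293, 373, 374]), (200, [60, 159, 187, 298, 340, 409]), (201, [34, 61, 119, 130, 380, 381]), (202,
   [34, 51, 74, 123, 219, 389, 390]), (203, [24, 137, 158, 245]), (204, [91, 104, 105, 155, 316]), (205, [24,
   27, 43, 81]), (206, [53, 117, 131, 143, 399]), (207, [35, 55, 83]), (208, [3, 13, 106, 127]), (209, [29,
   96, 181, 210, 243, 244, 318]), (210, [33, 64, 79, 125, 165, 179, 322]), (211, [5, 115, 361]), (212, [18,
   57, 133]), (213, [5, 11, 23, 70, 397]), (214, [38, 45, 220, 221, 398]), (215, [6, 48, 70, 213]), (216, [1,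
   106, 109, 270]), (217, [5, 35, 62, 144]), (218, [33, 52, 81, 105, 421]), (219, [34, 160, 196, 202, 299,
   327]), (220, [103, 118, 180, 214, 230]), (221, [17, 180, 214, 281, 289, 395]), (222, [28, 61, 92, 147, 271,
   402]), (223, [16, 40, 44]), (224, [7, 48, 348, 364]), (225, [48, 76, 86, 139]), (226, [22, 24, 172, 199]),
   (227, [29, 245, 262, 263, 286, 312]), (228, [6, 144, 151, 215]), (229, [77, 82, 174, 205]), (230, [103,
   118, 229]), (231, [26, 31, 68]), (232, [39, 41, 68, 101]), (233, [36, 40, 351, 415]), (234, [16, 20, 72,
   240]), (235, [32, 47, 53, 68]), (236, [97, 290, 314]), (237, [32, 304, 400]), (238, [15, 43, 246]), (239,
   [12, 76, 215, 364]), (240, [12, 23, 72, 88, 217]), (241, [44, 80, 248, 254]), (242, [14, 171, 184, 427]),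
   (243, [33, 62, 90, 248, 420]), (244, [6, 77, 79, 110]), (245, [85, 120, 203, 209, 297]), (246, [18, 32, 48,
   175]), (247, [5, 151, 213, 217]), (248, [33, 40, 83, 97, 243]), (249, [43, 63, 142]), (250, [25, 157, 159,
   253, 446]), (251, [16, 23, 52, 105]), (252, [36, 147, 179, 336]), (253, [20, 29, 44, 119, 204, 387]), (254,
   [16, 99, 112, 251]), (255, [1, 13, 97, 150]), (256, [53, 72, 91, 146, 155, 186]), (257, [164, 172, 272,
   311]), (258, [28, 63, 180, 257, 378]), (259, [56, 71, 135, 270]), (260, [104, 105, 228]), (261, [35, 64,
   78]), (262, [27, 157, 188, 203, 227]), (263, [124, 182, 201, 358, 392]), (264, [26, 50, 84]), (265, [10,
   111, 141, 280, 344]), (266, [3, 26, 54]), (267, [155, 192, 249, 443, 444]), (268, [68, 269, 354, 422]),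
   (269, [36, 68, 87]), (270, [51, 56, 206, 259]), (271, [8, 64, 78]), (272, [28, 39, 158, 404]), (273, [13,
   93, 113, 155, 405]), (274, [3, 177, 184, 259]), (275, [30, 38, 191, 300]), (276, [147, 277, 320, 339,
   410]), (277, [25, 59, 209]), (278, [16, 36, 73, 282]), (279, [104, 125, 210, 385]), (280, [28, 36, 110,
   291, 434]), (281, [63, 182, 205]), (282, [26, 290, 314]), (283, [53, 106, 176, 304, 331, 400]), (284, [49,
   121, 195, 213, 350]), (285, [1, 32, 46, 72, 88]), (286, [132, 188, 196, 407, 428]), (287, [76, 143, 246]),
   (288, [7, 76, 86]), (289, [45, 174, 226]), (290, [31, 55, 97]), (291, [28, 68, 132, 232]), (292, [1, 109,
   178, 239]), (293, [18, 60, 74]), (294, [37, 86, 112]), (295, [38, 61, 65]), (296, [217, 349, 489]), (297,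
   [85, 120, 187, 245, 431]), (298, [147, 200, 276, 277]), (299, [34, 88, 132, 432]), (300, [5, 85, 211]),
   (301, [45, 59, 94, 157]), (302, [45, 209, 244, 277, 289]), (303, [36, 231, 313]), (304, [41, 47, 106]),
   (305, [41, 48, 75]), (306, [34, 68, 89]), (307, [18, 21, 101, 379]), (308, [54, 236, 314]), (309, [4, 45,
   117]), (310, [11, 206, 333, 375]), (311, [34, 123, 292, 423, 424]), (312, [132, 180, 195, 199, 358]), (313,
   [19, 25, 54, 114]), (314, [26, 83, 87, 269, 425]), (315, [29, 108, 144]), (316, [4, 125, 167]), (317, [40,
   55, 255]), (318, [29, 90, 147, 171, 233]), (319, [37, 45, 94]), (320, [164, 203, 226, 252]), (321, [20, 97,
   99, 167, 346]), (322, [8, 117, 348]), (323, [7, 117, 194]), (324, [13, 121, 218]), (325, [15, 27, 70, 75]),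
   (326, [55, 91, 92, 216]), (327, [147, 164, 219, 258, 276, 437, 438]), (328, [61, 124, 329, 341, 441, 442]),
   (329, [38, 45, 214, 419]), (330, [43, 63, 85]), (331, [53, 56, 283, 306]), (332, [54, 84, 382]), (333, [1,
   168, 216, 270]), (334, [3, 112, 116]), (335, [69, 110, 181, 258, 447]), (336, [3, 109, 274]), (337, [47,
   141, 343]), (338, [68, 98, 147]), (339, [25, 338, 429, 430]), (340, [94, 136, 137]), (341, [29, 124, 227,
   286]), (342, [32, 50, 152]), (343, [47, 189, 334]), (344, [10, 79, 127, 265]), (345, [42, 48, 94]), (346,
   [20, 105, 114, 207]), (347, [15, 104, 106, 121, 185]), (348, [53, 71, 206, 347, 412]), (349, [9, 81, 97,
   108, 113]), (350, [121, 213, 284, 375, 414]), (351, [54, 83, 108, 248]), (352, [60, 148, 417]), (353, [34,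
   95, 235]), (354, [31, 95, 134, 290]), (355, [26, 97, 207]), (356, [26, 44, 494]), (357, [47, 61, 91]),
   (358, [34, 164, 226]), (359, [56, 168, 355]), (360, [6, 94, 344]), (361, [11, 129, 153, 299, 433]), (362,
   [14, 62, 144]), (363, [81, 309, 460]), (364, [12, 215, 347]), (365, [61, 134, 278, 326]), (366, [33, 165,
   251]), (367, [205, 249, 267, 281]), (368, [22, 82, 162, 330]), (369, [96, 174, 209]), (370, [32, 106,
   305]), (371, [13, 107, 185]), (372, [83, 356, 496]), (373, [6, 67, 172]), (374, [21, 307, 411]), (375, [11,
   206, 461]), (376, [74, 121, 142]), (377, [26, 116, 426]), (378, [38, 214, 398]), (379, [14, 23, 215]),
   (380, [1, 116, 333]), (381, [11, 76, 155]), (382, [54, 64, 84]), (383, [27, 34, 176]), (384, [100, 241,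
   356]), (385, [33, 167, 458]), (386, [42, 57, 479]), (387, [108, 204, 346]), (388, [10, 52, 80]), (389,
   [164, 187, 327]), (390, [46, 75, 417]), (391, [143, 150, 478]), (392, [119, 245, 369]), (393, [61, 262,
   263, 301, 328]), (394, [27, 472, 473]), (395, [17, 124, 281]), (396, [172, 257, 272]), (397, [57, 82,
   477]), (398, [63, 118, 192]), (399, [46, 65, 131]), (400, [32, 75, 462]), (401, [56, 177, 370]), (402,
   [106, 109, 178]), (403, [15, 98, 198]), (404, [232, 291, 450]), (405, [91, 207, 387]), (406, [27, 138,
   482]), (407, [132, 331, 439]), (408, [44, 203, 392]), (409, [60, 486, 487]), (410, [63, 85, 138]), (411,
   [176, 185, 412]), (412, [39, 53, 175]), (413, [1, 26, 306]), (414, [21, 305, 325]), (415, [124, 200, 328]),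
   (416, [36, 274, 326]), (417, [42, 74, 75]), (418, [88, 102, 329, 368, 445]), (419, [28, 180, 302]), (420,
   [62, 105, 154]), (421, [33, 108, 313]), (422, [47, 304, 448]), (423, [31, 169, 186]), (424, [34, 475,
   476]), (425, [16, 90, 128]), (426, [50, 168, 355]), (427, [21, 22, 51]), (428, [72, 146, 454]), (429, [36,
   124, 201]), (430, [22, 320, 436]), (431, [190, 191, 455]), (432, [38, 68, 278]), (433, [11, 58, 150]),
   (434, [36, 232, 328]), (435, [19, 30, 189]), (436, [278, 338, 365]), (437, [22, 164, 436]), (438, [295,
   378, 488]), (439, [41, 65, 184]), (440, [365, 416, 467]), (441, [439, 470, 471]), (442, [222, 298, 419]),
   (443, [42, 70, 417]), (444, [70, 155, 156]), (445, [27, 230, 483]), (446, [114, 241, 372]), (447, [25, 230,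
   498]), (448, [36, 47, 56]), (449, [47, 73, 101]), (450, [41, 132, 449]), (451, [188, 306, 311]), (452,
   [159, 291, 312]), (453, [170, 257, 451]), (454, [66, 115, 426]), (455, [196, 286, 295]), (456, [41, 208,
   345]), (457, [39, 157, 456]), (458, [33, 117, 127]), (459, [42, 117, 150]), (460, [42, 345, 459]), (461,
   [21, 106, 414]), (462, [18, 140, 176]), (463, [135, 163, 321]), (464, [26, 109, 184]), (465, [91, 117,
   463]), (466, [33, 91, 465]), (467, [177, 274, 464]), (468, [40, 326, 466]), (469, [233, 416, 468]), (470,
   [71, 407, 440]), (471, [416, 440, 469]), (472, [12, 204, 364]), (473, [7, 224, 256]), (474, [4, 139, 225]),
   (475, [31, 109, 175]), (476, [11, 109, 474]), (477, [43, 57, 325]), (478, [27, 46, 325]), (479, [42, 121,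
   205]), (480, [77, 199, 249]), (481, [121, 350, 352]), (482, [325, 352, 481]), (483, [229, 367, 480]), (484,
   [27, 142, 267]), (485, [94, 136, 267]), (486, [24, 137, 191]), (487, [170, 367, 485]), (488, [61, 393,
   484]), (489, [193, 247, 366]), (490, [124, 156, 275]), (491, [40, 108, 145]), (492, [100, 127, 313]), (493,
   [40, 313, 491]), (494, [39, 100, 208]), (495, [233, 492, 493]), (496, [54, 266, 495]), (497, [49, 82, 96]),
   (498, [229, 369, 497]), (499, [258, 291, 452, 453]), (500, [209, 245, 298, 341]), (501, [79, 104, 345,
   457]), (502, [156, 214, 275, 490])]"

text \<open>Patterns 16 and 33 and the neighbour 68 force vertex 2 to \<open>C2\<close>. Patterns 44
  and 41 and the neighbour 24 force vertex 6 to \<open>C3\<close>, whence 10 and 3 receive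
  \<open>C0\<close> and \<open>C2\<close>. Pattern 49 then leaves \<open>C0\<close> for vertex 5 and
  hence \<open>C3\<close> for vertex 1, and the neighbours 1, 2, 5, 34 of vertex 11 have all four
  colours.\<close>

definition single_triple_items :: "item list" where
  "single_triple_items = [
   Learn 1 [(19, C1), (15, C3), (2, C0), (95, C3)] [Look [7, 56, 8, 53]],
   Learn 2 [(19, C3), (194, C0), (31, C2), (13, C3), (2, C1)] [Look [7, 8, 47, 131, 135, 117]],
   Learn 3 [(6, C3), (2, C1), (10, C0)] [Look [3, 18, 32]],
   Learn 4 [(19, C3), (1, C0), (194, C0), (3, C2), (2, C1)] [Look [13], Use 2, Look [31]],
   Learn 5 [(6, C0), (10, C3), (4, C2), (194, C0), (2, C1)] [Look [3, 18, 32, 43, 15, 75, 140, 11, 1, 26, 13,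
   83, 46, 56], Use 4, Look [19, 9, 114, 12, 52, 14]],
   Learn 6 [(31, C3), (9, C3), (16, C3), (2, C1)] [Look [7, 20, 12]],
   Learn 7 [(95, C0), (2, C0), (13, C3), (1, C2)] [Look [31, 46, 7]],
   Learn 8 [(95, C2), (32, C1), (15, C3), (3, C2), (1, C0)] [Look [13, 31, 56, 47, 53, 235]],
   Learn 9 [(1, C0), (2, C0), (10, C3)] [Look [3, 6, 13, 32, 18, 15, 46], Use 8, Look [95, 31, 55], Use 1,
   Look [19, 7, 8, 20, 65, 47, 106, 97, 40, 131, 41, 235, 304, 134, 399, 48, 53, 353, 56, 354, 101, 75, 448,
   305, 11, 422, 370, 5, 89, 268, 85, 306, 73, 331, 50, 449, 283, 115, 23, 177, 152, 176, 169, 107, 168, 401,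
   126, 185, 170, 39, 371, 178, 100, 28, 232, 21, 172, 109, 135, 132, 92, 291, 292, 67, 216, 402, 197, 117,
   129, 450, 183, 373, 63, 333, 222, 186, 206, 146, 404, 116, 199, 44, 423, 310, 198, 272, 61, 159, 311, 195,
   188, 257, 312, 451, 258, 452, 453, 499]],
   Learn 10 [(95, C3), (5, C0), (1, C2), (10, C3), (2, C0)] [Look [3, 26, 6, 13, 16, 9, 54, 35, 31, 55, 231,
   19, 87, 313, 7, 56, 269, 303, 8, 97, 72, 314, 83, 14, 92, 53, 290, 47, 236, 207, 21, 74, 354, 41, 90, 355,
   94, 106, 268, 154, 73, 99, 50, 115, 84, 23, 168, 426, 93, 359, 177, 146, 113, 98, 112, 273, 30, 119, 126,
   254, 116, 38, 20, 196, 156, 114, 377, 334, 184, 66, 65, 52, 188, 171, 29, 274, 61, 45, 454, 295, 77, 242,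
   109, 318, 182, 71, 49, 60, 136, 201, 103, 428, 181, 336, 147, 39, 190, 102, 124, 158, 286, 209, 120, 252,
   338, 44, 191, 157, 429, 137, 455, 164, 203, 339, 340, 187, 431, 262, 320, 200, 297, 227, 276, 245, 341,
   298, 500]],
   Learn 11 [(1, C2), (2, C0), (10, C3)] [Look [3, 26, 11, 6, 13, 9, 5], Use 7, Use 10, Look [95, 56, 19, 87,
   28, 122, 18, 32]],
   Learn 12 [(10, C3), (2, C0)] [Use 9, Use 11, Look [1, 11, 5, 4, 9, 37, 26, 16]],
   Learn 13 [(1, C3), (2, C0)] [Use 12, Look [10, 3, 11, 6, 5, 48, 18, 35, 28, 88, 32, 38, 72, 16, 89, 23,
   175, 50, 152, 246, 115, 73, 342, 278, 47, 31, 153, 111, 55, 432, 8, 41, 86, 30, 299, 14, 7, 53, 58, 85,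
   361, 21, 15, 76, 143, 211, 133, 4, 61, 287, 300, 79, 69, 104, 138, 81, 22, 51]],
   Learn 14 [(11, C2), (2, C0), (1, C0)] [Use 12, Look [10, 3, 6, 13, 48, 5, 16, 35, 110, 26, 38, 101, 28, 87,
   18, 23, 84, 50, 264, 73, 141, 47, 31, 132, 41, 7, 129, 291, 39, 12, 8, 19, 78, 280, 79, 94, 9, 20, 42, 100,
   64, 265, 4, 105, 345, 127, 149, 344, 58, 208, 102, 360, 81, 456, 157, 104, 457, 501]],
   Learn 15 [(1, C0), (2, C0)] [Use 12, Look [10, 3, 6], Use 14, Look [11, 4, 15, 43, 32, 18]],
   Learn 16 [(2, C0)] [Use 12, Look [10], Use 15, Use 13, Look [1, 26, 11, 9, 5, 4, 6, 57, 3, 18, 12, 32, 14,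
   15]],
   Learn 17 [(1, C2), (2, C1), (4, C3)] [Look [26, 11, 16, 5]],
   Learn 18 [(11, C0), (6, C3), (411, C0), (21, C1), (142, C3), (43, C2), (8, C0), (4, C3), (2, C1), (33, C0),
   (30, C3), (153, C0), (143, C1), (50, C1), (132, C3)] [Look [18, 7, 129, 5, 150, 141, 85, 81, 101, 63, 104,
   307, 249, 71, 374, 199]],
   Learn 19 [(9, C1), (4, C3), (8, C0), (40, C3), (385, C2), (5, C0), (21, C1), (322, C1), (10, C2), (99, C2),
   (167, C3), (265, C0), (7, C3), (47, C3), (1, C3), (14, C3)] [Look [3, 33, 35, 80, 12, 100, 20, 149, 321,
   64, 163, 210, 91, 125, 22, 279, 51, 104, 81]],
   Learn 20 [(19, C1), (133, C2), (48, C1), (7, C3), (5, C0), (21, C1), (33, C0), (4, C3), (152, C0), (8, C0),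
   (142, C3), (6, C3), (3, C0), (32, C2), (13, C2)] [Look [40, 79, 56, 54, 122, 92, 28, 71, 78, 51, 86, 81,
   22, 76, 193]],
   Learn 21 [(49, C2), (18, C0), (115, C2), (20, C1), (6, C3), (5, C0), (21, C1)] [Look [29, 22, 66, 126, 69]],
   Learn 22 [(49, C1), (15, C1), (53, C2), (3, C0), (2, C1), (40, C3), (176, C3), (48, C1), (8, C0), (35, C1),
   (5, C0), (21, C1), (117, C2), (4, C3), (19, C2), (111, C3), (97, C0), (59, C0), (37, C2), (129, C0), (115,
   C2)] [Look [7, 47, 41, 98, 96, 51, 126, 146, 45, 22, 65, 169, 309, 67, 91, 61, 76, 198, 44, 357, 403, 186,
   116, 256, 183]],
   Learn 23 [(1, C3), (2, C1), (10, C2)] [Look [4, 3, 6, 13, 32, 18, 15, 43, 14, 23, 8, 21, 50, 7, 42, 106,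
   33, 74, 53, 208, 35, 40, 142, 47, 127, 131, 41, 117, 48, 39, 132, 458, 246, 175, 238, 412, 89, 133, 176,
   152, 79, 383, 148, 342, 344, 185, 143, 58, 347, 411, 30, 72, 348, 153, 322, 111, 265], Use 18, Look [11,
   129, 5, 115, 16, 85, 167, 385], Use 20, Look [19, 9, 37, 12], Use 19, Look [99, 20, 26, 59, 97], Use 22,
   Use 21, Look [49, 98, 96, 22, 146, 125, 51, 64, 81, 210, 104, 279]],
   Learn 24 [(49, C0), (30, C3), (48, C1), (211, C1), (20, C1), (323, C1), (5, C3), (7, C0), (16, C0), (39,
   C3), (317, C3), (105, C2), (4, C3), (35, C1), (8, C3), (84, C0), (40, C0), (33, C3), (94, C2), (117, C2),
   (37, C2)] [Look [59, 58, 96, 45, 125, 301, 64, 167, 179, 78, 91, 316, 85, 44, 86, 204, 119, 300, 102, 22,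
   76, 38, 155, 253, 69, 225, 275, 130, 136, 60, 191]],
   Learn 25 [(49, C2), (211, C1), (18, C3), (5, C3), (6, C0), (20, C1), (59, C3)] [Look [29, 51, 66, 22, 69]],
   Learn 26 [(10, C2), (2, C1)] [Look [4], Use 17, Use 23, Look [1, 3, 26, 11, 6, 13, 9, 5, 48, 18, 12, 16,
   35, 7, 37, 20, 23, 99, 8, 33, 97, 50, 154, 42, 40, 19, 255, 115, 105, 74, 59, 90, 189, 150, 58, 131, 145,
   55, 87, 433, 117, 80, 100, 317, 30, 84, 459, 79, 39, 113, 435, 264, 101, 94, 349, 141, 345, 194, 129, 460,
   323, 361, 211], Use 24, Use 25, Look [49, 96, 51, 45, 22, 81, 309, 91, 363, 155]],
   Learn 27 [(5, C3), (2, C1)] [Look [16, 26, 1, 11, 4], Use 26, Look [10, 9, 52, 83, 6, 37, 12, 114, 3, 128,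
   23, 14, 20, 7, 62, 13, 144, 251, 50, 80, 8, 151, 33, 362, 84, 111, 388, 21, 42, 228, 40, 127, 264, 35, 145,
   39, 78, 99, 59, 104, 100, 94, 64, 141, 81, 45, 149, 153, 51, 96, 102, 72, 49, 234, 98]],
   Learn 28 [(1, C3), (2, C1), (5, C0), (6, C2)] [Look [3, 11, 10, 4]],
   Learn 29 [(6, C2), (5, C0), (2, C1)] [Look [16], Use 28, Look [1, 26, 11, 4, 37, 9, 83], Use 6, Look [31,
   128, 55, 7, 10, 35, 8, 144, 3, 99, 207, 42, 13, 48, 32, 154, 54, 74, 75, 97, 92, 56, 290, 19, 90, 425, 314,
   236, 282, 308, 134, 278, 73, 100, 47, 131, 41, 117, 21, 305, 135, 14, 142, 106, 108, 15, 71, 53, 325, 259,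
   206, 414, 184, 121, 348, 270, 461, 274, 51, 376, 224, 216, 375, 22, 202, 29, 109, 326, 350, 310, 49, 427,
   315, 199, 336, 147, 365, 98, 284, 242, 226, 252, 338, 195, 93, 164, 436, 113, 320, 437, 30, 430, 160, 339,
   219, 276, 327]],
   Learn 30 [(6, C3), (2, C1)] [Use 3, Use 26, Look [10]],
   Learn 31 [(7, C3), (15, C3), (2, C1), (1, C0)] [Look [12, 8, 14]],
   Learn 32 [(6, C0), (2, C1)] [Use 26, Look [10], Use 27, Look [5, 18, 4, 3, 43, 32, 15, 75, 140, 11, 48, 1,
   246, 35, 26, 13, 238, 83, 46, 56, 53, 176, 462, 400, 283, 331], Use 31, Look [7, 8, 33, 65, 47, 106, 40,
   41, 304, 237, 132, 73, 50, 31, 55, 131, 143, 207, 20, 117, 59, 12, 97, 206, 51, 9, 248, 270, 114, 19, 216],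
   Use 5, Look [194, 346, 135, 134, 109, 333, 91, 321, 108, 259, 22, 326, 163, 351, 71, 184, 49, 463, 197,
   233, 29, 464, 116, 168, 274, 439, 465, 169, 182, 380, 61, 177, 416, 407, 466, 126, 365, 201, 467, 468, 188,
   124, 440, 469, 286, 263, 470, 471, 341, 227, 441, 262, 328, 393]],
   Learn 33 [(2, C1)] [Use 32, Use 30, Look [6], Use 29, Use 27, Look [5]],
   Fix [Use 16, Use 33, Look [2]],
   Learn 34 [(10, C3), (6, C2), (5, C0)] [Look [11, 4, 1, 57, 9, 37, 12, 82, 52, 35, 3, 114, 105, 77, 14, 13,
   48, 32, 23, 133, 15, 46, 161, 144, 18, 70, 7, 121, 128, 84, 43, 212, 28, 88, 215, 42, 20, 72, 31, 83, 80,
   205, 87, 228, 178, 74, 346, 55, 58, 269, 78, 207, 139, 122, 79, 173, 64, 155, 175, 244, 104, 261, 162, 174,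
   260, 204, 347, 120, 108, 229, 29, 91, 364, 387, 71, 66, 256, 239, 472, 224, 405, 253, 92, 103, 76, 473,
   273, 130, 106, 45, 158, 225, 86, 381, 394, 156, 109, 67, 94, 474, 288, 201, 123, 182, 475, 172, 39, 476,
   118, 124, 63, 272, 424, 230, 281, 311, 220, 395, 257, 221, 396, 180]],
   Learn 35 [(5, C0), (6, C2)] [Look [11, 4, 1, 57, 9, 37, 12, 82], Use 34, Look [10, 3, 14, 13, 15, 77, 23,
   70, 42, 75, 166, 16, 325, 74, 32, 43, 417, 18, 46, 205, 477, 443, 7, 121, 285, 478, 390, 229, 397, 20, 31,
   150, 479, 148, 202, 213, 85, 143, 386, 30, 391, 142, 60, 160, 63, 69, 93, 130, 293, 352, 195, 330, 29, 249,
   107, 139, 284, 66, 199, 162, 155, 350, 480, 103, 267, 481, 367, 123, 482, 483, 22, 368, 21, 138, 67, 118,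
   406, 102, 230, 190, 445, 88, 418]],
   Learn 36 [(18, C0), (6, C2), (70, C3), (55, C0), (7, C0), (48, C1), (13, C0), (23, C3), (42, C2), (9, C3),
   (4, C1), (77, C1), (35, C1), (133, C2), (57, C3)] [Use 35, Look [5, 12, 72, 20, 74, 212, 43, 88, 205, 38,
   192, 189, 30, 82, 58, 112, 60, 196, 161, 37, 86, 113, 139, 69, 93, 130, 65, 294, 76, 173, 155, 273, 107,
   61, 66, 225, 288, 162, 156, 295, 201, 29, 120, 136, 118, 103, 444, 190, 182, 63, 170, 191, 45, 158, 267,
   124, 281, 142, 398, 157, 94, 137, 263, 367, 484, 214, 301, 485, 340, 164, 486, 220, 329, 221, 378, 393,
   487, 180, 488, 409, 258, 438, 200, 327, 187, 219, 44, 389, 160, 202, 195, 123, 198, 22, 67, 368, 102, 418]],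
   Learn 37 [(7, C0), (10, C0), (4, C1), (6, C2)] [Use 35, Look [5, 11, 1, 35, 3, 13, 48, 52, 9, 57, 15, 12,
   72, 31, 14, 55, 77, 23, 133, 70, 42, 74], Use 36, Look [18, 212, 28, 21, 88, 78, 87, 240, 285, 84, 73, 196,
   112, 47, 132, 65, 38, 41, 299, 61, 176, 219, 123, 202]],
   Learn 38 [(7, C3), (1, C2), (13, C0)] [Look [33, 31, 40, 55]],
   Learn 39 [(4, C1), (6, C2), (10, C0)] [Use 35, Look [5, 11, 1, 35, 3, 13, 48, 52, 9, 57, 15], Use 37, Use
   38, Look [7, 12, 19, 46, 14, 105, 62, 56, 121, 77, 23, 217, 151, 54, 53, 148, 133, 144, 8, 42, 89, 58, 228,
   101, 38, 79, 112, 78, 113, 64, 93, 139]],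
   Learn 40 [(10, C0), (1, C2), (6, C2)] [Use 35, Look [5, 3], Use 39, Look [4, 52, 9, 14, 26, 12, 16, 23]],
   Learn 41 [(6, C2)] [Use 35, Look [5, 11, 1], Use 40, Look [10, 4, 3, 52, 9, 57, 13, 32, 151, 42, 46, 62,
   144, 33, 12, 217, 40, 14, 7, 23, 15, 20, 150, 16, 240, 255, 234, 183, 107, 119, 44]],
   Learn 42 [(5, C3), (3, C2)] [Look [1, 11]],
   Learn 43 [(1, C0), (6, C0)] [Look [10, 4, 3, 52, 15, 43, 14, 77], Use 42, Look [5, 35, 26, 12, 13, 11, 23,
   105, 9, 57, 54, 48, 16, 213, 62, 133, 82, 266, 108, 8, 37, 251, 110, 38, 152, 217, 33, 161, 80, 101, 21,
   47, 154, 174, 244, 89, 247, 112, 40, 79, 41, 420, 306, 86, 254, 165, 243, 413, 58, 366, 210, 162, 76, 248,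
   189, 81, 225, 173, 209, 241, 193, 218, 349, 205, 136, 116, 489, 22, 59, 229, 334, 66, 296, 67, 277, 343,
   156, 49, 118, 302, 141, 45, 182, 63, 191, 337, 103, 172, 85, 230, 158, 226, 30, 220, 137, 289, 275, 180,
   124, 221, 490, 214, 502]],
   Learn 44 [(6, C0)] [Look [10, 4, 3, 52, 15, 43, 14, 77], Use 42, Look [5], Use 43, Look [1, 9, 12, 13, 83,
   23, 82, 62, 33, 26, 18, 114, 40, 16, 54, 37, 248, 266, 313, 108, 8, 174, 243, 351, 80, 421, 127, 21, 229,
   233, 145, 218, 100, 208, 94, 491, 59, 492, 39, 493, 45, 44, 494, 495, 319, 96, 22, 102, 241, 223, 179, 107,
   356, 496, 67, 93, 49, 165, 384, 186, 372, 173, 497, 210, 149, 446, 197, 118, 209, 163, 369, 29, 498, 157,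
   181, 20, 103, 250, 66, 230, 159, 69, 447, 110, 335]],
   Fix [Use 44, Use 41, Look [6, 10, 3]],
   Learn 45 [(7, C1), (5, C2), (1, C3), (4, C1), (48, C1), (57, C3)] [Look [35, 13, 9, 15, 12, 19, 82, 14, 62,
   20, 87, 33, 23, 85, 28, 40, 84, 167, 80, 78, 50, 145, 108, 39, 115, 90, 54, 161, 243, 8, 77, 101, 64, 21,
   43, 175, 261, 382, 125, 271, 41, 166, 178, 332, 232, 132, 37, 109, 107, 174, 67, 147, 165, 22, 63, 118,
   120, 222, 210, 162, 44, 119, 103, 172, 45, 179, 138, 158, 226, 96, 59, 252, 410, 272, 289, 209, 164, 257,
   302, 369, 277, 245, 358, 258, 180, 276, 203, 392, 297, 419, 221, 220, 312, 298, 137, 408, 214, 442, 124,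
   187, 329, 263, 328, 227, 434, 160, 280, 30, 110, 69, 159, 335, 200, 181, 415, 60, 233, 29, 318]],
   Learn 46 [(7, C0), (1, C3), (4, C1), (5, C2)] [Look [35, 13, 11, 48, 9, 57, 15, 12, 72, 31, 82, 14, 20, 55,
   105, 23, 70, 90, 58, 213, 215, 151, 42, 19, 247, 8, 74, 87, 86, 21, 92, 28, 76, 106, 178, 239, 109, 292]],
   Learn 47 [(4, C1), (5, C2), (1, C3)] [Look [35, 13, 11, 48, 52, 9, 57, 15], Use 46, Use 45, Look [7, 19,
   33, 72, 46, 40, 81, 32, 121, 218, 18, 51, 59, 324, 28, 88, 20, 108, 38, 12, 54, 23, 14, 105, 56, 16, 8, 58,
   110, 134, 21, 30, 39, 65, 41, 22, 55, 44, 92, 61, 69, 102, 136, 222, 120, 60, 159, 119, 29, 191, 158, 253,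
   98, 137, 250, 126, 203, 157, 188, 262]],
   Learn 48 [(1, C3), (5, C2)] [Look [11], Use 47, Look [4, 57, 15, 12, 32, 14, 18, 23]],
   Learn 49 [(5, C2)] [Use 48, Look [1, 26, 13, 11, 33, 54, 4, 52, 57, 15, 151, 70, 14, 213, 42, 12, 8, 215,
   74, 23, 9, 127, 21, 379, 18, 208, 307, 171, 93, 170, 60]],
   Fix [Use 49, Look [5, 1, 11]]]"

text \<open>Two points of the opposite triple agree; the third, vertex 68, has the remaining
  colour.\<close>

definition single_triple_start :: pattern where
  "single_triple_start = [(17,C0),(34,C1),(24,C1),(36,C1),(27,C2),(25,C2),(68,C3)]"

lemma single_triple_edges_ok: "edges_ok unit_apart (index single_triple_points Tip) single_triple_edges"
  unfolding single_triple_points_def single_triple_edges_def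
  by (simp only: edges_simps unit_apart.simps)

lemma single_triple_replay:
  "replay (index single_triple_edges Tip) single_triple_items (index [] Tip) (Some (suppose single_triple_start Tip)) = None"
  unfolding single_triple_edges_def single_triple_items_def single_triple_start_def
  by (simp only: check_simps)

lemma single_triple_start:
  "matches (seen h place (index single_triple_points Tip)) single_triple_start \<longleftrightarrow>
     h (place (0, 0, 0, 0)) = C0 \<and> h (place (12, 0, 0, 0)) = C1 \<and> h (place (-6, 0, 6, 0)) = C1 \<and>
     h (place (-6, 0, -6, 0)) = C1 \<and> h (place (6, 0, 6, 0)) = C2 \<and> h (place (-12, 0, 0, 0)) = C2 \<and>
     h (place (6, 0, -6, 0)) = C3"
  unfolding single_triple_points_def single_triple_start_def
  by (simp only: matches_simps seen_num_of_nat check_simps coords_of.simps simp_thms)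

lemma no_single_triple_ring:
  assumes "proper_colouring h"
  shows "\<not> (h 0 = C0 \<and> h 1 = C1 \<and> h \<omega> = C2 \<and> h (\<omega> - 1) = C1 \<and> h (-1) = C2 \<and>
    h (-\<omega>) = C1 \<and> h (1 - \<omega>) = C3)"
proof -
  have "\<not> matches (seen h place (index single_triple_points Tip)) single_triple_start"
    by (rule certificate_refutes[OF assms unit_apart_place single_triple_edges_ok _ single_triple_replay]) simp_all
  then show ?thesis by (simp add: single_triple_start place_ring)
qed

section \<open>From hexagons to triangles of side sqrt 3\<close>

lemma colour_other:
  fixes a b x y z :: colour
  assumes "distinct [a, b, x]" "y \<notin> {a, b}" "z \<notin> {a, b}" "y \<noteq> x" "z \<noteq> x" shows "y = z"
  using assms by (cases a; cases b; cases x; cases y; cases z) simp_all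

text \<open>After renaming, the only open colour is that of 1 - \<omega>. It differs from the
  colours of 0 and 1. So it is either the colour of \<omega>, which gives the alternating hexagon,
  or the fourth colour.\<close>

lemma ring_with_equal_neighbours:
  assumes "proper_colouring h"
    and "h (\<omega> - 1) = h 1" "h (-\<omega>) = h 1" "h (-1) = h \<omega>"
  shows False
proof -
  have far: "h p \<noteq> h q" if "cmod (p - q) = 1" for p q
    using proper_colouringD[OF assms(1) that] .
  have d: "distinct [h 0, h 1, h \<omega>]"
    using far[of 0 1] far[of 0 \<omega>] far[of 1 \<omega>] norm_\<omega> norm_\<omega>_minus_1 by simp
  have e: "h (1 - \<omega>) \<notin> {h 0, h 1}"
    using far[of "1 - \<omega>" 0] far[of "1 - \<omega>" 1] norm_\<omega> norm_\<omega>_minus_1 by simp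
  obtain \<pi> where \<pi>: "inj \<pi>" "\<pi> (h 0) = C0" "\<pi> (h 1) = C1" "\<pi> (h \<omega>) = C2"
      "\<And>c. c \<notin> {h 0, h 1, h \<omega>} \<Longrightarrow> \<pi> c = C3"
    using recolour[OF d] by metis
  have "proper_colouring (\<lambda>x. \<pi> (h x))"
    using proper_colouring_transform[OF assms(1) _ \<pi>(1), of 1 0] by simp
  from no_alternating_ring[OF this] no_single_triple_ring[OF this] show False
    using assms(2-4) \<pi> e by (cases "h (1 - \<omega>) = h \<omega>") auto
qed

text \<open>Two colours remain for the three opposite points, so two of these agree. A rotation by a
  multiple of 120 degrees preserves both triples and moves the agreeing pair to \<omega> and
  -1.\<close>

lemma no_mono_triple:
  assumes "proper_colouring h"
  shows "\<not> (h 1 = h (\<omega> - 1) \<and> h (-\<omega>) = h 1)"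
proof
  assume *: "h 1 = h (\<omega> - 1) \<and> h (-\<omega>) = h 1"
  have far: "h p \<noteq> h q" if "cmod (p - q) = 1" for p q
    using proper_colouringD[OF assms that] .
  let ?x = "h \<omega>" and ?y = "h (-1)" and ?z = "h (1 - \<omega>)"
  have "?x \<notin> {h 0, h 1}" "?y \<notin> {h 0, h 1}" "?z \<notin> {h 0, h 1}" "h 0 \<noteq> h 1"
    using far[of \<omega> 0] far[of \<omega> 1] far[of "-1" 0] far[of "-1" "-\<omega>"] far[of "1 - \<omega>" 0]
      far[of "1 - \<omega>" 1] far[of 0 1] norm_\<omega> norm_\<omega>_minus_1 * by auto
  then have "?x = ?y \<or> ?y = ?z \<or> ?z = ?x"
    using colour_other[of "h 0" "h 1" ?x ?y ?z] by auto
  then consider "?x = ?y" | "?y = ?z" | "?z = ?x" by blast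
  moreover have turn: "proper_colouring (\<lambda>x. h (u * x))" if "cmod u = 1" for u
    using proper_colouring_transform[OF assms that inj_on_id, of 0] by simp
  \<comment> \<open>The rotations by \<open>\<omega> - 1\<close> and \<open>- \<omega>\<close>, of
    120 and 240 degrees, take the pair \<omega>, -1 to the pairs -1, 1 - \<omega> and 1 - \<omega>,
    \<omega>.\<close>
  moreover have "(\<omega> - 1) * (\<omega> - 1) = -\<omega>" "(\<omega> - 1) * \<omega> = -1" "\<omega> * (\<omega> - 1) = -1"
    by (simp_all add: algebra_simps \<omega>_sq)
  ultimately show False
    using ring_with_equal_neighbours[OF assms] ring_with_equal_neighbours[OF turn[of "\<omega> - 1"]]
      ring_with_equal_neighbours[OF turn[of "-\<omega>"]] * norm_\<omega> norm_\<omega>_minus_1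
    by cases (simp_all add: \<omega>_sq)
qed

lemma no_mono_triangle:
  assumes "proper_colouring g" "cmod t = sqrt 3"
  shows "\<not> (g p = g (p + t) \<and> g (p + \<omega> * t) = g p)"
proof -
  \<comment> \<open>The circumcentre of the triangle is \<open>p - ?u\<close>, and \<open>?u\<close>
    is the unit vector from there to \<open>p\<close>.\<close>
  let ?u = "- t * (1 + \<omega>) / 3"
  have "cmod (1 + \<omega>) = sqrt 3" by (simp add: \<omega>_def cmod_def power_divide)
  then have u: "cmod ?u = 1" using assms(2) by (simp add: norm_mult norm_divide)
  have e: "(p - ?u) + ?u * 1 = p" "(p - ?u) + ?u * (\<omega> - 1) = p + t"
    "(p - ?u) + ?u * (-\<omega>) = p + \<omega> * t"
    by (simp_all add: field_simps \<omega>_mult)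
  have "proper_colouring (\<lambda>x. g ((p - ?u) + ?u * x))"
    using proper_colouring_transform[OF assms(1) u inj_on_id] by simp
  from no_mono_triple[OF this, unfolded e] show ?thesis .
qed

section \<open>Points at distance 4\<close>

text \<open>
  The rotation by \<open>\<rho>\<close> moves points at distance 2 from the centre by 1.
\<close>

definition \<rho> :: complex where "\<rho> = Complex (7/8) (sqrt 15 / 8)"

text \<open>Points of the lattice have c = d = 0, points of its rotated copy a = b = 0; only the
  centre belongs to both descriptions.\<close>

definition double_place :: "coords \<Rightarrow> complex" where
  "double_place = (\<lambda>(a, b, c, d). of_int a + of_int b * \<omega> + (of_int c + of_int d * \<omega>) * \<rho>)"

text \<open>The norm form of the Eisenstein integers in the basis 1, \<omega>. The sign of the mixed
  term is positive because \<omega> is a sixth, not a third, root of unity.\<close>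

fun lattice_norm :: "int \<Rightarrow> int \<Rightarrow> int" where
  "lattice_norm a b = a * a + a * b + b * b"

text \<open>The parameter is the squared distance: 1 for edges and 3 for sides of triangles.\<close>

fun lattice_apart :: "int \<Rightarrow> coords \<Rightarrow> coords \<Rightarrow> bool" where
  "lattice_apart n (a, b, c, d) (a', b', c', d') \<longleftrightarrow>
     c = c' \<and> d = d' \<and> lattice_norm (a - a') (b - b') = n \<or>
     a = a' \<and> b = b' \<and> lattice_norm (c - c') (d - d') = n"

text \<open>The second alternative joins the two lattices. There the difference of the points is v
  (1 - \<rho>) for a lattice vector v of length 2, and 1 - \<rho> has modulus 1/2.\<close>

fun double_apart :: "coords \<Rightarrow> coords \<Rightarrow> bool" where
  "double_apart (a, b, c, d) (a', b', c', d') \<longleftrightarrow>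
     lattice_apart 1 (a, b, c, d) (a', b', c', d') \<or>
     a - a' = c' - c \<and> b - b' = d' - d \<and> lattice_norm (a - a') (b - b') = 4"

lemma norm_lattice: "cmod (of_int a + of_int b * \<omega>) = sqrt (of_int (lattice_norm a b))"
proof -
  have "(of_int a + of_int b / 2)\<^sup>2 + (of_int b * sqrt 3 / 2)\<^sup>2 = (of_int (lattice_norm a b) :: real)"
    by (simp add: power2_eq_square algebra_simps)
  then show ?thesis by (simp add: cmod_def \<omega>_def)
qed

lemma norm_\<rho>: "cmod \<rho> = 1" and norm_1_minus_\<rho>: "cmod (1 - \<rho>) = 1/2"
  by (simp_all add: \<rho>_def cmod_def power_divide real_sqrt_divide)

lemma double_place_diff:
  "double_place (a, b, c, d) - double_place (a', b', c', d') =
     (of_int (a - a') + of_int (b - b') * \<omega>) + (of_int (c - c') + of_int (d - d') * \<omega>) * \<rho>"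
  by (simp add: double_place_def algebra_simps)

lemma lattice_apart_dist:
  assumes "lattice_apart n p q" shows "cmod (double_place p - double_place q) = sqrt (of_int n)"
  using assms by (cases p; cases q)
    (auto simp: double_place_diff norm_mult norm_\<rho> norm_lattice simp del: lattice_norm.simps of_int_diff)

lemma double_apart_dist:
  assumes "double_apart p q" shows "cmod (double_place p - double_place q) = 1"
proof -
  obtain a b c d where p: "p = (a, b, c, d)" by (cases p)
  obtain a' b' c' d' where q: "q = (a', b', c', d')" by (cases q)
  from assms consider "lattice_apart 1 p q" |
      "a - a' = c' - c" "b - b' = d' - d" "lattice_norm (a - a') (b - b') = 4"
    unfolding p q double_apart.simps by blast
  then show ?thesis
  proof cases
    case 1 with lattice_apart_dist[of 1 p q] show ?thesis by simp
  next
    case 2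
    then have eqs: "c - c' = - (a - a')" "d - d' = - (b - b')" by linarith+
    have "double_place p - double_place q = (of_int (a - a') + of_int (b - b') * \<omega>) * (1 - \<rho>)"
      unfolding p q double_place_diff eqs by (simp add: algebra_simps)
    with 2(3) show ?thesis by (simp add: norm_mult norm_1_minus_\<rho> norm_lattice del: lattice_norm.simps of_int_diff)
  qed
qed

text \<open>In the basis 1, \<omega>, multiplication by \<omega> takes (x, y) to (-y, x + y). The
  third vertex is the second one turned by 60 degrees about the first, so the length of one side
  determines the triangle as equilateral with that side.\<close>

fun triangle :: "coords \<Rightarrow> coords \<Rightarrow> coords \<Rightarrow> bool" where
  "triangle (a, b, c, d) (a', b', c', d') (a'', b'', c'', d'') \<longleftrightarrow>
     lattice_apart 3 (a', b', c', d') (a, b, c, d) \<and>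
     a'' - a = - (b' - b) \<and> b'' - b = (a' - a) + (b' - b) \<and>
     c'' - c = - (d' - d) \<and> d'' - d = (c' - c) + (d' - d)"

text \<open>The order of the entries matters: the vertices have to be listed
  counterclockwise.\<close>

fun mono_triangle :: "coords trie \<Rightarrow> pattern \<Rightarrow> bool" where
  "mono_triangle Q [(u, x), (v, y), (w, z)] \<longleftrightarrow> x = y \<and> y = z \<and>
     triangle (coords_of (fetch u Q)) (coords_of (fetch v Q)) (coords_of (fetch w Q))"
| "mono_triangle Q _ \<longleftrightarrow> False"

fun triangles_ok :: "coords trie \<Rightarrow> (nat \<times> pattern) list \<Rightarrow> bool" where
  "triangles_ok Q [] = True"
| "triangles_ok Q ((k, ls) # N) = (mono_triangle Q ls \<and> triangles_ok Q N)"

lemma triangle_turn: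
  assumes "triangle p q r"
  shows "double_place r = double_place p + \<omega> * (double_place q - double_place p)"
proof -
  obtain a b c d where p: "p = (a, b, c, d)" by (cases p)
  obtain a' b' c' d' where q: "q = (a', b', c', d')" by (cases q)
  obtain a'' b'' c'' d'' where r: "r = (a'', b'', c'', d'')" by (cases r)
  have eqs: "a'' = a - (b' - b)" "b'' = b + (a' - a) + (b' - b)"
     "c'' = c - (d' - d)" "d'' = d + (c' - c) + (d' - d)"
    using assms unfolding p q r by auto
  show ?thesis
    unfolding p q r double_place_def eqs by (simp add: algebra_simps \<omega>_mult)
qed

lemma triangles_excluded:
  assumes "proper_colouring h" "triangles_ok Q N" "(k, ls) \<in> set N"
  shows "\<not> matches (seen h double_place Q) ls"
proof -
  have "mono_triangle Q ls" using assms(2,3) by (induction Q N rule: triangles_ok.induct) auto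
  then obtain u v w x where ls: "ls = [(u, x), (v, x), (w, x)]"
    and tri: "triangle (coords_of (fetch u Q)) (coords_of (fetch v Q)) (coords_of (fetch w Q))"
    by (auto elim!: mono_triangle.elims(2))
  let ?p = "\<lambda>v. double_place (coords_of (fetch v Q))"
  have "lattice_apart 3 (coords_of (fetch v Q)) (coords_of (fetch u Q))"
    using tri by (cases "coords_of (fetch u Q)"; cases "coords_of (fetch v Q)"; cases "coords_of (fetch w Q)") simp
  from lattice_apart_dist[OF this] have "cmod (?p v - ?p u) = sqrt 3" by simp
  from no_mono_triangle[OF assms(1) this, of "?p u"] show ?thesis
    using triangle_turn[OF tri] by (auto simp: matches_def ls seen_num_of_nat)
qed

section \<open>The graph that forces opposite points at distance 4 to agree\<close>

definition diagonal_points :: "(nat \<times> int \<times> int \<times> int \<times> int) list" where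
  "diagonal_points = [
   (1, (0, 0, 0, 0)), (2, (-1, 1, 0, 0)), (3, (0, -1, 0, 0)), (4, (1, -1, 0, 0)), (5, (0, 1, 0, 0)), (6, (-1,
   0, 0, 0)), (7, (1, 0, 0, 0)), (8, (-2, 2, 0, 0)), (9, (2, -2, 0, 0)), (10, (0, -2, 0, 0)), (11, (-1, 2, 0,
   0)), (12, (1, -2, 0, 0)), (13, (-1, -1, 0, 0)), (14, (-2, 1, 0, 0)), (15, (2, -1, 0, 0)), (16, (0, 2, 0,
   0)), (17, (1, 1, 0, 0)), (18, (0, 0, 2, -1)), (19, (0, 0, -1, 0)), (20, (-2, 0, 0, 0)), (21, (0, 0, -1,
   -1)), (22, (0, 0, 2, 0)), (23, (0, 0, 1, 0)), (24, (2, 0, 0, 0)), (25, (0, 0, -2, 1)), (26, (0, 0, -2, 0)),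
   (27, (0, 0, 1, -1)), (28, (0, 0, 2, -2)), (29, (0, 0, 1, 1)), (30, (0, 0, 0, -1)), (31, (0, 0, -1, 1)),
   (32, (0, 0, 3, -2)), (33, (0, 0, 3, -1)), (34, (0, 0, 0, -2)), (35, (0, 0, -2, -1)), (36, (0, 0, -1, -2)),
   (37, (0, 0, 0, 1)), (38, (0, 0, 0, 2)), (39, (0, 0, 1, 2)), (40, (0, 0, -2, 2)), (41, (0, 0, -3, 2)), (42,
   (0, 0, 2, 1)), (43, (0, 0, -3, 1)), (44, (3, -2, 0, 0)), (45, (1, 2, 0, 0)), (46, (-2, 3, 0, 0)), (47, (1,
   -3, 0, 0)), (48, (-1, -2, 0, 0)), (49, (-3, 2, 0, 0)), (50, (3, -1, 0, 0)), (51, (2, 1, 0, 0)), (52, (-2,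
   -1, 0, 0)), (53, (-3, 1, 0, 0)), (54, (-1, 3, 0, 0)), (55, (2, -3, 0, 0))]"

text \<open>Apart from the shared centre, vertex 1, the two lattice pieces are linked by six edges
  only. They join the six points at distance 2 from the centre, vertices 8, 9, 10, 16, 20 and 24, to
  their rotated images.\<close>

definition diagonal_edges :: "(nat \<times> nat list) list" where
  "diagonal_edges = [
   (2, [1, 5, 6, 8, 11, 14]), (3, [1, 4, 6, 13]), (4, [1, 3, 7, 15]), (5, [1, 2, 7, 17]), (6, [1, 2, 3, 13,
   14, 20]), (7, [1, 4, 5, 15, 24]), (8, [2, 11, 14]), (9, [4, 12, 15]), (10, [3, 12, 13]), (11, [2, 5, 8,
   16]), (12, [3, 4, 9, 10]), (13, [3, 6, 10, 20]), (14, [2, 6, 8, 20]), (15, [4, 7, 9, 24]), (16, [5, 11,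
   17]), (17, [5, 7, 24]), (19, [1, 21, 30]), (21, [19]), (22, [18, 24]), (23, [1, 18, 22, 27]), (25, [19,
   31]), (26, [19, 20, 21, 25]), (27, [1, 18, 23, 28]), (28, [9, 18, 27]), (29, [22, 23]), (30, [1, 19, 21]),
   (31, [1, 19]), (32, [18, 28, 33]), (33, [18, 22, 32]), (34, [10, 21, 30]), (35, [21, 26, 36]), (36, [21,
   34, 35]), (37, [1, 23, 29]), (38, [16, 29, 37]), (39, [29, 38]), (40, [8, 25, 31]), (41, [25, 40]), (42,
   [22, 29, 39]), (43, [25, 26, 41]), (44, [9, 15]), (45, [16, 17]), (46, [8, 11]), (47, [10, 12]), (48, [10,
   13]), (49, [8, 14]), (50, [15, 24, 44]), (51, [17, 24, 45]), (52, [13, 20, 48]), (53, [14, 20, 49]), (54,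
   [11, 16, 46]), (55, [9, 12, 47])]"

text \<open>Numbers up to 72 are taken by the given triangles. The main split is on the centre:
  patterns 124, 156 and 92 exclude \<open>C0\<close>, \<open>C1\<close> and \<open>C3\<close>, and
  the items from 157 on refute the remaining colour \<open>C2\<close>.\<close>

definition diagonal_items :: "item list" where
  "diagonal_items = [
   Learn 73 [(1, C0), (18, C1), (22, C3), (28, C3)] [Look [27, 23]],
   Learn 74 [(21, C2), (34, C0), (30, C3), (1, C1)] [Look [19, 26], Use 28, Look [35], Use 23, Look [36]],
   Learn 75 [(3, C3), (4, C2), (7, C3), (1, C1)] [Look [15], Use 50, Look [12], Use 68, Look [9]],
   Learn 76 [(9, C3), (15, C2), (7, C3), (4, C0)] [Use 72, Look [44], Use 65, Look [50]],
   Learn 77 [(9, C2), (7, C2), (15, C3), (4, C0)] [Use 72, Look [44], Use 64, Look [50]],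
   Learn 78 [(1, C0), (18, C1), (33, C2), (22, C3)] [Look [23, 27], Use 39, Look [28], Use 47, Look [32]],
   Learn 79 [(10, C3), (3, C0), (4, C3)] [Look [13], Use 12, Look [6]],
   Learn 80 [(16, C2), (7, C2), (17, C3), (5, C0)] [Use 71, Look [45], Use 58, Look [51]],
   Learn 81 [(21, C0), (34, C2), (30, C3), (19, C2)] [Look [26], Use 29, Look [35], Use 23, Look [36]],
   Learn 82 [(21, C0), (30, C2), (34, C3), (1, C1)] [Look [19, 26], Use 30, Look [35], Use 22, Look [36]],
   Learn 83 [(8, C0), (1, C1), (17, C1), (5, C3)] [Look [2], Use 31, Look [11]],
   Learn 84 [(8, C2), (1, C1), (17, C1), (5, C3)] [Look [2], Use 31, Look [11]],
   Learn 85 [(2, C0), (5, C1), (17, C3), (1, C3)] [Look [6], Use 33, Look [11, 14, 16, 8], Use 9, Look [46],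
   Use 48, Look [54]],
   Learn 86 [(5, C1), (7, C2), (1, C3)] [Look [17], Use 85, Look [2], Use 33, Look [11], Use 61, Look [16]],
   Learn 87 [(3, C2), (4, C1), (7, C2), (1, C3)] [Look [15], Use 52, Look [12], Use 67, Look [9]],
   Learn 88 [(7, C2), (1, C3)] [Use 86, Look [5], Use 55, Look [4, 15], Use 87, Look [3, 6], Use 52, Look [12,
   13, 9, 10], Use 49, Look [47], Use 63, Look [55]],
   Learn 89 [(3, C1), (4, C2), (1, C3)] [Look [7, 15], Use 52, Look [12], Use 66, Look [9]],
   Learn 90 [(4, C2), (1, C3)] [Look [7, 15], Use 89, Look [3, 6], Use 52, Look [12, 13], Use 11, Look [10]],
   Learn 91 [(3, C2), (4, C0), (1, C3)] [Look [6, 13], Use 10, Look [10], Use 54, Look [12]],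
   Learn 92 [(1, C3)] [Use 88, Look [7], Use 90, Look [4], Use 55, Look [5, 17], Use 91, Look [3], Use 15,
   Look [2, 6], Use 33, Look [11, 14], Use 5, Look [8]],
   Learn 93 [(22, C3), (18, C1), (1, C0), (9, C0)] [Use 73, Look [28], Use 78, Look [33, 27], Use 47, Look
   [32]],
   Learn 94 [(18, C1), (9, C0), (1, C0)] [Use 93, Look [22, 23, 27, 28], Use 46, Look [32], Use 40, Look [33]],
   Learn 95 [(22, C2), (18, C3), (9, C0), (1, C0)] [Look [23, 27, 28], Use 46, Look [32], Use 38, Look [33]],
   Learn 96 [(18, C3), (9, C0), (1, C0)] [Use 95, Look [22, 23, 27, 28], Use 45, Look [32], Use 39, Look [33]],
   Learn 97 [(23, C3), (22, C1), (16, C0), (1, C0), (18, C0)] [Use 41, Look [29, 37, 38], Use 42, Look [39],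
   Use 37, Look [42]],
   Learn 98 [(22, C1), (16, C0), (1, C0), (18, C0)] [Use 97, Look [23], Use 41, Look [29, 37, 38], Use 42,
   Look [39], Use 36, Look [42]],
   Learn 99 [(23, C1), (22, C2), (16, C0), (1, C0), (18, C0)] [Use 41, Look [29, 37, 38], Use 43, Look [39],
   Use 35, Look [42]],
   Learn 100 [(22, C2), (16, C0), (1, C0), (18, C0)] [Use 99, Look [23], Use 41, Look [29, 37, 38], Use 43,
   Look [39], Use 37, Look [42]],
   Learn 101 [(23, C2), (16, C0), (1, C0), (18, C0)] [Use 98, Use 100, Look [22], Use 41, Look [29, 37, 38],
   Use 44, Look [39], Use 36, Look [42]],
   Learn 102 [(18, C0), (16, C0), (1, C0)] [Use 98, Use 100, Look [22], Use 101, Look [23], Use 41, Look [29,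
   37, 38], Use 44, Look [39], Use 35, Look [42]],
   Learn 103 [(22, C3), (18, C2), (9, C0), (1, C0)] [Look [23, 27, 28], Use 47, Look [32], Use 38, Look [33]],
   Learn 104 [(4, C2), (1, C0), (3, C1), (6, C2)] [Use 17, Look [2, 14], Use 3, Look [13], Use 11, Look [10],
   Use 56, Look [5, 12], Use 34, Look [11, 7, 15], Use 62, Look [16, 9], Use 102, Use 94, Use 96, Use 103,
   Look [22, 23, 27, 28], Use 45, Look [32], Use 40, Look [33]],
   Learn 105 [(9, C1), (3, C1), (4, C3)] [Look [15], Use 66, Look [7]],
   Learn 106 [(18, C2), (9, C0), (1, C0)] [Use 103, Look [22, 23, 27, 28], Use 45, Look [32], Use 40, Look
   [33]],
   Learn 107 [(7, C2), (18, C0), (1, C0), (14, C0), (2, C3)] [Look [5], Use 34, Look [11, 17], Use 102, Look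
   [16]],
   Learn 108 [(5, C2), (6, C2), (2, C3), (1, C0)] [Look [14], Use 34, Look [11], Use 5, Look [8]],
   Learn 109 [(9, C0), (7, C2), (1, C0), (14, C0), (2, C3)] [Use 107, Use 94, Use 106, Use 96],
   Learn 110 [(3, C1), (6, C2), (1, C0)] [Use 17, Look [2, 14], Use 3, Look [13], Use 104, Look [4], Use 108,
   Look [5, 7], Use 109, Use 105, Look [9, 12, 10], Use 2, Look [48], Use 13, Look [52]],
   Learn 111 [(8, C2), (6, C2), (14, C3), (2, C1)] [Use 1, Look [49], Use 7, Look [53]],
   Learn 112 [(7, C2), (1, C0), (11, C2), (5, C3), (13, C0), (3, C3)] [Look [4, 17], Use 53, Look [12, 15, 16,
   9], Use 102, Use 94, Use 106, Use 96],
   Learn 113 [(4, C2), (6, C2), (1, C0)] [Use 110, Look [3, 13], Use 53, Look [12], Use 11, Look [10]],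
   Learn 114 [(7, C3), (18, C0), (1, C0), (8, C0), (2, C1)] [Look [5, 11, 17], Use 102, Look [16]],
   Learn 115 [(7, C2), (8, C0), (2, C1), (1, C0), (13, C0), (3, C3)] [Look [5], Use 112, Look [11]],
   Learn 116 [(6, C2), (1, C0)] [Use 110, Look [3, 13], Use 3, Look [14, 2], Use 111, Look [8], Use 113, Look
   [4], Use 53, Look [12], Use 115, Look [7], Use 68, Look [9], Use 114, Use 94, Use 106, Use 96],
   Learn 117 [(8, C3), (14, C2), (6, C3), (2, C1)] [Use 1, Look [49], Use 8, Look [53]],
   Learn 118 [(7, C3), (1, C0), (8, C0), (2, C1), (13, C0), (3, C2)] [Look [4], Use 53, Look [12, 15, 9], Use
   114, Use 94, Use 106, Use 96],
   Learn 119 [(4, C3), (3, C2), (1, C0)] [Look [6, 13], Use 53, Look [12], Use 12, Look [10]],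
   Learn 120 [(2, C1), (1, C0)] [Use 116, Look [6], Use 17, Look [3, 13], Use 3, Look [14], Use 117, Look [8],
   Use 119, Look [4], Use 53, Look [12], Use 118, Look [7, 5], Use 67, Look [9, 11, 17], Use 94, Use 106, Use
   96, Use 102, Look [16]],
   Learn 121 [(4, C3), (1, C0)] [Use 116, Look [6], Use 120, Look [2, 14], Use 3, Look [13, 3], Use 12, Look
   [10], Use 57, Look [5, 12], Use 34, Look [11, 7], Use 105, Look [9], Use 61, Look [16], Use 102, Use 94,
   Use 106, Use 96],
   Learn 122 [(5, C3), (1, C0)] [Use 116, Look [6], Use 120, Look [2, 14], Use 34, Look [11], Use 6, Look [8]],
   Learn 123 [(9, C0), (16, C0), (1, C0)] [Use 102, Use 94, Use 106, Use 96],
   Learn 124 [(1, C0)] [Use 116, Look [6], Use 120, Look [2, 14], Use 3, Look [13, 3], Use 121, Look [4], Use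
   122, Look [5], Use 34, Look [11, 7, 17, 15, 16], Use 123, Look [9, 12, 10], Use 2, Look [48], Use 14, Look
   [52]],
   Learn 125 [(25, C2), (19, C3), (31, C0), (8, C1)] [Look [26, 40], Use 18, Look [41], Use 27, Look [43]],
   Learn 126 [(25, C2), (19, C0), (31, C3), (8, C1)] [Look [26, 40], Use 20, Look [41], Use 25, Look [43]],
   Learn 127 [(21, C3), (19, C0), (30, C2), (10, C1)] [Look [26, 34], Use 22, Look [36], Use 28, Look [35]],
   Learn 128 [(31, C3), (19, C0), (21, C1), (1, C1), (8, C1)] [Use 24, Use 126, Look [25]],
   Learn 129 [(25, C3), (19, C0), (31, C2), (8, C1)] [Look [26, 40], Use 19, Look [41], Use 25, Look [43]],
   Learn 130 [(21, C2), (1, C1), (10, C1), (19, C0)] [Look [30], Use 74, Look [34]],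
   Learn 131 [(21, C3), (19, C0), (1, C1), (10, C1)] [Use 127, Look [30]],
   Learn 132 [(19, C0), (1, C1), (8, C1), (10, C1)] [Use 130, Use 131, Look [21], Use 128, Look [31], Use 24,
   Use 129, Look [25]],
   Learn 133 [(21, C2), (19, C3), (10, C1), (1, C1)] [Look [26, 30, 34], Use 21, Look [36], Use 30, Look [35]],
   Learn 134 [(21, C0), (10, C1), (1, C1), (19, C3)] [Look [30], Use 82, Look [34]],
   Learn 135 [(31, C0), (21, C1), (1, C1), (19, C3), (8, C1)] [Use 24, Use 125, Look [25]],
   Learn 136 [(19, C3), (8, C1), (1, C1), (10, C1)] [Use 134, Use 133, Look [21], Use 135, Look [31], Use 24,
   Look [25, 26, 40], Use 19, Look [41], Use 27, Look [43]],
   Learn 137 [(25, C0), (19, C2), (31, C3), (8, C1)] [Look [26, 40], Use 20, Look [41], Use 26, Look [43]],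
   Learn 138 [(21, C3), (19, C2), (10, C1), (1, C1)] [Look [26, 30, 34], Use 21, Look [36], Use 29, Look [35]],
   Learn 139 [(31, C3), (19, C2), (8, C1), (21, C1), (1, C1)] [Use 137, Use 24, Look [25]],
   Learn 140 [(21, C1), (19, C2), (8, C1), (1, C1)] [Use 139, Look [31], Use 24, Look [25, 26, 40], Use 18,
   Look [41], Use 26, Look [43]],
   Learn 141 [(8, C1), (10, C1), (1, C1)] [Use 132, Use 136, Look [19], Use 140, Use 138, Look [21, 30], Use
   81, Look [34]],
   Learn 142 [(16, C3), (17, C2), (7, C3), (5, C0)] [Use 71, Look [45], Use 59, Look [51]],
   Learn 143 [(8, C3), (5, C0), (16, C1), (1, C1)] [Look [2, 11]],
   Learn 144 [(2, C2), (3, C0), (8, C0)] [Look [14, 6]],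
   Learn 145 [(8, C0), (3, C0), (1, C1)] [Use 144, Look [2, 14, 6]],
   Learn 146 [(8, C2), (5, C0), (16, C1), (1, C1)] [Look [2, 11]],
   Learn 147 [(4, C2), (1, C1), (7, C3)] [Look [15], Use 75, Look [3], Use 69, Look [17], Use 50, Look [12,
   5], Use 142, Look [16], Use 145, Use 146, Use 143, Use 141, Look [10, 13], Use 11, Look [6]],
   Learn 148 [(16, C3), (1, C1), (5, C2), (7, C3)] [Look [17], Use 31, Look [11], Use 62, Look [2]],
   Learn 149 [(6, C3), (8, C1), (1, C1), (4, C0), (9, C1)] [Look [3, 13, 12], Use 141, Look [10]],
   Learn 150 [(8, C1), (1, C1), (4, C0), (9, C1), (2, C0)] [Use 149, Look [6, 3, 13, 12], Use 141, Look [10]],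
   Learn 151 [(7, C3), (1, C1)] [Use 147, Look [4], Use 55, Look [5, 17], Use 69, Look [15], Use 76, Look [9],
   Use 148, Look [16], Use 31, Look [11, 2], Use 150, Look [8, 14], Use 5, Look [6]],
   Learn 152 [(2, C2), (5, C3), (1, C1)] [Look [7, 17], Use 31, Look [11], Use 61, Look [16]],
   Learn 153 [(5, C3), (1, C1)] [Look [7, 17], Use 69, Look [15, 4], Use 77, Look [9], Use 152, Look [2], Use
   83, Use 150, Use 84, Look [14], Use 6, Look [6]],
   Learn 154 [(3, C0), (8, C1), (1, C1), (4, C3), (15, C1)] [Use 50, Look [12], Use 141, Use 79, Look [10]],
   Learn 155 [(3, C2), (4, C3), (1, C1)] [Look [7, 15], Use 50, Look [12], Use 67, Look [9]],
   Learn 156 [(1, C1)] [Use 151, Look [7], Use 153, Look [5], Use 55, Look [4, 15], Use 69, Look [17], Use 80,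
   Look [16], Use 155, Look [3], Use 145, Use 154, Use 146, Use 143],
   Fix [Use 124, Use 156, Use 92, Look [1]],
   Learn 157 [(3, C0), (4, C3), (15, C2)] [Look [6], Use 51, Look [12, 13], Use 79, Look [10]],
   Learn 158 [(4, C3), (7, C1)] [Look [15], Use 157, Look [3], Use 51, Look [12], Use 66, Look [9]],
   Learn 159 [(2, C0), (5, C3), (17, C2)] [Look [6], Use 32, Look [11, 14], Use 6, Look [8]],
   Learn 160 [(7, C1)] [Use 158, Look [4], Use 55, Look [5, 17], Use 159, Look [2], Use 32, Look [11], Use 60,
   Look [16]],
   Fix [Use 160, Look [7]],
   Learn 161 [(2, C0), (5, C1)] [Look [17, 6], Use 32, Look [11, 14, 16, 8], Use 9, Look [46], Use 48, Look
   [54]],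
   Learn 162 [(5, C1)] [Look [17], Use 161, Look [2], Use 32, Look [11], Use 62, Look [16]],
   Fix [Use 162, Look [5], Use 55, Look [4, 15], Use 70, Look [17]],
   Learn 163 [(2, C3)] [Look [6], Use 16, Look [3]],
   Fix [Use 163, Look [2]],
   Learn 164 [(3, C3)] [Use 51, Look [12], Use 68, Look [9]],
   Fix [Use 164, Look [3, 6], Use 51, Look [12, 13, 9, 10], Use 4, Look [14], Use 49, Look [47], Use 63, Look
   [55]]]"

definition diagonal_start :: pattern where
  "diagonal_start = [(24,C0),(20,C1)]"

text \<open>These patterns are available to the replay from the start, so that the graph need not
  contain copies of the hexagon graphs.\<close>

definition diagonal_base :: "(nat \<times> pattern) list" where
  "diagonal_base = [
   (1, [(20, C1), (2, C1), (49, C1)]), (2, [(48, C1), (3, C1), (20, C1)]), (3, [(13, C0), (1, C0), (14, C0)]),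
   (4, [(13, C2), (1, C2), (14, C2)]), (5, [(6, C2), (5, C2), (8, C2)]), (6, [(6, C3), (5, C3), (8, C3)]), (7,
   [(6, C2), (8, C2), (53, C2)]), (8, [(6, C3), (8, C3), (53, C3)]), (9, [(2, C0), (16, C0), (46, C0)]), (10,
   [(10, C0), (4, C0), (6, C0)]), (11, [(10, C2), (4, C2), (6, C2)]), (12, [(10, C3), (4, C3), (6, C3)]), (13,
   [(10, C2), (6, C2), (52, C2)]), (14, [(10, C3), (6, C3), (52, C3)]), (15, [(3, C1), (7, C1), (2, C1)]),
   (16, [(3, C3), (7, C3), (2, C3)]), (17, [(3, C1), (2, C1), (20, C1)]), (18, [(26, C0), (31, C0), (41,
   C0)]), (19, [(26, C2), (31, C2), (41, C2)]), (20, [(26, C3), (31, C3), (41, C3)]), (21, [(36, C0), (30,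
   C0), (26, C0)]), (22, [(36, C2), (30, C2), (26, C2)]), (23, [(36, C3), (30, C3), (26, C3)]), (24, [(21,
   C1), (1, C1), (25, C1)]), (25, [(19, C0), (40, C0), (43, C0)]), (26, [(19, C2), (40, C2), (43, C2)]), (27,
   [(19, C3), (40, C3), (43, C3)]), (28, [(34, C0), (19, C0), (35, C0)]), (29, [(34, C2), (19, C2), (35,
   C2)]), (30, [(34, C3), (19, C3), (35, C3)]), (31, [(1, C1), (17, C1), (11, C1)]), (32, [(1, C2), (17, C2),
   (11, C2)]), (33, [(1, C3), (17, C3), (11, C3)]), (34, [(1, C0), (11, C0), (14, C0)]), (35, [(23, C1), (42,
   C1), (38, C1)]), (36, [(23, C2), (42, C2), (38, C2)]), (37, [(23, C3), (42, C3), (38, C3)]), (38, [(28,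
   C1), (33, C1), (23, C1)]), (39, [(28, C2), (33, C2), (23, C2)]), (40, [(28, C3), (33, C3), (23, C3)]), (41,
   [(18, C0), (29, C0), (1, C0)]), (42, [(22, C1), (39, C1), (37, C1)]), (43, [(22, C2), (39, C2), (37, C2)]),
   (44, [(22, C3), (39, C3), (37, C3)]), (45, [(32, C1), (22, C1), (27, C1)]), (46, [(32, C2), (22, C2), (27,
   C2)]), (47, [(32, C3), (22, C3), (27, C3)]), (48, [(5, C1), (54, C1), (8, C1)]), (49, [(47, C0), (9, C0),
   (3, C0)]), (50, [(12, C1), (15, C1), (1, C1)]), (51, [(12, C2), (15, C2), (1, C2)]), (52, [(12, C3), (15,
   C3), (1, C3)]), (53, [(12, C0), (1, C0), (13, C0)]), (54, [(12, C3), (1, C3), (13, C3)]), (55, [(4, C0),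
   (24, C0), (5, C0)]), (56, [(4, C2), (5, C2), (6, C2)]), (57, [(4, C3), (5, C3), (6, C3)]), (58, [(7, C2),
   (51, C2), (16, C2)]), (59, [(7, C3), (51, C3), (16, C3)]), (60, [(7, C1), (16, C1), (2, C1)]), (61, [(7,
   C2), (16, C2), (2, C2)]), (62, [(7, C3), (16, C3), (2, C3)]), (63, [(55, C1), (4, C1), (10, C1)]), (64,
   [(9, C2), (50, C2), (7, C2)]), (65, [(9, C3), (50, C3), (7, C3)]), (66, [(9, C1), (7, C1), (3, C1)]), (67,
   [(9, C2), (7, C2), (3, C2)]), (68, [(9, C3), (7, C3), (3, C3)]), (69, [(15, C1), (17, C1), (1, C1)]), (70,
   [(15, C2), (17, C2), (1, C2)]), (71, [(24, C0), (45, C0), (5, C0)]), (72, [(44, C0), (24, C0), (4, C0)])]"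

lemma diagonal_edges_ok: "edges_ok double_apart (index diagonal_points Tip) diagonal_edges"
  unfolding diagonal_points_def diagonal_edges_def
  by (simp only: edges_simps double_apart.simps lattice_apart.simps lattice_norm.simps)

lemma diagonal_base_ok: "triangles_ok (index diagonal_points Tip) diagonal_base"
  unfolding diagonal_points_def diagonal_base_def
  by (simp only: edges_simps triangles_ok.simps mono_triangle.simps triangle.simps
      lattice_apart.simps lattice_norm.simps)

lemma diagonal_replay:
  "replay (index diagonal_edges Tip) diagonal_items (index diagonal_base Tip)
     (Some (suppose diagonal_start Tip)) = None"
  unfolding diagonal_edges_def diagonal_items_def diagonal_start_def diagonal_base_def
  by (simp only: check_simps)

lemma diagonal_start:
  "matches (seen h double_place (index diagonal_points Tip)) diagonal_start \<longleftrightarrow>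
     h (double_place (2, 0, 0, 0)) = C0 \<and> h (double_place (-2, 0, 0, 0)) = C1"
  unfolding diagonal_points_def diagonal_start_def
  by (simp only: matches_simps seen_num_of_nat check_simps coords_of.simps simp_thms)

lemma no_bichromatic_diagonal:
  assumes "proper_colouring h"
  shows "\<not> (h 2 = C0 \<and> h (-2) = C1)"
proof -
  have "\<not> matches (seen h double_place (index diagonal_points Tip)) diagonal_start"
    by (rule certificate_refutes[OF assms double_apart_dist diagonal_edges_ok
          triangles_excluded[OF assms diagonal_base_ok] diagonal_replay])
  moreover have "double_place (2, 0, 0, 0) = 2" "double_place (-2, 0, 0, 0) = -2"
    by (simp_all add: double_place_def)
  ultimately show ?thesis by (simp add: diagonal_start)
qed

section \<open>Contradiction at distance 4 and transfer to the real plane\<close>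

lemma diagonal_mono:
  assumes "proper_colouring g" "cmod (p - q) = 4" shows "g p = g q"
proof (rule ccontr)
  assume ne: "g p \<noteq> g q"
  \<comment> \<open>The third colour completes the triple that \<open>recolour\<close>
    expects.\<close>
  then obtain c where "distinct [g p, g q, c]"
    by (metis (full_types) distinct_length_2_or_more distinct_singleton colour.distinct)
  then obtain \<pi> where \<pi>: "inj \<pi>" "\<pi> (g p) = C0" "\<pi> (g q) = C1" using recolour by metis
  have "cmod ((p - q) / 4) = 1" using assms(2) by (simp add: norm_divide)
  \<comment> \<open>This isometry takes 2 to \<open>p\<close> and -2 to \<open>q\<close>.\<close>
  from proper_colouring_transform[OF assms(1) this \<pi>(1), of "(p + q) / 2"]
  have "proper_colouring (\<lambda>x. \<pi> (g ((p + q) / 2 + (p - q) / 4 * x)))" .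
  from no_bichromatic_diagonal[OF this] \<pi> show False by (simp add: field_simps)
qed

theorem no_proper_colouring: "\<not> proper_colouring g"
proof
  assume *: "proper_colouring g"
  \<comment> \<open>The apex angle of the isosceles triangle with sides 4, 4, 1 has cosine 1 - 1/32
    = 31/32, and 4 times this is 31/8.\<close>
  let ?q = "Complex (31/8) (sqrt 63 / 8)"
  have "cmod (0 - 4) = 4" "cmod (0 - ?q) = 4" "cmod (4 - ?q) = 1"
    by (simp_all add: cmod_def power_divide)
  then show False using diagonal_mono[OF *] proper_colouringD[OF *] by metis
qed

theorem corollary2:
  "chromatic_number_plane \<ge> 5 \<and>
   \<not> (\<exists>c :: real ^ 2 \<Rightarrow> nat. (\<forall>x. c x \<in> {1, 2, 3, 4}) \<and>
        (\<forall>x y. norm (x - y) = 1 \<longrightarrow> c x \<noteq> c y))"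
proof -
  have no: "\<not> (\<exists>c :: real ^ 2 \<Rightarrow> nat. (\<forall>x. c x \<in> {1, 2, 3, 4}) \<and>
        (\<forall>x y. norm (x - y) = 1 \<longrightarrow> c x \<noteq> c y))"
  proof
    assume "\<exists>c :: real ^ 2 \<Rightarrow> nat. (\<forall>x. c x \<in> {1, 2, 3, 4}) \<and>
        (\<forall>x y. norm (x - y) = 1 \<longrightarrow> c x \<noteq> c y)"
    then obtain c :: "real ^ 2 \<Rightarrow> nat" where c: "\<And>x. c x \<in> {1, 2, 3, 4}"
      "\<And>x y. norm (x - y) = 1 \<Longrightarrow> c x \<noteq> c y" by blast
    \<comment> \<open>The number 4 shares \<open>C3\<close> with all numbers that are not colours,
      so injectivity holds on the range of \<open>c\<close> only.\<close>
    define \<kappa> :: "nat \<Rightarrow> colour" where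
      "\<kappa> n = (if n = 1 then C0 else if n = 2 then C1 else if n = 3 then C2 else C3)" for n
    have \<kappa>: "inj_on \<kappa> {1, 2, 3, 4}" by (auto simp: inj_on_def \<kappa>_def)
    \<comment> \<open>Complex numbers turn rotations into multiplications; this isometry carries the
      result over to \<open>real ^ 2\<close>.\<close>
    define plane :: "complex \<Rightarrow> real ^ 2" where "plane z = vector [Re z, Im z]" for z
    have "norm (plane z - plane w) = cmod (z - w)" for z w
      by (simp add: plane_def norm_vec_def L2_set_def sum_2 cmod_def)
    then have "proper_colouring (\<lambda>z. \<kappa> (c (plane z)))"
      unfolding proper_colouring_def using c inj_onD[OF \<kappa>] by metis
    then show False using no_proper_colouring by blast
  qed
  have "enat n \<ge> 5" if "plane_coloring n c" for n c
  proof (rule ccontr)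
    assume "\<not> enat n \<ge> 5"
    then have "n \<le> 4" by (simp add: numeral_eq_enat)
    \<comment> \<open>A colouring with fewer colours is also one with four, so excluding four
      colours settles every \<open>n \<le> 4\<close>.\<close>
    then have "{1..n} \<subseteq> {1, 2, 3, 4}" by auto
    with that no show False unfolding plane_coloring_def by blast
  qed
  then have "chromatic_number_plane \<ge> 5"
    unfolding chromatic_number_plane_def by (auto intro!: Inf_greatest)
  with no show ?thesis by blast
qed

end
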